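(* Let $n\ge 2$ be an integer. The embedding $\phi_*: T_n \hookrightarrow T_2$ given by caret replacement is a quasi-isometric embedding, where $T_n$ and $T_2$ carry the word metrics with respect to finite generating sets.
   Context: **The groups $T_n$.** For an integer $n\ge 2$, an $n$-adic subdivision of $[0,1]$ is a subdivision of $[0,1]$ into finitely many subintervals of the form $[\ell/n^k,(\ell+1)/n^k]$ with $k,\ell\ge 0$ integers and $\ell+1\le n^k$. Let $S^1=[0,1]/(0\sim 1)$; an $n$-adic subdivision of $S^1$ is one induced by an $n$-adic subdivision of $[0,1]$. $T_n$ is the group of orientation-preserving piecewise-linear homeomorphisms of $S^1$ which map the intervals of some $n$-adic subdivision of $S^1$ onto the intervals of another one (with the same number of intervals), affinely on each interval. **Tree pairs.** An $n$-caret is a vertex with $n$ edges to $n$ ordered children. An $n$-ary tree is a finite rooted tree built from $n$-carets; it corresponds to an $n$-adic subdivision whose intervals are, from left to right, the leaves of the tree. A labelled $n$-ary tree pair $(\mathcal T,\mathcal S)$ consists of two $n$-ary trees with the same number of leaves (source tree $\mathcal T$, target tree $\mathcal S$), each with its leaves labelled cyclically by $0,1,2,\dots$: some leaf is labelled $0$, labels increase by one going right, and continue from the leftmost leaf after the rightmost one. It represents the element of $T_n$ mapping, for each $i$, the interval of the source leaf labelled $i$ affinely onto the interval of the target leaf labelled $i$. A simple expansion attaches an $n$-caret to the source leaf and to the target leaf with the same label (and relabels accordingly); simple contraction is the inverse operation. Elements of $T_n$ correspond to labelled tree pairs modulo simple expansions and contractions. **The map $\phi_*$.** An all-right binary tree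 is a binary tree in which every caret except the top one is attached to the rightmost leaf of the previous caret. Given a labelled $n$-ary tree pair, $\phi$ replaces every $n$-caret in both trees by the all-right binary tree with $n$ leaves, keeping the labelling of the leaves; the result is a labelled binary tree pair. $\phi$ is compatible with simple expansions and contractions and induces an injective group homomorphism $\phi_*:T_n\to T_2$. **Quasi-isometric embedding.** A map $f:(X,d_X)\to(Y,d_Y)$ is a quasi-isometric embedding if there are constants $K\ge1$, $C\ge0$ with $\frac1K d_X(x,x')-C\le d_Y(f(x),f(x'))\le K d_X(x,x')+C$ for all $x,x'\in X$. The groups $T_n$ are finitely generated, and the property does not depend on the choice of finite generating sets. *)

theory Defs
  imports "HOL-Analysis.Analysis" "HOL-Algebra.Bij" "HOL-Algebra.Generated_Groups"
begin

section \<open>The circle\<close>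

text \<open>
  A point of \<open>[0,1]/(0 \<sim> 1)\<close> is given by its representative in \<open>[0,1)\<close>, so that the
  projection from \<open>[0,1]\<close> is \<^const>\<open>frac\<close>; the topology is the quotient topology.
\<close>

definition circle :: "real set" where
  "circle = {0..<1}"

definition circle_topology :: "real topology" where
  "circle_topology = topology (\<lambda>U. U \<subseteq> circle \<and>
     openin (top_of_set {0..1}) {t \<in> {0..1}. frac t \<in> U})"

lemma openin_circle_topology:
  "openin circle_topology U \<longleftrightarrow>
     U \<subseteq> circle \<and> openin (top_of_set {0..1}) {t \<in> {0..1}. frac t \<in> U}"
proof -
  have "istopology (\<lambda>U. U \<subseteq> circle \<and>
          openin (top_of_set {0..1::real}) {t \<in> {0..1}. frac t \<in> U})"
    unfolding istopology_def
  proof (rule conjI; intro allI impI conjI)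
    fix S U :: "real set"
    assume S: "S \<subseteq> circle \<and> openin (top_of_set {0..1}) {t \<in> {0..1}. frac t \<in> S}"
      and U: "U \<subseteq> circle \<and> openin (top_of_set {0..1}) {t \<in> {0..1}. frac t \<in> U}"
    show "S \<inter> U \<subseteq> circle" using S by blast
    have "{t \<in> {0..1}. frac t \<in> S \<inter> U} =
        {t \<in> {0..1}. frac t \<in> S} \<inter> {t \<in> {0..1}. frac t \<in> U}" by blast
    then show "openin (top_of_set {0..1}) {t \<in> {0..1}. frac t \<in> S \<inter> U}"
      using S U by (simp only: openin_Int)
  next
    fix \<K> :: "real set set"
    assume *: "\<forall>K\<in>\<K>. K \<subseteq> circle \<and> openin (top_of_set {0..1}) {t \<in> {0..1}. frac t \<in> K}"
    show "\<Union>\<K> \<subseteq> circle" using * by blast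
    have "{t \<in> {0..1}. frac t \<in> \<Union>\<K>} = (\<Union>K\<in>\<K>. {t \<in> {0..1}. frac t \<in> K})" by blast
    then show "openin (top_of_set {0..1}) {t \<in> {0..1}. frac t \<in> \<Union>\<K>}"
      using * by (simp only:) (rule openin_Union, auto)
  qed
  then show ?thesis
    unfolding circle_topology_def by (simp only: topology_inverse')
qed

lemma topspace_circle_topology [simp]: "topspace circle_topology = circle"
proof
  show "topspace circle_topology \<subseteq> circle"
    unfolding topspace_def by (auto simp: openin_circle_topology)
  have "{t \<in> {0..1::real}. frac t \<in> circle} = {0..1}"
    by (auto simp: circle_def frac_lt_1)
  then have "openin circle_topology circle"
    by (simp only: openin_circle_topology) simp
  then show "circle \<subseteq> topspace circle_topology"
    by (rule openin_subset)
qed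

lemma quotient_map_frac: "quotient_map (top_of_set {0..1}) circle_topology frac"
proof -
  have "frac ` {0..1::real} = circle"
  proof
    show "frac ` {0..1::real} \<subseteq> circle" by (auto simp: circle_def frac_lt_1)
    show "circle \<subseteq> frac ` {0..1::real}"
    proof
      fix x assume x: "x \<in> circle"
      then have "frac x = x" by (simp add: circle_def frac_eq)
      then show "x \<in> frac ` {0..1}" using x by (force simp: circle_def)
    qed
  qed
  then show ?thesis
    unfolding quotient_map_def by (auto simp: openin_circle_topology)
qed


section \<open>The groups \<open>T\<^sub>n\<close>\<close>

definition nadic_interval :: "nat \<Rightarrow> real set \<Rightarrow> bool" where
  "nadic_interval n K \<longleftrightarrow>
     (\<exists>k l :: nat. l + 1 \<le> n ^ k \<and> K = {real l / real n ^ k .. real (l + 1) / real n ^ k})"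

definition nadic_subdivision :: "nat \<Rightarrow> real set set \<Rightarrow> bool" where
  "nadic_subdivision n D \<longleftrightarrow> D division_of {0..1} \<and> (\<forall>K\<in>D. nadic_interval n K)"

text \<open>
  \<open>K\<close> and \<open>L\<close> are intervals in \<open>[0,1]\<close>, the map \<open>f\<close> acts on their images in the circle.
  The slope \<open>r\<close> is positive since only orientation-preserving maps are considered.
\<close>

definition maps_affinely_onto :: "(real \<Rightarrow> real) \<Rightarrow> real set \<Rightarrow> real set \<Rightarrow> bool" where
  "maps_affinely_onto f K L \<longleftrightarrow>
     (\<exists>r s. r > 0 \<and> (\<lambda>t. r * t + s) ` K = L \<and> (\<forall>t\<in>K. f (frac t) = frac (r * t + s)))"

definition thompson_T :: "nat \<Rightarrow> (real \<Rightarrow> real) monoid" where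
  "thompson_T n = BijGroup circle \<lparr>carrier :=
     {f \<in> Bij circle. homeomorphic_map circle_topology circle_topology f \<and>
        (\<exists>D E \<pi>. nadic_subdivision n D \<and> nadic_subdivision n E \<and> bij_betw \<pi> D E \<and>
           (\<forall>K\<in>D. maps_affinely_onto f K (\<pi> K)))}\<rparr>"


section \<open>Labelled tree pairs\<close>

datatype ltree = Leaf nat | Caret "ltree list"

fun nary :: "nat \<Rightarrow> ltree \<Rightarrow> bool" where
  "nary n (Leaf i) \<longleftrightarrow> True"
| "nary n (Caret ts) \<longleftrightarrow> length ts = n \<and> (\<forall>t\<in>set ts. nary n t)"

fun leaf_labels :: "ltree \<Rightarrow> nat list" where
  "leaf_labels (Leaf i) = [i]"
| "leaf_labels (Caret ts) = concat (map leaf_labels ts)"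

definition cyclically_labelled :: "ltree \<Rightarrow> bool" where
  "cyclically_labelled t \<longleftrightarrow> (\<exists>k. leaf_labels t = rotate k [0..<length (leaf_labels t)])"

definition labelled_tree_pair :: "nat \<Rightarrow> ltree \<times> ltree \<Rightarrow> bool" where
  "labelled_tree_pair n = (\<lambda>(S, R). nary n S \<and> nary n R \<and>
     length (leaf_labels S) = length (leaf_labels R) \<and>
     cyclically_labelled S \<and> cyclically_labelled R)"

text \<open>
  \<open>leaf_interval t a b i K\<close>: when the root of \<open>t\<close> is the interval \<open>[a,b]\<close>, some leaf of \<open>t\<close>
  with label \<open>i\<close> is the interval \<open>K\<close>. A caret divides its interval into equal parts.
\<close>

inductive leaf_interval :: "ltree \<Rightarrow> real \<Rightarrow> real \<Rightarrow> nat \<Rightarrow> real set \<Rightarrow> bool" where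
  "leaf_interval (Leaf i) a b i {a..b}"
| "j < length ts \<Longrightarrow>
   leaf_interval (ts ! j) (a + real j * ((b - a) / real (length ts)))
     (a + real (j + 1) * ((b - a) / real (length ts))) i K \<Longrightarrow>
   leaf_interval (Caret ts) a b i K"

definition represents :: "nat \<Rightarrow> ltree \<times> ltree \<Rightarrow> (real \<Rightarrow> real) \<Rightarrow> bool" where
  "represents n = (\<lambda>(S, R) f. labelled_tree_pair n (S, R) \<and> f \<in> carrier (thompson_T n) \<and>
     (\<forall>i K L. leaf_interval S 0 1 i K \<longrightarrow> leaf_interval R 0 1 i L \<longrightarrow> maps_affinely_onto f K L))"


section \<open>Caret replacement\<close>

text \<open>
  \<open>all_right [t\<^sub>1, \<dots>, t\<^sub>n]\<close> is the all-right binary tree with \<open>n\<close> leaves whose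
  \<open>i\<close>-th leaf is replaced by \<open>t\<^sub>i\<close>. The value at \<open>[]\<close> is irrelevant.
\<close>

fun all_right :: "ltree list \<Rightarrow> ltree" where
  "all_right [] = Caret []"
| "all_right [t] = t"
| "all_right (t # u # ts) = Caret [t, all_right (u # ts)]"

fun caret_replacement :: "ltree \<Rightarrow> ltree" where
  "caret_replacement (Leaf i) = Leaf i"
| "caret_replacement (Caret ts) = all_right (map caret_replacement ts)"

text \<open>The image of \<open>f\<close> does not depend on the tree pair chosen to represent \<open>f\<close>.\<close>

definition phi_star :: "nat \<Rightarrow> (real \<Rightarrow> real) \<Rightarrow> (real \<Rightarrow> real)" where
  "phi_star n f = (THE g. \<exists>S R. represents n (S, R) f \<and>
     represents 2 (caret_replacement S, caret_replacement R) g)"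


section \<open>Word metrics and quasi-isometric embeddings\<close>

definition finite_generating_set :: "('a, 'b) monoid_scheme \<Rightarrow> 'a set \<Rightarrow> bool" where
  "finite_generating_set G A \<longleftrightarrow> finite A \<and> A \<subseteq> carrier G \<and> generate G A = carrier G"

definition word_length :: "('a, 'b) monoid_scheme \<Rightarrow> 'a set \<Rightarrow> 'a \<Rightarrow> nat" where
  "word_length G A g = (LEAST k. \<exists>ws. length ws = k \<and> set ws \<subseteq> A \<union> m_inv G ` A \<and>
     foldr (mult G) ws \<one>\<^bsub>G\<^esub> = g)"

definition word_metric :: "('a, 'b) monoid_scheme \<Rightarrow> 'a set \<Rightarrow> 'a \<Rightarrow> 'a \<Rightarrow> real" where
  "word_metric G A g h = real (word_length G A (inv\<^bsub>G\<^esub> g \<otimes>\<^bsub>G\<^esub> h))"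

definition quasi_isometric_embedding ::
  "'a set \<Rightarrow> ('a \<Rightarrow> 'a \<Rightarrow> real) \<Rightarrow> 'b set \<Rightarrow> ('b \<Rightarrow> 'b \<Rightarrow> real) \<Rightarrow> ('a \<Rightarrow> 'b) \<Rightarrow> bool" where
  "quasi_isometric_embedding X dX Y dY f \<longleftrightarrow> f \<in> X \<rightarrow> Y \<and>
     (\<exists>K C. K \<ge> 1 \<and> C \<ge> 0 \<and>
        (\<forall>x\<in>X. \<forall>x'\<in>X. 1 / K * dX x x' - C \<le> dY (f x) (f x') \<and>
                         dY (f x) (f x') \<le> K * dX x x' + C))"

end

theory Submission
  imports Defs
begin

text \<open>
  Points of the circle are coded by digit sequences. Replacing every digit \<open>j < n - 1\<close> by
  \<open>1\<^sup>j 0\<close> and the digit \<open>n - 1\<close> by \<open>1\<^bsup>n-1\<^esup>\<close> defines an increasing bijection of the circle that maps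
  each \<open>n\<close>-adic interval onto a dyadic one by a rescaled copy of itself, and \<open>\<phi>\<^sub>*\<close> is the
  conjugation by this bijection. So \<open>\<phi>\<^sub>*\<close> is a homomorphism, which gives the upper bound.

  For the lower bound, call an \<open>n\<close>-adic interval bad for \<open>f\<close> if \<open>f\<close> does not map it affinely onto an
  \<open>n\<close>-adic interval; the bad intervals are the carets of the reduced source tree of \<open>f\<close>. Their
  number is subadditive, hence at most linear in the word length. Caret replacement maps bad
  intervals of \<open>f\<close> to bad intervals of \<open>\<phi>\<^sub>* f\<close>, so the number of bad intervals cannot shrink. Finally
  the word length in \<open>T\<^sub>n\<close> is at most linear in the number of carets: any tree with a marked leaf is
  turned into the left comb whose first leaf is the marked one by a linear number of moves that
  change at most three carets at the root, and up to finitely many choices a move is an element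
  of \<open>T\<^sub>n\<close>.
\<close>

section \<open>Words and \<open>n\<close>-adic intervals\<close>

text \<open>Adjacent closed intervals share endpoints and the circle identifies 0 with 1, so
  piecewise definitions need care. Points are therefore located in half-open intervals, where two
  intervals that meet are nested, whereas affinity is demanded on closed intervals modulo
  \<open>frac\<close>, which already contains continuity at the joints. Membership in the group
  thereby becomes a condition on all words of one fixed length. Conjugation does not refer to tree
  pairs, so independence of the representing pair and multiplicativity come for free. What remains
  delicate is the lower bound: the replaced tree pair might admit reductions that the original one
  does not, because a dyadic interval may be mapped onto one that is not the image of any
  \<open>n\<close>-adic interval. That the codes form a prefix code with a single code free of 0
  excludes this. The generating sets are arbitrary. They enter only through bounds over finite sets:
  the numbers of bad intervals of the generators, the lengths of the images of generators, and the
  lengths of the finitely many moves.\<close>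

primrec aff :: "nat \<Rightarrow> nat list \<Rightarrow> real \<Rightarrow> real" where
  "aff n [] x = x"
| "aff n (j # w) x = (real j + aff n w x) / real n"

text \<open>The parameter runs over the closed unit interval. Its value 1 forces the piece to have
  the right limit at its right end, so that pieces on neighbouring intervals fit together across the
  joint, including the joint at 0.\<close>

definition maps_word :: "nat \<Rightarrow> (real \<Rightarrow> real) \<Rightarrow> nat list \<Rightarrow> nat list \<Rightarrow> bool" where
  "maps_word n f w v \<longleftrightarrow> (\<forall>x\<in>{0..1}. f (frac (aff n w x)) = frac (aff n v x))"

definition words :: "nat \<Rightarrow> nat list set" where
  "words n = lists {..<n}"

lemma words_simps [simp]:
  "[] \<in> words n"
  "j # w \<in> words n \<longleftrightarrow> j < n \<and> w \<in> words n"
  "u @ v \<in> words n \<longleftrightarrow> u \<in> words n \<and> v \<in> words n"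
  by (auto simp: words_def)

lemma aff_append: "aff n (u @ v) x = aff n u (aff n v x)"
  by (induction u) auto

lemma aff_eq: "aff n w x = aff n w 0 + x / real n ^ length w"
proof (induction w)
  case (Cons j w)
  then show ?case by (simp add: add_divide_distrib ac_simps)
qed simp

lemma aff_less_iff: "n > 0 \<Longrightarrow> aff n w x < aff n w y \<longleftrightarrow> x < y"
  by (subst (1 2) aff_eq) (simp add: divide_less_cancel)

lemma aff_eq_iff: "n > 0 \<Longrightarrow> aff n w x = aff n w y \<longleftrightarrow> x = y"
  by (subst (1 2) aff_eq) simp

lemma aff_le_iff: "n > 0 \<Longrightarrow> aff n w x \<le> aff n w y \<longleftrightarrow> x \<le> y"
  by (subst (1 2) aff_eq) (simp add: divide_le_cancel)

lemma aff_nonneg: "0 \<le> x \<Longrightarrow> 0 \<le> aff n w x"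
  by (induction w) auto

lemma aff_le_1: "w \<in> words n \<Longrightarrow> x \<le> 1 \<Longrightarrow> aff n w x \<le> 1"
proof (induction w)
  case (Cons j w)
  then have "aff n w x \<le> 1" "real j \<le> real n - 1" "n > 0" by auto
  then show ?case by (simp add: divide_simps)
qed simp

lemma aff_less_1: "w \<in> words n \<Longrightarrow> x < 1 \<Longrightarrow> aff n w x < 1"
proof (induction w)
  case (Cons j w)
  then have "aff n w x < 1" "real j \<le> real n - 1" "n > 0" by auto
  then show ?case by (simp add: divide_simps)
qed simp

lemma aff_unit: "w \<in> words n \<Longrightarrow> x \<in> {0..1} \<Longrightarrow> aff n w x \<in> {0..1}"
  by (simp add: aff_nonneg aff_le_1)

lemma aff_circle: "w \<in> words n \<Longrightarrow> x \<in> circle \<Longrightarrow> aff n w x \<in> circle"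
  by (simp add: aff_nonneg aff_less_1 circle_def)

lemma frac_circle: "x \<in> circle \<Longrightarrow> frac x = x"
  by (simp add: circle_def frac_eq)

lemma frac_in_circle: "frac x \<in> circle"
  by (simp add: circle_def frac_lt_1)

lemma circle_unit: "x \<in> circle \<Longrightarrow> x \<in> {0..1}"
  by (simp add: circle_def)

lemma maps_wordD: "maps_word n f w v \<Longrightarrow> x \<in> {0..1} \<Longrightarrow> f (frac (aff n w x)) = frac (aff n v x)"
  by (simp add: maps_word_def)

lemma maps_word_circle:
  "\<lbrakk>maps_word n f w v; w \<in> words n; v \<in> words n; x \<in> circle\<rbrakk> \<Longrightarrow> f (aff n w x) = aff n v x"
  using maps_wordD[of n f w v x] circle_unit[of x] by (simp add: frac_circle aff_circle)

lemma word_value: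
  "w \<in> words n \<Longrightarrow> \<exists>l. l + 1 \<le> n ^ length w \<and> (\<forall>x. aff n w x = (real l + x) / real n ^ length w)"
proof (induction w)
  case (Cons j w)
  then obtain l where l: "l + 1 \<le> n ^ length w" "\<And>x. aff n w x = (real l + x) / real n ^ length w"
    and j: "j < n" by auto
  have "j * n ^ length w + l + 1 \<le> j * n ^ length w + n ^ length w" using l by simp
  also have "\<dots> = (j + 1) * n ^ length w" by simp
  also have "\<dots> \<le> n * n ^ length w" using j by (intro mult_right_mono) auto
  finally have 1: "(j * n ^ length w + l) + 1 \<le> n ^ length (j # w)" by simp
  have "aff n (j # w) x = (real (j * n ^ length w + l) + x) / real n ^ length (j # w)" for x
    using j by (simp add: l field_simps)
  with 1 show ?case by blast
qed simp

lemma ex_word_value: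
  "l < n ^ k \<Longrightarrow> \<exists>w\<in>words n. length w = k \<and> (\<forall>x. aff n w x = (real l + x) / real n ^ k)"
proof (induction k arbitrary: l)
  case (Suc k)
  then have n: "n > 0" by (cases n) auto
  define j where "j = l div n ^ k"
  define l' where "l' = l mod n ^ k"
  have l: "l = j * n ^ k + l'" by (simp add: j_def l'_def mult.commute)
  have "l' < n ^ k" using n by (simp add: l'_def)
  then obtain w where w: "w \<in> words n" "length w = k" "\<And>x. aff n w x = (real l' + x) / real n ^ k"
    using Suc.IH by blast
  have "j < n" using Suc.prems n by (simp add: j_def less_mult_imp_div_less)
  then have "j # w \<in> words n" using w by simp
  moreover have "aff n (j # w) x = (real l + x) / real n ^ Suc k" for x
    using n w by (simp add: l field_simps)
  ultimately show ?case using w(2) by (intro bexI[of _ "j # w"]) auto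
qed simp

lemma ex_word_circle:
  assumes "n > 0" "x \<in> circle"
  shows "\<exists>w\<in>words n. length w = k \<and> (\<exists>y\<in>circle. x = aff n w y)"
proof -
  define l where "l = nat \<lfloor>x * real n ^ k\<rfloor>"
  have x: "0 \<le> x" "x < 1" using assms by (auto simp: circle_def)
  have p: "real n ^ k > 0" using assms by simp
  have le: "real l \<le> x * real n ^ k" using x p by (simp add: l_def)
  have lt: "x * real n ^ k < real l + 1" using x p by (simp add: l_def; linarith)
  have "real l < real (n ^ k)" using le x p by (smt (verit) mult_less_cancel_right2 of_nat_power)
  then have "l < n ^ k" by linarith
  then obtain w where w: "w \<in> words n" "length w = k" "\<And>x. aff n w x = (real l + x) / real n ^ k"
    using ex_word_value by blast
  have "x = aff n w (x * real n ^ k - real l)" using p by (simp add: w)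
  moreover have "x * real n ^ k - real l \<in> circle" using le lt by (simp add: circle_def)
  ultimately show ?thesis using w by blast
qed

text \<open>With parameters in \<open>[0,1)\<close> the first letter is the integer part of
  \<open>n\<close> times the point, so a common point determines the letters one after the other
  until the shorter word ends.\<close>

lemma aff_eq_imp_prefix:
  "\<lbrakk>aff n u x = aff n v y; x \<in> circle; y \<in> circle; u \<in> words n; v \<in> words n; length u \<le> length v\<rbrakk>
    \<Longrightarrow> \<exists>t\<in>words n. v = u @ t"
proof (induction u arbitrary: v)
  case (Cons a u)
  then obtain b v' where v: "v = b # v'" by (cases v) auto
  have n: "n > 0" using Cons.prems by auto
  have e: "real a + aff n u x = real b + aff n v' y"
    using Cons.prems(1) n by (simp add: v)
  have c: "aff n u x \<in> circle" "aff n v' y \<in> circle"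
    using Cons.prems by (auto simp: v intro!: aff_circle)
  then have "a = b" using e by (auto simp: circle_def)
  moreover from this have "aff n u x = aff n v' y" using e by simp
  then have "\<exists>t\<in>words n. v' = u @ t" using Cons by (auto simp: v)
  ultimately show ?case by (auto simp: v)
qed auto

lemma aff_eq_imp_eq:
  "\<lbrakk>aff n u x = aff n v y; x \<in> circle; y \<in> circle; u \<in> words n; v \<in> words n; length u = length v\<rbrakk>
    \<Longrightarrow> u = v"
  using aff_eq_imp_prefix[of n u x v y] by auto

text \<open>The difference of the values at 0 and 1/2 reveals the length of the interval, hence of
  the word; among words of equal length the left endpoint decides.\<close>

lemma aff_inj:
  assumes "n \<ge> 2" "u \<in> words n" "v \<in> words n" "\<And>x. x \<in> circle \<Longrightarrow> aff n u x = aff n v x"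
  shows "u = v"
proof -
  have "aff n u 0 = aff n v 0" "aff n u (1/2) = aff n v (1/2)"
    using assms(4)[of 0] assms(4)[of "1/2"] by (auto simp: circle_def)
  then have "1 / 2 / real n ^ length u = 1 / 2 / real n ^ length v"
    using aff_eq[of n u "1/2"] aff_eq[of n v "1/2"] by linarith
  then have "real n ^ length u = real n ^ length v"
    using assms(1) by (simp add: divide_simps)
  then have "length u = length v" using assms(1) by (subst (asm) power_inject_exp) auto
  then show ?thesis using aff_eq_imp_eq[of n u 0 v 0] assms \<open>aff n u 0 = aff n v 0\<close>
    by (simp add: circle_def)
qed

lemma maps_word_append:
  assumes "maps_word n f w v" "u \<in> words n"
  shows "maps_word n f (w @ u) (v @ u)"
  unfolding maps_word_def aff_append
  by (intro ballI maps_wordD[OF assms(1)] aff_unit assms(2))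

lemma maps_word_target_unique:
  assumes "n \<ge> 2" "w \<in> words n" "v \<in> words n" "v' \<in> words n" "maps_word n f w v" "maps_word n f w v'"
  shows "v = v'"
proof (rule aff_inj[OF assms(1,3,4)])
  fix x assume "x \<in> circle"
  then show "aff n v x = aff n v' x"
    using maps_word_circle[OF assms(5,2,3)] maps_word_circle[OF assms(6,2,4)] by simp
qed

lemma maps_word_compose_circle:
  "maps_word n g w v \<Longrightarrow> maps_word n f v u \<Longrightarrow> maps_word n (compose circle f g) w u"
  by (auto simp: maps_word_def compose_def frac_in_circle)

lemma maps_word_source_unique:
  assumes "n \<ge> 2" "w \<in> words n" "w' \<in> words n" "v \<in> words n" "maps_word n f w v" "maps_word n f w' v"
    "inj_on f circle"
  shows "w = w'"
proof (rule aff_inj[OF assms(1,2,3)])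
  fix x assume x: "x \<in> circle"
  then have "f (aff n w x) = f (aff n w' x)" using assms by (simp add: maps_word_circle)
  then show "aff n w x = aff n w' x"
    by (rule inj_onD[OF assms(7)]) (use x assms in \<open>auto intro: aff_circle\<close>)
qed

lemma maps_word_inv:
  assumes "bij_betw f circle circle" "maps_word n f w v"
  shows "maps_word n (restrict (inv_into circle f) circle) v w"
  unfolding maps_word_def
proof
  fix x :: real assume "x \<in> {0..1}"
  then have "f (frac (aff n w x)) = frac (aff n v x)" by (rule maps_wordD[OF assms(2)])
  then show "restrict (inv_into circle f) circle (frac (aff n v x)) = frac (aff n w x)"
    using assms(1) by (metis bij_betw_inv_into_left frac_in_circle restrict_apply)
qed

section \<open>Affine maps between \<open>n\<close>-adic intervals\<close>

lemma aff_image: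
  assumes "n > 0"
  shows "aff n w ` {0..1} = {aff n w 0..aff n w 1}"
proof -
  have "(\<lambda>x. x / real n ^ length w + aff n w 0) ` {0..1} = {aff n w 0..aff n w 0 + 1 / real n ^ length w}"
    using assms by (simp add: image_affinity_atLeastAtMost_div)
  moreover have "aff n w = (\<lambda>x. x / real n ^ length w + aff n w 0)"
    by (rule ext, subst aff_eq) simp
  moreover have "aff n w 1 = aff n w 0 + 1 / real n ^ length w" by (rule aff_eq)
  ultimately show ?thesis by metis
qed

lemma nadic_interval_iff_word:
  assumes "n > 0"
  shows "nadic_interval n K \<longleftrightarrow> (\<exists>w\<in>words n. K = aff n w ` {0..1})"
proof
  assume "nadic_interval n K"
  then obtain k l where l: "l + 1 \<le> n ^ k" "K = {real l / real n ^ k .. real (l + 1) / real n ^ k}"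
    unfolding nadic_interval_def by blast
  then obtain w where "w \<in> words n" "length w = k" "\<And>x. aff n w x = (real l + x) / real n ^ k"
    using ex_word_value[of l n k] by auto
  then have "K = aff n w ` {0..1}" using l by (simp only: aff_image[OF assms]) (simp add: add.commute)
  then show "\<exists>w\<in>words n. K = aff n w ` {0..1}" using \<open>w \<in> words n\<close> by blast
next
  assume "\<exists>w\<in>words n. K = aff n w ` {0..1}"
  then obtain w where w: "w \<in> words n" "K = aff n w ` {0..1}" by blast
  obtain l where "l + 1 \<le> n ^ length w" "\<And>x. aff n w x = (real l + x) / real n ^ length w"
    using word_value[OF w(1)] by blast
  then show "nadic_interval n K" unfolding nadic_interval_def
    using aff_image[OF assms, of w] w(2) by (intro exI[of _ "length w"] exI[of _ l]) (simp add: add.commute)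
qed

lemma affine_image_endpoints:
  fixes a b c d r s :: real
  assumes "r > 0" "a \<le> b" "c \<le> d" "(\<lambda>t. r * t + s) ` {a..b} = {c..d}"
  shows "r * a + s = c" "r * b + s = d"
proof -
  have "{r * a + s..r * b + s} = {c..d}"
    using assms by (auto simp: image_affinity_atLeastAtMost)
  moreover have "r * a + s \<le> r * b + s" using assms by simp
  ultimately show "r * a + s = c" "r * b + s = d" by (auto simp: Icc_eq_Icc)
qed

text \<open>An increasing affine map between two given intervals is determined by the endpoints, so
  slope and offset are forced and the map carries the standard parametrization of one interval to
  that of the other.\<close>

lemma maps_affinely_onto_iff:
  assumes n: "n > 0"
  shows "maps_affinely_onto f (aff n w ` {0..1}) (aff n v ` {0..1}) \<longleftrightarrow> maps_word n f w v" (is "?L \<longleftrightarrow> ?R")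
proof -
  define q where "q u = real n ^ length u" for u :: "nat list"
  have q: "q u > 0" for u using n by (simp add: q_def)
  have af: "aff n u x = aff n u 0 + x / q u" for u x unfolding q_def by (rule aff_eq)
  show ?thesis
  proof
    assume ?L
    then obtain r s where rs: "r > 0" "(\<lambda>t. r * t + s) ` (aff n w ` {0..1}) = aff n v ` {0..1}"
      "\<forall>t\<in>aff n w ` {0..1}. f (frac t) = frac (r * t + s)"
      unfolding maps_affinely_onto_def by (elim exE conjE)
    have "r * aff n w 0 + s = aff n v 0" "r * aff n w 1 + s = aff n v 1"
      using affine_image_endpoints[OF rs(1) _ _ rs(2)[unfolded aff_image[OF n]]]
      by (simp_all add: aff_le_iff[OF n])
    then have e: "r * aff n w 0 + s = aff n v 0"
      and "r * (aff n w 0 + 1 / q w) + s = aff n v 0 + 1 / q v"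
      using af[of w 1] af[of v 1] by simp_all
    then have e': "r / q w = 1 / q v" by (simp add: distrib_left)
    have "r * aff n w x + s = aff n v x" for x
    proof -
      have "r * aff n w x + s = (r * aff n w 0 + s) + (r / q w) * x"
        unfolding af[of w x] by (simp add: distrib_left)
      also have "\<dots> = aff n v 0 + x / q v" unfolding e e' by simp
      finally show ?thesis by (simp add: af[of v x])
    qed
    then show ?R using rs(3) by (auto simp: maps_word_def)
  next
    assume m: ?R
    define r where "r = q w / q v"
    define s where "s = aff n v 0 - r * aff n w 0"
    have e: "r * aff n w x + s = aff n v x" for x
      using q[of w] q[of v] unfolding s_def af[of w x] af[of v x] by (simp add: r_def field_simps)
    have "r > 0" using q by (simp add: r_def)
    moreover have "(\<lambda>t. r * t + s) ` (aff n w ` {0..1}) = aff n v ` {0..1}"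
      by (simp add: image_image e)
    moreover have "\<forall>t\<in>aff n w ` {0..1}. f (frac t) = frac (r * t + s)"
      using m by (auto simp: e maps_word_def)
    ultimately show ?L
      unfolding maps_affinely_onto_def by blast
  qed
qed

section \<open>Elements of \<open>T\<^sub>n\<close> as bijections that are affine on all words of
  some fixed length\<close>

definition good_word :: "nat \<Rightarrow> (real \<Rightarrow> real) \<Rightarrow> nat list \<Rightarrow> bool" where
  "good_word n f w \<longleftrightarrow> (\<exists>v\<in>words n. maps_word n f w v)"

text \<open>Any subdivision can be refined to a uniform one, so a single depth stands for the source
  subdivision. The target subdivision, the matching of the intervals and continuity are recovered
  from bijectivity.\<close>

definition tame :: "nat \<Rightarrow> (real \<Rightarrow> real) \<Rightarrow> bool" where
  "tame n f \<longleftrightarrow> (\<exists>k. \<forall>w\<in>words n. length w = k \<longrightarrow> good_word n f w)"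

lemma good_word_append: "good_word n f w \<Longrightarrow> u \<in> words n \<Longrightarrow> good_word n f (w @ u)"
  unfolding good_word_def by (metis maps_word_append words_simps(3))

lemma good_word_longer:
  assumes "\<And>w. w \<in> words n \<Longrightarrow> length w = k \<Longrightarrow> good_word n f w" "w \<in> words n" "length w \<ge> k"
  shows "good_word n f w"
proof -
  have "take k w \<in> words n" "drop k w \<in> words n"
    using assms(2) by (auto simp: words_def lists_eq_set dest: in_set_takeD in_set_dropD)
  then have "good_word n f (take k w @ drop k w)"
    using assms by (intro good_word_append) auto
  then show ?thesis by simp
qed

lemma finite_words_length: "finite {w \<in> words n. length w = k}"
  using finite_lists_length_eq[of "{..<n}" k] by (auto simp: words_def lists_eq_set)

text \<open>This version serves closed subdivision intervals: the second parameter may be the right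
  endpoint 1, which is compensated by a first parameter in the interior.\<close>

lemma aff_inner_prefix:
  assumes "n > 0" "u \<in> words n" "w \<in> words n" "length u \<le> length w" "0 < x" "x < 1"
    "y \<in> {0..1}" "aff n w x = aff n u y"
  shows "\<exists>t\<in>words n. w = u @ t"
proof (cases "y = 1")
  case False
  then have "y \<in> circle" "x \<in> circle" using assms by (auto simp: circle_def)
  then show ?thesis using aff_eq_imp_prefix[of n u y w x] assms by auto
next
  case True
  define k where "k = length u"
  have w: "w = take k w @ drop k w" "take k w \<in> words n" "drop k w \<in> words n"
    using assms(3) by (auto simp: words_def lists_eq_set dest: in_set_takeD in_set_dropD)
  define z where "z = aff n (drop k w) x"
  have z: "0 < z" "z < 1"
    using aff_less_iff[OF assms(1), of "drop k w" 0 x] aff_nonneg[of 0 n "drop k w"]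
      aff_less_1[OF w(3), of x] assms(5,6) by (auto simp: z_def)
  obtain l where l: "\<And>x. aff n (take k w) x = (real l + x) / real n ^ k"
    using word_value[OF w(2)] assms(4) by (auto simp: k_def)
  obtain m where m: "\<And>x. aff n u x = (real m + x) / real n ^ k"
    using word_value[OF assms(2)] by (auto simp: k_def)
  have wz: "aff n w x = aff n (take k w) z" unfolding z_def using w(1) by (metis aff_append)
  then have "(real l + z) / real n ^ k = (real m + 1) / real n ^ k"
    using assms(8) unfolding wz l m True by blast
  then have "real l + z = real m + 1"
    by (subst (asm) divide_cancel_right) (use assms(1) in auto)
  \<comment> \<open>An integer would lie strictly between 0 and 1, so the right endpoint cannot
    occur.\<close>
  then have "real_of_int (int m + 1 - int l) = z" by simp
  then have "int m + 1 - int l > 0" "int m + 1 - int l < 1" using z by linarith+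
  then show ?thesis by linarith
qed

lemma thompson_T_imp_tame:
  assumes n: "n \<ge> 2" and f: "f \<in> carrier (thompson_T n)"
  shows "f \<in> Bij circle" "tame n f"
proof -
  from f obtain D E \<pi> where D: "nadic_subdivision n D" "nadic_subdivision n E" "bij_betw \<pi> D E"
    "\<forall>K\<in>D. maps_affinely_onto f K (\<pi> K)" and fB: "f \<in> Bij circle"
    unfolding thompson_T_def by auto
  show "f \<in> Bij circle" by (rule fB)
  have n0: "n > 0" using n by simp
  have "\<forall>K\<in>D. \<exists>w\<in>words n. K = aff n w ` {0..1} \<and> good_word n f w"
  proof
    fix K assume K: "K \<in> D"
    then have "\<pi> K \<in> E" using D(3) by (auto simp: bij_betw_def)
    then obtain w v where wv: "w \<in> words n" "v \<in> words n" "K = aff n w ` {0..1}" "\<pi> K = aff n v ` {0..1}"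
      using D(1,2) K unfolding nadic_subdivision_def nadic_interval_iff_word[OF n0] by metis
    then have "maps_word n f w v" using D(4) K maps_affinely_onto_iff[OF n0] by metis
    then show "\<exists>w\<in>words n. K = aff n w ` {0..1} \<and> good_word n f w"
      using wv by (auto simp: good_word_def)
  qed
  then obtain W where W: "\<And>K. K \<in> D \<Longrightarrow> W K \<in> words n" "\<And>K. K \<in> D \<Longrightarrow> K = aff n (W K) ` {0..1}"
    "\<And>K. K \<in> D \<Longrightarrow> good_word n f (W K)"
    by metis
  have Df: "finite D" "\<Union>D = {0..1}" using D(1) by (auto simp: nadic_subdivision_def)
  \<comment> \<open>Any upper bound of the lengths would do; the sum is one that needs no
    maximum.\<close>
  define k where "k = (\<Sum>K\<in>D. length (W K))"
  have "good_word n f w" if w: "w \<in> words n" "length w = k" for w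
  proof -
    \<comment> \<open>The midpoint is an interior point, so the interval of \<open>D\<close>
      containing it contains the whole interval of \<open>w\<close>.\<close>
    have "aff n w (1/2) \<in> \<Union>D" unfolding Df by (rule aff_unit[OF w(1)]) simp
    then obtain K where K: "K \<in> D" "aff n w (1/2) \<in> K" by blast
    then obtain y where y: "y \<in> {0..1}" "aff n w (1/2) = aff n (W K) y" using W(2)[OF K(1)] by blast
    have "length (W K) \<le> length w" unfolding w(2) k_def
      using Df K by (intro member_le_sum) auto
    then obtain t where "t \<in> words n" "w = W K @ t"
      using aff_inner_prefix[OF n0 W(1)[OF K(1)] w(1) _ _ _ y] by auto
    then show ?thesis using W(3)[OF K(1)] good_word_append by simp
  qed
  then show "tame n f" by (auto simp: tame_def)
qed

lemma tame_wordmap: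
  assumes "tame n f"
  obtains k V where "\<And>w. w \<in> words n \<Longrightarrow> length w = k \<Longrightarrow> V w \<in> words n \<and> maps_word n f w (V w)"
  using assms unfolding tame_def good_word_def by metis

text \<open>The left endpoint of \<open>u\<close> has a preimage in some interval of depth
  \<open>k\<close>. The image of that interval and the interval of \<open>u\<close> share this point
  and are hence nested, and the length of \<open>u\<close> decides which one is inside. This turns
  statements about sources into statements about targets, for the inverse map and for the target
  subdivision.\<close>

lemma deep_word_in_image:
  assumes n: "n > 0" and f: "bij_betw f circle circle"
    and V: "\<And>w. w \<in> words n \<Longrightarrow> length w = k \<Longrightarrow> V w \<in> words n \<and> maps_word n f w (V w)"
    and u: "u \<in> words n" "length u = (\<Sum>w\<in>{w \<in> words n. length w = k}. length (V w))"
  shows "\<exists>w\<in>words n. length w = k \<and> (\<exists>t\<in>words n. u = V w @ t)"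
proof -
  have c0: "(0::real) \<in> circle" by (simp add: circle_def)
  have "aff n u 0 \<in> circle" by (rule aff_circle[OF u(1) c0])
  then obtain x where x: "x \<in> circle" "f x = aff n u 0"
    using f by (metis bij_betw_imp_surj_on imageE)
  obtain w y where w: "w \<in> words n" "length w = k" "y \<in> circle" "x = aff n w y"
    using ex_word_circle[OF n x(1), of k] by blast
  have e: "aff n (V w) y = aff n u 0"
    using maps_word_circle[of n f w "V w" y] V[OF w(1,2)] w x by simp
  have "length (V w) \<le> length u" unfolding u(2) using w finite_words_length by (intro member_le_sum) auto
  then show ?thesis using aff_eq_imp_prefix[OF e w(3) c0] V[OF w(1,2)] u(1) w by blast
qed

lemma tame_inv:
  assumes n: "n > 0" and f: "bij_betw f circle circle" "tame n f"
  shows "tame n (restrict (inv_into circle f) circle)"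
proof -
  obtain k V where V: "\<And>w. w \<in> words n \<Longrightarrow> length w = k \<Longrightarrow> V w \<in> words n \<and> maps_word n f w (V w)"
    using tame_wordmap[OF f(2)] by metis
  have "good_word n (restrict (inv_into circle f) circle) u"
    if u: "u \<in> words n" "length u = (\<Sum>w\<in>{w \<in> words n. length w = k}. length (V w))" for u
  proof -
    obtain w t where "w \<in> words n" "length w = k" "t \<in> words n" "u = V w @ t"
      using deep_word_in_image[OF n f(1) V u] by blast
    then have "maps_word n f (w @ t) u" "w @ t \<in> words n" using V maps_word_append by auto
    then show ?thesis using maps_word_inv[OF f(1)] unfolding good_word_def by blast
  qed
  then show ?thesis by (auto simp: tame_def)
qed

lemma tame_compose:
  assumes "n > 0" "tame n f" "tame n g" "bij_betw g circle circle"
  shows "tame n (compose circle f g)"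
proof -
  obtain k V where V: "\<And>w. w \<in> words n \<Longrightarrow> length w = k \<Longrightarrow> V w \<in> words n \<and> maps_word n g w (V w)"
    using tame_wordmap[OF assms(3)] by metis
  obtain k' where k': "\<And>w. w \<in> words n \<Longrightarrow> length w = k' \<Longrightarrow> good_word n f w"
    using assms(2) by (auto simp: tame_def)
  have "good_word n (compose circle f g) w" if w: "w \<in> words n" "length w = k + k'" for w
  proof -
    have t: "take k w \<in> words n" "drop k w \<in> words n" "w = take k w @ drop k w"
      using w(1) by (auto simp: words_def lists_eq_set dest: in_set_takeD in_set_dropD)
    \<comment> \<open>The letters after the first \<open>k\<close> reappear unchanged in the image,
      so \<open>v\<close> still has at least \<open>k'\<close> letters and \<open>f\<close> is
      affine on it.\<close>
    define v where "v = V (take k w) @ drop k w"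
    have v: "v \<in> words n" "maps_word n g w v"
      using V[OF t(1)] t w maps_word_append[OF _ t(2), of g "take k w" "V (take k w)"]
      by (auto simp: v_def)
    have "good_word n f v" by (rule good_word_longer[OF k' v(1)]) (use w in \<open>auto simp: v_def\<close>)
    then show ?thesis using v maps_word_compose_circle unfolding good_word_def by metis
  qed
  then show ?thesis by (auto simp: tame_def)
qed

lemma ex_word_unit:
  assumes "n > 0" "x \<in> {0..1}"
  shows "\<exists>w\<in>words n. length w = k \<and> (\<exists>y\<in>{0..1}. x = aff n w y)"
proof (cases "x = 1")
  case True
  have 1: "aff n (replicate m (n - 1)) 1 = 1" for m
    using assms(1) by (induction m) auto
  have 2: "replicate k (n - 1) \<in> words n" using assms(1) by (auto simp: words_def lists_eq_set)
  then show ?thesis using True 1[of k] by (intro bexI[OF _ 2] conjI bexI[of _ 1]) simp_all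
next
  case False
  then have "x \<in> circle" using assms by (auto simp: circle_def)
  then show ?thesis using ex_word_circle[OF assms(1)] circle_unit by metis
qed

text \<open>Continuity is checked on \<open>[0,1]\<close> before passing to the quotient. There the
  closed intervals of depth \<open>k\<close> are pasted: on each of them the map is
  \<open>frac\<close> after an affine map, and on overlaps the pieces agree because each of them
  equals \<open>f\<close> after \<open>frac\<close>.\<close>

lemma continuous_map_tame:
  assumes n: "n > 0" and f: "f \<in> Bij circle" "tame n f"
  shows "continuous_map circle_topology circle_topology f"
proof (rule continuous_compose_quotient_map[OF quotient_map_frac])
  obtain k V where V: "\<And>w. w \<in> words n \<Longrightarrow> length w = k \<Longrightarrow> V w \<in> words n \<and> maps_word n f w (V w)"
    using tame_wordmap[OF f(2)] by metis
  define I where "I = {w \<in> words n. length w = k}"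
  have VI: "w \<in> words n" "V w \<in> words n" "maps_word n f w (V w)" if "w \<in> I" for w
    using that V by (auto simp: I_def)
  define L where "L w x = (x - aff n w 0) * (real n ^ length w / real n ^ length (V w)) + aff n (V w) 0" for w x
  have L: "L w (aff n w y) = aff n (V w) y" for w y
    using n by (subst (2) aff_eq, subst (1) aff_eq) (simp add: L_def)
  show "continuous_map (top_of_set {0..1}) circle_topology (f \<circ> frac)"
  proof (rule pasting_lemma_closed)
    show "finite I" using finite_words_length by (simp add: I_def)
    show "closedin (top_of_set {0..1}) (aff n w ` {0..1})" if "w \<in> I" for w
      using aff_nonneg[of 0 n w] aff_le_1[OF VI(1)[OF that], of 1]
      by (auto simp: closedin_closed aff_image[OF n] intro!: exI[of _ "{aff n w 0..aff n w 1}"])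
    show "continuous_map (subtopology (top_of_set {0..1}) (aff n w ` {0..1})) circle_topology (frac \<circ> L w)"
      if "w \<in> I" for w
    proof (rule continuous_map_compose)
      have "continuous_on ({0..1} \<inter> aff n w ` {0..1}) (L w)"
        unfolding L_def by (intro continuous_intros)
      moreover have "L w x \<in> {0..1}" if "x \<in> aff n w ` {0..1}" for x
        using that L[of w] aff_unit[OF VI(2)[OF \<open>w \<in> I\<close>]] by auto
      ultimately show "continuous_map (subtopology (top_of_set {0..1}) (aff n w ` {0..1})) (top_of_set {0..1}) (L w)"
        by (auto simp: subtopology_subtopology)
      show "continuous_map (top_of_set {0..1}) circle_topology frac"
        by (rule quotient_imp_continuous_map[OF quotient_map_frac])
    qed
    have eq: "f (frac x) = frac (L w x)" if "w \<in> I" "x \<in> aff n w ` {0..1}" for w x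
      using that VI(3)[OF that(1)] L[of w] by (auto simp: maps_word_def)
    show "(frac \<circ> L w) x = (frac \<circ> L v) x"
      if "w \<in> I" "v \<in> I" "x \<in> topspace (top_of_set {0..1}) \<inter> aff n w ` {0..1} \<inter> aff n v ` {0..1}" for w v x
      using eq[of w x] eq[of v x] that by auto
    show "\<exists>w. w \<in> I \<and> x \<in> aff n w ` {0..1} \<and> (f \<circ> frac) x = (frac \<circ> L w) x"
      if "x \<in> topspace (top_of_set {0..1})" for x
      using ex_word_unit[OF n, of x k] that eq by (auto simp: I_def)
  qed
qed

lemma homeomorphic_map_tame:
  assumes n: "n > 0" and f: "f \<in> Bij circle" "tame n f"
  shows "homeomorphic_map circle_topology circle_topology f"
proof -
  let ?g = "restrict (inv_into circle f) circle"
  have b: "bij_betw f circle circle" using f(1) by (simp add: Bij_def)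
  have "homeomorphic_maps circle_topology circle_topology f ?g"
    unfolding homeomorphic_maps_def
    using b continuous_map_tame[OF n f] continuous_map_tame[OF n restrict_inv_into_Bij[OF f(1)] tame_inv[OF n b f(2)]]
    by (auto simp: bij_betw_inv_into_left bij_betw_inv_into_right bij_betwE)
  then show ?thesis using homeomorphic_map_maps by blast
qed

lemma interior_aff_image:
  assumes "n > 0" "x \<in> interior (aff n w ` {0..1})"
  shows "\<exists>y\<in>circle. x = aff n w y"
proof -
  have "x \<in> {aff n w 0<..<aff n w 1}" using assms(2) by (simp add: aff_image[OF assms(1)])
  moreover from this obtain y where y: "y \<in> {0..1}" "x = aff n w y"
    using aff_image[OF assms(1), of w] by (smt (verit) atLeastAtMost_iff greaterThanLessThan_iff image_iff)
  ultimately have "y < 1" by (auto simp: aff_less_iff[OF assms(1)])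
  then show ?thesis using y by (auto simp: circle_def)
qed

text \<open>The source subdivision consists of all intervals of depth \<open>k\<close>. Their images
  have disjoint interiors because \<open>f\<close> is injective, and they cover because every
  sufficiently deep interval lies in one of them. Disjointness also makes the matching of intervals
  a bijection.\<close>

lemma tame_imp_thompson_T:
  assumes n: "n \<ge> 2" and f: "f \<in> Bij circle" "tame n f"
  shows "f \<in> carrier (thompson_T n)"
proof -
  have n0: "n > 0" using n by simp
  have b: "bij_betw f circle circle" using f(1) by (simp add: Bij_def)
  obtain k V where V: "\<And>w. w \<in> words n \<Longrightarrow> length w = k \<Longrightarrow> V w \<in> words n \<and> maps_word n f w (V w)"
    using tame_wordmap[OF f(2)] by metis
  define I where "I = {w \<in> words n. length w = k}"
  have VI: "w \<in> words n" "V w \<in> words n" "maps_word n f w (V w)" if "w \<in> I" for w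
    using that V by (auto simp: I_def)
  have fin: "finite I" using finite_words_length by (simp add: I_def)
  let ?J = "\<lambda>w. aff n w ` {0..1::real}"
  have circ: "f (aff n w y) = aff n (V w) y" if "w \<in> I" "y \<in> circle" for w y
    using maps_word_circle VI that by metis
  have int: "w = v" if "w \<in> I" "v \<in> I" "x \<in> interior (?J w)" "x \<in> interior (?J v)" for w v x
  proof -
    note x = that(3,4)
    obtain y z where "y \<in> circle" "z \<in> circle" "aff n w y = aff n v z"
      using interior_aff_image[OF n0] x by metis
    then show ?thesis using aff_eq_imp_eq[of n w y v z] that by (auto simp: I_def)
  qed
  have intV: "w = v" if "w \<in> I" "v \<in> I" "x \<in> interior (?J (V w))" "x \<in> interior (?J (V v))" for w v x
  proof -
    note x = that(3,4)
    obtain y z where yz: "y \<in> circle" "z \<in> circle" "aff n (V w) y = aff n (V v) z"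
      using interior_aff_image[OF n0] x by metis
    then have "f (aff n w y) = f (aff n v z)" using circ that by simp
    then have "aff n w y = aff n v z"
      using b yz that VI by (meson aff_circle bij_betw_imp_inj_on inj_onD)
    then show ?thesis using aff_eq_imp_eq[of n w y v z] yz that by (auto simp: I_def)
  qed
  have box: "?J w \<noteq> {} \<and> (\<exists>a b. ?J w = cbox a b)" for w
    by (auto simp: aff_image[OF n0] aff_le_iff[OF n0])
  have ne: "interior (?J w) \<noteq> {}" for w
    using aff_less_iff[OF n0, of w 0 1] by (simp add: aff_image[OF n0])
  have D: "?J ` I division_of {0..1}"
  proof (rule division_ofI)
    show "finite (?J ` I)" using fin by simp
    show "\<Union>(?J ` I) = {0..1}"
      using ex_word_unit[OF n0, of _ k] aff_unit by (fastforce simp: I_def)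
    then show "K \<subseteq> {0..1}" if "K \<in> ?J ` I" for K using that by blast
    show "K \<noteq> {}" "\<exists>a b. K = cbox a b" if "K \<in> ?J ` I" for K using that box by auto
    show "interior K \<inter> interior L = {}" if "K \<in> ?J ` I" "L \<in> ?J ` I" "K \<noteq> L" for K L
      using that int by fast
  qed
  have E: "(?J \<circ> V) ` I division_of {0..1}"
  proof (rule division_ofI)
    show "finite ((?J \<circ> V) ` I)" using fin by simp
    have "y \<in> \<Union>((?J \<circ> V) ` I)" if y: "y \<in> {0..1}" for y
    proof -
      obtain u z where u: "u \<in> words n" "length u = (\<Sum>w\<in>{w \<in> words n. length w = k}. length (V w))"
        and z: "z \<in> {0..1}" "y = aff n u z"
        using ex_word_unit[OF n0 y] by blast
      obtain w t where w: "w \<in> I" "t \<in> words n" "u = V w @ t"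
        using deep_word_in_image[OF n0 b V u] by (auto simp: I_def)
      then have "y \<in> ?J (V w)"
        using z aff_unit[OF w(2) z(1)] by (simp only: aff_append imageI)
      then show ?thesis using w(1) by (simp only: image_comp[symmetric]) blast
    qed
    then show "\<Union>((?J \<circ> V) ` I) = {0..1}" using VI(2) aff_unit by fastforce
    then show "K \<subseteq> {0..1}" if "K \<in> (?J \<circ> V) ` I" for K using that by blast
    show "K \<noteq> {}" "\<exists>a b. K = cbox a b" if "K \<in> (?J \<circ> V) ` I" for K using that box by auto
    show "interior K \<inter> interior L = {}" if "K \<in> (?J \<circ> V) ` I" "L \<in> (?J \<circ> V) ` I" "K \<noteq> L" for K L
    proof -
      note KL = that
      obtain w v where wv: "w \<in> I" "v \<in> I" "K = ?J (V w)" "L = ?J (V v)"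
        using KL(1,2) by (auto simp del: image_image)
      with KL(3) have "w \<noteq> v" by blast
      then show ?thesis using intV[OF wv(1,2)] wv(3,4) by blast
    qed
  qed
  have injJ: "inj_on ?J I"
  proof (rule inj_onI)
    fix w v assume wv: "w \<in> I" "v \<in> I" "?J w = ?J v"
    obtain x where x: "x \<in> interior (?J w)" using ne by blast
    moreover from this have "x \<in> interior (?J v)" using wv(3) by (simp only:)
    ultimately show "w = v" by (rule int[OF wv(1,2)])
  qed
  have injV: "inj_on (?J \<circ> V) I"
  proof (rule inj_onI)
    fix w v assume wv: "w \<in> I" "v \<in> I" "(?J \<circ> V) w = (?J \<circ> V) v"
    obtain x where x: "x \<in> interior (?J (V w))" using ne by blast
    moreover from this have "x \<in> interior (?J (V v))" using wv(3) by (simp only: comp_apply)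
    ultimately show "w = v" by (rule intV[OF wv(1,2)])
  qed
  define \<pi> where "\<pi> = (?J \<circ> V) \<circ> inv_into I ?J"
  have \<pi>: "\<pi> (?J w) = ?J (V w)" if "w \<in> I" for w
    using inv_into_f_f[OF injJ that] by (simp add: \<pi>_def)
  have bij: "bij_betw \<pi> (?J ` I) ((?J \<circ> V) ` I)"
    unfolding \<pi>_def
    by (rule bij_betw_trans[OF bij_betw_inv_into[OF inj_on_imp_bij_betw[OF injJ]]
      inj_on_imp_bij_betw[OF injV]])
  have aff: "\<forall>K\<in>?J ` I. maps_affinely_onto f K (\<pi> K)"
    using VI(3) by (auto simp: \<pi> maps_affinely_onto_iff[OF n0])
  have nad: "nadic_subdivision n (?J ` I)" "nadic_subdivision n ((?J \<circ> V) ` I)"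
    using D E VI unfolding nadic_subdivision_def nadic_interval_iff_word[OF n0] by auto
  show ?thesis unfolding thompson_T_def
    using f homeomorphic_map_tame[OF n0 f] nad bij aff by auto
qed

lemma thompson_T_iff: "n \<ge> 2 \<Longrightarrow> f \<in> carrier (thompson_T n) \<longleftrightarrow> f \<in> Bij circle \<and> tame n f"
  using thompson_T_imp_tame tame_imp_thompson_T by blast

lemma thompson_T_bij: "n \<ge> 2 \<Longrightarrow> f \<in> carrier (thompson_T n) \<Longrightarrow> bij_betw f circle circle"
  by (simp add: thompson_T_iff Bij_def)

lemma thompson_T_eqI:
  "\<lbrakk>n \<ge> 2; m \<ge> 2; f \<in> carrier (thompson_T n); g \<in> carrier (thompson_T m);
    \<And>x. x \<in> circle \<Longrightarrow> f x = g x\<rbrakk> \<Longrightarrow> f = g"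
  by (auto simp: thompson_T_iff intro: extensionalityI dest: Bij_imp_extensional)

lemma thompson_T_inv_into:
  assumes "n \<ge> 2" "f \<in> carrier (thompson_T n)"
  shows "restrict (inv_into circle f) circle \<in> carrier (thompson_T n)"
  using assms tame_inv[of n f] restrict_inv_into_Bij[of f circle] thompson_T_bij[OF assms]
  by (simp add: thompson_T_iff)

lemma thompson_T_compose:
  assumes "n \<ge> 2" "f \<in> carrier (thompson_T n)" "g \<in> carrier (thompson_T n)"
  shows "compose circle f g \<in> carrier (thompson_T n)"
  using assms tame_compose[of n f g] compose_Bij[of f circle g] thompson_T_bij[of n g]
  by (simp add: thompson_T_iff)

section \<open>The group structure of \<open>T\<^sub>n\<close>\<close>

lemma subgroup_thompson_T:
  assumes n: "n \<ge> 2"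
  shows "subgroup (carrier (thompson_T n)) (BijGroup circle)"
proof -
  interpret group "BijGroup circle" by (rule group_BijGroup)
  have n0: "n > 0" using n by simp
  have inv: "inv\<^bsub>BijGroup circle\<^esub> f = restrict (inv_into circle f) circle" if "f \<in> Bij circle" for f
    using that by (intro inv_equality)
      (auto simp: BijGroup_def Bij_compose_restrict_eq restrict_inv_into_Bij)
  have id: "tame n (\<lambda>x\<in>circle. x)" unfolding tame_def
    by (intro exI[of _ 0]) (auto simp: good_word_def maps_word_def frac_in_circle intro!: bexI[of _ "[]"])
  show ?thesis
  proof (rule subgroupI)
    show "carrier (thompson_T n) \<subseteq> carrier (BijGroup circle)"
      using n by (auto simp: thompson_T_iff BijGroup_def)
    show "carrier (thompson_T n) \<noteq> {}"
      using n id id_Bij[of circle] by (auto simp: thompson_T_iff)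
    show "inv\<^bsub>BijGroup circle\<^esub> f \<in> carrier (thompson_T n)" if "f \<in> carrier (thompson_T n)" for f
      using that n thompson_T_inv_into[OF n that] by (simp add: thompson_T_iff inv)
    show "f \<otimes>\<^bsub>BijGroup circle\<^esub> g \<in> carrier (thompson_T n)"
      if "f \<in> carrier (thompson_T n)" "g \<in> carrier (thompson_T n)" for f g
      using that n thompson_T_compose[OF n that] by (simp add: thompson_T_iff BijGroup_def)
  qed
qed

lemma thompson_T_eq: "thompson_T n = (BijGroup circle)\<lparr>carrier := carrier (thompson_T n)\<rparr>"
  by (simp add: thompson_T_def)

lemma group_thompson_T: "n \<ge> 2 \<Longrightarrow> group (thompson_T n)"
  by (subst thompson_T_eq) (rule subgroup.subgroup_is_group[OF subgroup_thompson_T group_BijGroup])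

lemma thompson_T_mult:
  "\<lbrakk>n \<ge> 2; f \<in> carrier (thompson_T n); g \<in> carrier (thompson_T n)\<rbrakk> \<Longrightarrow>
    f \<otimes>\<^bsub>thompson_T n\<^esub> g = compose circle f g"
  by (auto simp: thompson_T_iff) (simp add: thompson_T_def BijGroup_def)

lemma thompson_T_one: "\<one>\<^bsub>thompson_T n\<^esub> = (\<lambda>x\<in>circle. x)"
  by (simp add: thompson_T_def BijGroup_def)

lemma thompson_T_inv:
  assumes n: "n \<ge> 2" and f: "f \<in> carrier (thompson_T n)"
  shows "inv\<^bsub>thompson_T n\<^esub> f = restrict (inv_into circle f) circle"
proof (rule group.inv_equality[OF group_thompson_T[OF n] _ f])
  show g: "restrict (inv_into circle f) circle \<in> carrier (thompson_T n)"
    by (rule thompson_T_inv_into[OF n f])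
  show "restrict (inv_into circle f) circle \<otimes>\<^bsub>thompson_T n\<^esub> f = \<one>\<^bsub>thompson_T n\<^esub>"
    using n f g by (simp add: thompson_T_mult thompson_T_one Bij_compose_restrict_eq thompson_T_iff)
qed

section \<open>The conjugating homeomorphism\<close>

definition code :: "nat \<Rightarrow> nat \<Rightarrow> nat list" where
  "code n j = (if j < n - 1 then replicate j 1 @ [0] else replicate (n - 1) 1)"

definition code_word :: "nat \<Rightarrow> nat list \<Rightarrow> nat list" where
  "code_word n w = concat (map (code n) w)"

lemma code_word_simps [simp]:
  "code_word n [] = []" "code_word n (j # w) = code n j @ code_word n w"
  "code_word n (u @ v) = code_word n u @ code_word n v"
  by (simp_all add: code_word_def)

lemma replicate_words: "j < n \<Longrightarrow> replicate k j \<in> words n"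
  by (auto simp: words_def lists_eq_set)

lemma code_words: "code n j \<in> words 2"
  by (simp add: code_def replicate_words)

lemma code_word_words: "code_word n w \<in> words 2"
  by (induction w) (auto simp: code_words)

lemma aff_replicate_1: "aff 2 (replicate j 1) x = 1 - (1 - x) / 2 ^ j"
  by (induction j) (auto simp: field_simps)

definition code_weight :: "nat \<Rightarrow> nat \<Rightarrow> real" where
  "code_weight n j = 1 / 2 ^ length (code n j)"

text \<open>The left endpoint is \<open>1 - 1 / 2 ^ j\<close> in both cases of \<open>code\<close>:
  the last code has no final 0, but a final 0 would not move the left endpoint anyway.\<close>

lemma aff_code_weight:
  assumes "j < n" shows "aff 2 (code n j) x = 1 - 1 / 2 ^ j + code_weight n j * x"
proof (cases "j < n - 1")
  case False
  then have "j = n - 1" using assms by simp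
  then show ?thesis by (simp add: aff_replicate_1 code_weight_def code_def diff_divide_distrib del: One_nat_def)
qed (simp add: aff_append aff_replicate_1 code_weight_def code_def diff_divide_distrib del: One_nat_def)

lemma sum_code_weight: "j < n \<Longrightarrow> (\<Sum>i<j. code_weight n i) = 1 - 1 / 2 ^ j"
  by (induction j) (auto simp: code_weight_def code_def)

lemma sum_code_weight_1: assumes "n > 0" shows "(\<Sum>i<n. code_weight n i) = 1"
proof -
  have "{..<n} = insert (n - 1) {..<n - 1}" using assms by auto
  then have "(\<Sum>i<n. code_weight n i) = code_weight n (n - 1) + (\<Sum>i<n - 1. code_weight n i)"
    by (simp del: lessThan_eq_iff)
  also have "\<dots> = 1" using assms by (subst sum_code_weight) (auto simp: code_weight_def code_def)
  finally show ?thesis .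
qed

lemma code_weight_pos: "code_weight n j > 0"
  by (simp add: code_weight_def)

lemma code_weight_le: assumes "n \<ge> 2" shows "code_weight n j \<le> 1 / 2"
proof -
  have "length (code n j) \<ge> 1" using assms by (auto simp: code_def)
  then have "(2::real) ^ 1 \<le> 2 ^ length (code n j)" by (intro power_increasing) auto
  then show ?thesis by (simp add: code_weight_def divide_simps)
qed

section \<open>Construction of the conjugating map as a fixed point\<close>

definition clamp01 :: "real \<Rightarrow> real" where
  "clamp01 y = max 0 (min 1 y)"

text \<open>One step of the iteration for the self-similarity equation, written as a single sum
  instead of a case distinction. By clamping, the branches to the left of \<open>x\<close>
  contribute their full weight when \<open>h 1 = 1\<close>, those to the right contribute nothing
  when \<open>h 0 = 0\<close>. Monotonicity and continuity are then inherited term by term.\<close>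

definition refine_step :: "nat \<Rightarrow> (real \<Rightarrow> real) \<Rightarrow> real \<Rightarrow> real" where
  "refine_step n h x = (\<Sum>j<n. code_weight n j * h (clamp01 (real n * x - real j)))"

lemma refine_step_aff:
  assumes "j < n" "x \<in> {0..1}" "h 0 = 0" "h 1 = 1"
  shows "refine_step n h (aff n [j] x) = aff 2 (code n j) (h x)"
proof -
  let ?t = "\<lambda>i. code_weight n i * h (clamp01 (real n * aff n [j] x - real i))"
  have y: "real n * aff n [j] x = real j + x" using assms(1) by simp
  have "refine_step n h (aff n [j] x) = sum ?t ({..<j} \<union> {j..<n})"
    using assms(1) by (simp add: refine_step_def ivl_disj_un_one)
  also have "\<dots> = sum ?t {..<j} + sum ?t {j..<n}" by (rule sum.union_disjoint) auto
  also have "sum ?t {..<j} = (\<Sum>i<j. code_weight n i)"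
  proof (rule sum.cong)
    fix i assume "i \<in> {..<j}"
    then have "real j + x - real i \<ge> 1" using assms(2) by auto
    then show "?t i = code_weight n i" using assms(4) by (simp add: y clamp01_def del: aff.simps)
  qed simp
  also have "sum ?t {j..<n} = (\<Sum>i\<in>{j..<n}. if i = j then code_weight n j * h x else 0)"
  proof (rule sum.cong)
    fix i assume i: "i \<in> {j..<n}"
    show "?t i = (if i = j then code_weight n j * h x else 0)"
    proof (cases "i = j")
      case False
      then have "real j + x - real i \<le> 0" using assms(2) i by auto
      then show ?thesis using assms(3) False by (simp add: y clamp01_def del: aff.simps)
    qed (use assms(2) in \<open>simp add: y clamp01_def del: aff.simps\<close>)
  qed simp
  also have "\<dots> = code_weight n j * h x" using assms(1) by simp
  finally show ?thesis using assms(1) by (simp only: aff_code_weight sum_code_weight)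
qed

lemma refine_step_0: "h 0 = 0 \<Longrightarrow> refine_step n h 0 = 0"
  by (auto simp: refine_step_def clamp01_def)

lemma refine_step_1:
  assumes "n > 0" "h 1 = 1" shows "refine_step n h 1 = 1"
proof -
  have "refine_step n h 1 = (\<Sum>j<n. code_weight n j)"
    unfolding refine_step_def
  proof (rule sum.cong)
    fix j assume "j \<in> {..<n}"
    then have "real n * 1 - real j \<ge> 1" by auto
    then show "code_weight n j * h (clamp01 (real n * 1 - real j)) = code_weight n j"
      using assms(2) by (simp add: clamp01_def)
  qed simp
  then show ?thesis using sum_code_weight_1[OF assms(1)] by simp
qed

lemma refine_step_mono:
  assumes "mono h" shows "mono (refine_step n h)"
proof (rule monoI)
  fix x y :: real assume "x \<le> y"
  then have "clamp01 (real n * x - real j) \<le> clamp01 (real n * y - real j)" for j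
    using mult_left_mono[of x y "real n"] by (auto simp: clamp01_def)
  then show "refine_step n h x \<le> refine_step n h y"
    unfolding refine_step_def
    using assms code_weight_pos by (intro sum_mono mult_left_mono) (auto dest: monoD intro: less_imp_le)
qed

text \<open>At a given point the two sums differ in one branch only, and its weight is at most 1/2
  because no code is empty.\<close>

lemma refine_step_diff:
  assumes n: "n \<ge> 2" and gh: "g 0 = 0" "g 1 = 1" "h 0 = 0" "h 1 = 1"
    and d: "\<And>x. x \<in> {0..1} \<Longrightarrow> \<bar>g x - h x\<bar> \<le> d" and x: "x \<in> {0..1}"
  shows "\<bar>refine_step n g x - refine_step n h x\<bar> \<le> d / 2"
proof -
  obtain w y where w: "w \<in> words n" "length w = 1" "y \<in> {0..1}" "x = aff n w y"
    using ex_word_unit[of n x 1] n x by auto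
  then obtain j where j: "w = [j]" "j < n" by (cases w) auto
  have "\<bar>refine_step n g x - refine_step n h x\<bar> = \<bar>code_weight n j * g y - code_weight n j * h y\<bar>"
    using refine_step_aff[OF j(2) w(3)] gh w(4) j by (simp add: aff_code_weight del: aff.simps)
  also have "\<dots> = code_weight n j * \<bar>g y - h y\<bar>"
    using code_weight_pos[of n j] by (simp add: abs_mult right_diff_distrib[symmetric] del: right_diff_distrib)
  also have "\<dots> \<le> 1 / 2 * d"
    using code_weight_le[OF n] code_weight_pos[of n j] d[OF w(3)] by (intro mult_mono) auto
  finally show ?thesis by simp
qed

lemma refine_step_continuous:
  "continuous_on UNIV h \<Longrightarrow> continuous_on UNIV (refine_step n h)"
  unfolding refine_step_def
  by (intro continuous_on_sum continuous_on_mult_left, rule continuous_on_compose2[of UNIV h])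
    (auto simp: clamp01_def intro!: continuous_intros)

primrec hseq :: "nat \<Rightarrow> nat \<Rightarrow> real \<Rightarrow> real" where
  "hseq n 0 = (\<lambda>x. x)"
| "hseq n (Suc k) = refine_step n (hseq n k)"

lemma hseq_0 [simp]: "hseq n k 0 = 0"
  by (induction k) (auto simp: refine_step_0)

lemma hseq_1: "n > 0 \<Longrightarrow> hseq n k 1 = 1"
  by (induction k) (auto simp: refine_step_1)

lemma hseq_mono: "mono (hseq n k)"
  by (induction k) (auto simp: refine_step_mono intro: monoI)

lemma hseq_continuous: "continuous_on UNIV (hseq n k)"
  by (induction k) (auto simp: refine_step_continuous)

lemma hseq_diff:
  assumes n: "n \<ge> 2"
  shows "x \<in> {0..1} \<Longrightarrow> \<bar>hseq n (Suc k) x - hseq n k x\<bar> \<le> (1 / 2) ^ k"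
proof (induction k arbitrary: x)
  case 0
  have "hseq n 0 0 \<le> hseq n 0 x" "hseq n 0 x \<le> hseq n 0 1"
    "hseq n 1 0 \<le> hseq n 1 x" "hseq n 1 x \<le> hseq n 1 1"
    using 0 by (intro monoD[OF hseq_mono]; simp)+
  then show ?case using hseq_1[of n 0] hseq_1[of n 1] n by (simp add: abs_if del: hseq.simps)
next
  case (Suc k)
  have "\<bar>refine_step n (hseq n (Suc k)) x - refine_step n (hseq n k) x\<bar> \<le> (1 / 2) ^ k / 2"
    by (rule refine_step_diff[OF n _ _ _ _ Suc.IH Suc.prems]) (use hseq_1 n in \<open>auto simp del: hseq.simps\<close>)
  then show ?case by (simp only: hseq.simps(2)[symmetric]) simp
qed

text \<open>\<^const>\<open>refine_step\<close> halves distances between functions fixing \<open>0\<close> and \<open>1\<close>, so its iterates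
  converge uniformly.\<close>

lemma ex_conjugator:
  assumes n: "n \<ge> 2"
  shows "\<exists>h. strict_mono_on {0..1} h \<and> h 0 = 0 \<and> h 1 = 1 \<and> h ` {0..1} = {0..1} \<and>
    (\<forall>j<n. \<forall>x\<in>{0..1}. h (aff n [j] x) = aff 2 (code n j) (h x))"
proof -
  let ?d = "\<lambda>k x. hseq n (Suc k) x - hseq n k x"
  \<comment> \<open>The series of differences telescopes to the limit minus its starting function,
    the identity; the summand \<open>x\<close> restores it.\<close>
  define h where "h x = suminf (\<lambda>k. ?d k x) + x" for x
  have "uniform_limit {0..1} (\<lambda>k x. \<Sum>i<k. ?d i x) (\<lambda>x. suminf (\<lambda>k. ?d k x)) sequentially"
    by (rule Weierstrass_m_test[where M = "\<lambda>k. (1/2) ^ k"])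
       (use hseq_diff[OF n] in \<open>auto simp del: hseq.simps intro: summable_geometric\<close>)
  moreover have "(\<lambda>k x. \<Sum>i<k. ?d i x) = (\<lambda>k x. hseq n k x - x)"
    using sum_lessThan_telescope[of "\<lambda>i. hseq n i x" for x] by (simp add: fun_eq_iff del: hseq.simps(2))
  ultimately have "uniform_limit {0..1} (\<lambda>k x. hseq n k x - x) (\<lambda>x. suminf (\<lambda>k. ?d k x)) sequentially"
    by simp
  then have "uniform_limit {0..1} (\<lambda>k x. (hseq n k x - x) + x) h sequentially"
    unfolding h_def by (intro uniform_limit_add uniform_limit_const)
  then have ul: "uniform_limit {0..1} (hseq n) h sequentially" by simp
  have cont: "continuous_on {0..1} h"
    by (rule uniform_limit_theorem[OF _ ul])
       (auto intro!: always_eventually continuous_on_subset[OF hseq_continuous])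
  have lim: "(\<lambda>k. hseq n k x) \<longlonglongrightarrow> h x" if "x \<in> {0..1}" for x
    using tendsto_uniform_limitI[OF ul that] .
  have h0: "h 0 = 0" using lim[of 0] by (simp add: LIMSEQ_const_iff)
  have h1: "h 1 = 1" using lim[of 1] hseq_1 n by (simp add: LIMSEQ_const_iff)
  have mono: "h x \<le> h y" if "x \<in> {0..1}" "y \<in> {0..1}" "x \<le> y" for x y
    by (rule LIMSEQ_le[OF lim lim]) (use that hseq_mono in \<open>auto dest: monoD\<close>)
  have eq: "h (aff n [j] x) = aff 2 (code n j) (h x)" if j: "j < n" "x \<in> {0..1}" for j x
  proof (rule LIMSEQ_unique)
    have "aff n [j] x \<in> {0..1}" by (rule aff_unit) (use j in auto)
    then show "(\<lambda>k. hseq n (Suc k) (aff n [j] x)) \<longlonglongrightarrow> h (aff n [j] x)"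
      by (rule LIMSEQ_Suc[OF lim])
    have "(\<lambda>k. 1 - 1 / 2 ^ j + code_weight n j * hseq n k x) \<longlonglongrightarrow> 1 - 1 / 2 ^ j + code_weight n j * h x"
      by (intro tendsto_intros lim j)
    then show "(\<lambda>k. hseq n (Suc k) (aff n [j] x)) \<longlonglongrightarrow> aff 2 (code n j) (h x)"
      using refine_step_aff[OF j] hseq_1 n j by (simp add: aff_code_weight del: aff.simps)
  qed
  have eqw: "w \<in> words n \<Longrightarrow> x \<in> {0..1} \<Longrightarrow> h (aff n w x) = aff 2 (code_word n w) (h x)" for w x
  proof (induction w)
    case (Cons j w)
    then have "aff n w x \<in> {0..1}" by (intro aff_unit) auto
    then have "h (aff n [j] (aff n w x)) = aff 2 (code n j) (h (aff n w x))"
      using Cons.prems by (intro eq) auto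
    then show ?case using Cons by (simp add: aff_append)
  qed simp
  have "strict_mono_on {0..1} h"
  proof (rule strict_mono_onI)
    fix x y :: real assume xy: "x \<in> {0..1}" "y \<in> {0..1}" "x < y"
    \<comment> \<open>At a scale finer than half the distance a complete \<open>n\<close>-adic
      interval fits between \<open>x\<close> and \<open>y\<close>, even after rounding its left end
      up. Its image is a dyadic interval of positive length, which makes monotonicity
      strict.\<close>
    obtain k where k: "2 / (y - x) < real n ^ k"
      using real_arch_pow[of "real n" "2 / (y - x)"] n by auto
    define l where "l = nat \<lceil>x * real n ^ k\<rceil>"
    have p: "real n ^ k > 0" using n by simp
    have "0 \<le> x * real n ^ k" using xy p by simp
    then have l: "x * real n ^ k \<le> real l" "real l < x * real n ^ k + 1"
      unfolding l_def by linarith+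
    have "2 < (y - x) * real n ^ k" using k xy by (simp add: field_simps)
    then have ly: "real l + 1 < y * real n ^ k" using l by (simp add: algebra_simps)
    also have "\<dots> \<le> real (n ^ k)" using xy p by simp
    finally have "l < n ^ k" by linarith
    then obtain w where w: "w \<in> words n" "\<And>x. aff n w x = (real l + x) / real n ^ k"
      using ex_word_value by blast
    have 1: "x \<le> aff n w 0" "aff n w 1 \<le> y" using l ly p by (auto simp: w field_simps)
    have "h x \<le> h (aff n w 0)" using 1 xy aff_unit[OF w(1), of 0] by (intro mono) auto
    also have "\<dots> = aff 2 (code_word n w) 0" using eqw[OF w(1), of 0] h0 by simp
    also have "\<dots> < aff 2 (code_word n w) 1" by (simp add: aff_less_iff)
    also have "\<dots> = h (aff n w 1)" using eqw[OF w(1), of 1] h1 by simp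
    also have "\<dots> \<le> h y" using 1 xy aff_unit[OF w(1), of 1] by (intro mono) auto
    finally show "h x < h y" .
  qed
  moreover have "h ` {0..1} = {0..1}"
  proof
    show "h ` {0..1} \<subseteq> {0..1}" using mono[of 0] mono[of _ 1] h0 h1 by auto
    show "{0..1} \<subseteq> h ` {0..1}"
    proof
      fix y :: real assume "y \<in> {0..1}"
      then show "y \<in> h ` {0..1}" using IVT'[of h 0 y 1] h0 h1 cont by auto
    qed
  qed
  ultimately show ?thesis using h0 h1 eq by blast
qed

definition conjugator :: "nat \<Rightarrow> real \<Rightarrow> real" where
  "conjugator n = (SOME h. strict_mono_on {0..1} h \<and> h 0 = 0 \<and> h 1 = 1 \<and> h ` {0..1} = {0..1} \<and>
    (\<forall>j<n. \<forall>x\<in>{0..1}. h (aff n [j] x) = aff 2 (code n j) (h x)))"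

lemma conjugator:
  assumes "n \<ge> 2"
  shows "strict_mono_on {0..1} (conjugator n)" "conjugator n 0 = 0" "conjugator n 1 = 1"
    "conjugator n ` {0..1} = {0..1}"
    "\<And>j x. j < n \<Longrightarrow> x \<in> {0..1} \<Longrightarrow> conjugator n (aff n [j] x) = aff 2 (code n j) (conjugator n x)"
  using someI_ex[OF ex_conjugator[OF assms]] unfolding conjugator_def[symmetric] by auto

lemma conjugator_aff:
  assumes "n \<ge> 2"
  shows "w \<in> words n \<Longrightarrow> x \<in> {0..1} \<Longrightarrow> conjugator n (aff n w x) = aff 2 (code_word n w) (conjugator n x)"
proof (induction w)
  case (Cons j w)
  then have "aff n w x \<in> {0..1}" by (intro aff_unit) auto
  then have "conjugator n (aff n [j] (aff n w x)) = aff 2 (code n j) (conjugator n (aff n w x))"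
    using Cons.prems by (intro conjugator[OF assms]) auto
  then show ?case using Cons by (simp add: aff_append)
qed simp

lemma conjugator_circle:
  assumes "n \<ge> 2" shows "bij_betw (conjugator n) circle circle"
proof -
  have b: "bij_betw (conjugator n) {0..1} {0..1}"
    using conjugator[OF assms] by (simp add: bij_betw_def strict_mono_on_imp_inj_on)
  have "bij_betw (conjugator n) ({0..1} - {1}) ({0..1} - {conjugator n 1})"
    by (rule bij_betw_DiffI[OF b]) (auto simp: conjugator(3)[OF assms])
  moreover have "{0..1} - {1} = circle" by (auto simp: circle_def)
  ultimately show ?thesis using conjugator(3)[OF assms] by simp
qed

lemma conjugator_frac:
  assumes "n \<ge> 2" "x \<in> {0..1}" shows "conjugator n (frac x) = frac (conjugator n x)"
proof (cases "x = 1")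
  case False
  then have "x \<in> circle" using assms by (auto simp: circle_def)
  moreover from this have "conjugator n x \<in> circle"
    using conjugator_circle[OF assms(1)] by (auto dest: bij_betwE)
  ultimately show ?thesis by (simp add: frac_circle)
qed (use conjugator[OF assms(1)] in auto)

section \<open>Caret replacement as a conjugation\<close>

definition conj_map :: "nat \<Rightarrow> (real \<Rightarrow> real) \<Rightarrow> real \<Rightarrow> real" where
  "conj_map n f = (\<lambda>y\<in>circle. conjugator n (f (inv_into circle (conjugator n) y)))"

lemma conj_map_conjugator:
  "n \<ge> 2 \<Longrightarrow> x \<in> circle \<Longrightarrow> conj_map n f (conjugator n x) = conjugator n (f x)"
  using conjugator_circle[of n] by (simp add: conj_map_def bij_betw_inv_into_left bij_betwE)

lemma conj_map_Bij:
  assumes "n \<ge> 2" "f \<in> Bij circle" shows "conj_map n f \<in> Bij circle"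
proof -
  have "bij_betw (conjugator n \<circ> (f \<circ> inv_into circle (conjugator n))) circle circle"
    using assms conjugator_circle[OF assms(1)]
    by (intro bij_betw_trans[of _ _ circle] bij_betw_inv_into) (auto simp: Bij_def)
  moreover have "bij_betw (conj_map n f) circle circle \<longleftrightarrow> bij_betw (conjugator n \<circ> (f \<circ> inv_into circle (conjugator n))) circle circle"
    by (rule bij_betw_cong) (simp add: conj_map_def)
  ultimately show ?thesis by (simp add: Bij_def conj_map_def)
qed

text \<open>By self-similarity the restriction of the conjugator to any \<open>n\<close>-adic
  interval is the same map up to affine rescaling. It enters once at the source and once at the
  target and cancels, so the conjugate is affine although the conjugator need not be.\<close>

lemma conj_map_maps_word:
  assumes n: "n \<ge> 2" and w: "w \<in> words n" "v \<in> words n" "maps_word n f w v"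
  shows "maps_word 2 (conj_map n f) (code_word n w) (code_word n v)"
  unfolding maps_word_def
proof
  fix y :: real assume "y \<in> {0..1}"
  then obtain x where x: "x \<in> {0..1}" "y = conjugator n x"
    using conjugator(4)[OF n] by (metis imageE)
  have "conj_map n f (frac (aff 2 (code_word n w) y)) = conj_map n f (conjugator n (frac (aff n w x)))"
    using x conjugator_aff[OF n w(1) x(1)] conjugator_frac[OF n aff_unit[OF w(1) x(1)]] by simp
  also have "\<dots> = conjugator n (frac (aff n v x))"
    using w(3) x(1) by (simp add: conj_map_conjugator[OF n] frac_in_circle maps_word_def)
  also have "\<dots> = frac (aff 2 (code_word n v) y)"
    using x conjugator_aff[OF n w(2) x(1)] conjugator_frac[OF n aff_unit[OF w(2) x(1)]] by simp
  finally show "conj_map n f (frac (aff 2 (code_word n w) y)) = frac (aff 2 (code_word n v) y)" .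
qed

lemma conj_map_maps_wordD:
  assumes n: "n \<ge> 2" and f: "bij_betw f circle circle" and w: "w \<in> words n" "v \<in> words n"
    and m: "maps_word 2 (conj_map n f) (code_word n w) (code_word n v)"
  shows "maps_word n f w v"
  unfolding maps_word_def
proof
  fix x :: real assume x: "x \<in> {0..1}"
  then have y: "conjugator n x \<in> {0..1}" using conjugator(4)[OF n] by auto
  have "conjugator n (f (frac (aff n w x))) = conj_map n f (conjugator n (frac (aff n w x)))"
    by (simp add: conj_map_conjugator[OF n] frac_in_circle)
  also have "\<dots> = conj_map n f (frac (aff 2 (code_word n w) (conjugator n x)))"
    using x conjugator_aff[OF n w(1) x] conjugator_frac[OF n aff_unit[OF w(1) x]] by simp
  also have "\<dots> = frac (aff 2 (code_word n v) (conjugator n x))" by (rule maps_wordD[OF m y])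
  also have "\<dots> = conjugator n (frac (aff n v x))"
    using x conjugator_aff[OF n w(2) x] conjugator_frac[OF n aff_unit[OF w(2) x]] by simp
  finally show "f (frac (aff n w x)) = frac (aff n v x)"
    by (rule inj_onD[OF bij_betw_imp_inj_on[OF conjugator_circle[OF n]]])
       (use f in \<open>auto simp: frac_in_circle dest: bij_betwE\<close>)
qed

section \<open>Parsing binary words by the prefix code\<close>

lemma binary_word_cases:
  "u \<in> words 2 \<Longrightarrow> (\<exists>s<m. u = replicate s 1) \<or> (\<exists>s<m. \<exists>t\<in>words 2. u = replicate s 1 @ 0 # t) \<or>
    (\<exists>t\<in>words 2. u = replicate m 1 @ t)"
proof (induction u arbitrary: m)
  case Nil
  then show ?case by (cases m) auto
next
  case (Cons a u)
  show ?case
  proof (cases m)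
    case (Suc k)
    from Cons.prems consider "a = 0" | "a = 1" by (auto simp: less_2_cases_iff)
    then show ?thesis
    proof cases
      case 1
      then show ?thesis using Cons.prems Suc by (intro disjI2 disjI1 exI[of _ 0]) auto
    next
      case 2
      have "(\<exists>s<k. u = replicate s 1) \<or> (\<exists>s<k. \<exists>t\<in>words 2. u = replicate s 1 @ 0 # t) \<or>
        (\<exists>t\<in>words 2. u = replicate k 1 @ t)" using Cons by auto
      then consider s where "s < k" "u = replicate s 1"
        | s t where "s < k" "t \<in> words 2" "u = replicate s 1 @ 0 # t"
        | t where "t \<in> words 2" "u = replicate k 1 @ t" by blast
      then show ?thesis
      proof cases
        case 1
        then show ?thesis using 2 Suc by (intro disjI1 exI[of _ "Suc s"]) auto
      next
        case 2
        then show ?thesis using \<open>a = 1\<close> Suc by (intro disjI2 disjI1 exI[of _ "Suc s"]) auto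
      next
        case 3
        then show ?thesis using \<open>a = 1\<close> Suc by (intro disjI2) auto
      qed
    qed
  qed (use Cons.prems in auto)
qed

lemma binary_word_code_cases:
  assumes "n \<ge> 2" "u \<in> words 2"
  shows "(\<exists>s<n - 1. u = replicate s 1) \<or> (\<exists>j<n. \<exists>t\<in>words 2. u = code n j @ t)"
proof -
  consider s where "s < n - 1" "u = replicate s 1"
    | s t where "s < n - 1" "t \<in> words 2" "u = replicate s 1 @ 0 # t"
    | t where "t \<in> words 2" "u = replicate (n - 1) 1 @ t"
    using binary_word_cases[OF assms(2), of "n - 1"] by blast
  then show ?thesis
  proof cases
    case 2
    then show ?thesis by (intro disjI2 exI[of _ s]) (auto simp: code_def intro!: bexI[of _ t])
  next
    case 3
    then show ?thesis using assms(1)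
      by (intro disjI2 exI[of _ "n - 1"]) (auto simp: code_def intro!: bexI[of _ t])
  qed auto
qed

text \<open>Every vertex of the infinite binary tree lies in exactly one of the all-right trees that
  replace carets: reading codes greedily leads to the root of that tree, and the remaining
  \<open>s\<close> ones walk down its right spine. The case \<open>s = 0\<close> is the root itself,
  that is, a genuine code word.\<close>

lemma binary_word_decompose:
  assumes "n \<ge> 2"
  shows "u \<in> words 2 \<Longrightarrow> \<exists>w\<in>words n. \<exists>s<n - 1. u = code_word n w @ replicate s 1"
proof (induction "length u" arbitrary: u rule: less_induct)
  case less
  consider s where "s < n - 1" "u = replicate s 1" | j t where "j < n" "t \<in> words 2" "u = code n j @ t"
    using binary_word_code_cases[OF assms less.prems] by blast
  then show ?case
  proof cases
    case 1
    then show ?thesis by (intro bexI[of _ "[]"] exI[of _ s]) auto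
  next
    case 2
    have "length t < length u" using 2 assms by (auto simp: code_def)
    then obtain w s where "w \<in> words n" "s < n - 1" "t = code_word n w @ replicate s 1"
      using less.hyps 2 by blast
    then show ?thesis using 2 by (intro bexI[of _ "j # w"] exI[of _ s]) auto
  qed
qed

lemma code_length_le: "n \<ge> 2 \<Longrightarrow> length (code n j) \<le> n - 1"
  by (auto simp: code_def)

text \<open>A code has at most \<open>n - 1\<close> letters, so a depth for \<open>f\<close>
  multiplied by \<open>n - 1\<close> is a depth for its conjugate.\<close>

lemma long_binary_word_prefix:
  assumes "n \<ge> 2"
  shows "u \<in> words 2 \<Longrightarrow> length u \<ge> (n - 1) * k \<Longrightarrow>
    \<exists>w\<in>words n. length w = k \<and> (\<exists>t\<in>words 2. u = code_word n w @ t)"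
proof (induction k arbitrary: u)
  case 0
  then show ?case by (intro bexI[of _ "[]"]) auto
next
  case (Suc k)
  have "length u \<ge> n - 1" using Suc.prems(2) by simp
  then obtain j t where j: "j < n" "t \<in> words 2" "u = code n j @ t"
    using binary_word_code_cases[OF assms Suc.prems(1)] by auto
  then have "length t \<ge> (n - 1) * k" using Suc.prems(2) code_length_le[OF assms, of j] by simp
  then obtain w t' where "w \<in> words n" "length w = k" "t' \<in> words 2" "t = code_word n w @ t'"
    using Suc.IH[OF j(2)] by blast
  then show ?case using j by (intro bexI[of _ "j # w"]) auto
qed

lemma conj_map_tame:
  assumes n: "n \<ge> 2" and f: "tame n f"
  shows "tame 2 (conj_map n f)"
proof -
  obtain k V where V: "\<And>w. w \<in> words n \<Longrightarrow> length w = k \<Longrightarrow> V w \<in> words n \<and> maps_word n f w (V w)"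
    using tame_wordmap[OF f] by metis
  have "good_word 2 (conj_map n f) u" if u: "u \<in> words 2" "length u = (n - 1) * k" for u
  proof -
    obtain w t where w: "w \<in> words n" "length w = k" "t \<in> words 2" "u = code_word n w @ t"
      using long_binary_word_prefix[OF n u(1)] u(2) by (metis order_refl)
    then have "maps_word 2 (conj_map n f) u (code_word n (V w) @ t)"
      using V conj_map_maps_word[OF n] maps_word_append by metis
    then show ?thesis using w code_word_words by (auto simp: good_word_def)
  qed
  then show ?thesis by (auto simp: tame_def)
qed

lemma conj_map_closed:
  "n \<ge> 2 \<Longrightarrow> f \<in> carrier (thompson_T n) \<Longrightarrow> conj_map n f \<in> carrier (thompson_T 2)"
  by (simp add: thompson_T_iff conj_map_Bij conj_map_tame)

lemma conj_map_hom:
  assumes n: "n \<ge> 2" shows "conj_map n \<in> hom (thompson_T n) (thompson_T 2)"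
proof (rule homI)
  fix f g assume fg: "f \<in> carrier (thompson_T n)" "g \<in> carrier (thompson_T n)"
  show "conj_map n f \<in> carrier (thompson_T 2)" by (rule conj_map_closed[OF n fg(1)])
  have bij: "bij_betw g circle circle" "bij_betw (conjugator n) circle circle"
    using thompson_T_bij[OF n] fg conjugator_circle[OF n] by auto
  have "conj_map n (compose circle f g) y = compose circle (conj_map n f) (conj_map n g) y" for y
  proof (cases "y \<in> circle")
    case True
    then obtain x where x: "x \<in> circle" "y = conjugator n x"
      using bij(2) by (metis bij_betw_imp_surj_on imageE)
    moreover have "g x \<in> circle" using bij x by (auto dest: bij_betwE)
    ultimately show ?thesis using True
      by (simp add: conj_map_conjugator[OF n] compose_eq)
  qed (simp add: conj_map_def compose_def)
  then show "conj_map n (f \<otimes>\<^bsub>thompson_T n\<^esub> g) = conj_map n f \<otimes>\<^bsub>thompson_T 2\<^esub> conj_map n g"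
    using n fg conj_map_closed[OF n] by (simp add: thompson_T_mult fun_eq_iff)
qed

text \<open>For \<open>i < j\<close> the codes differ at position \<open>i\<close>, where the first
  ends with 0 and the second still has a 1.\<close>

lemma code_append_eq:
  assumes n: "n \<ge> 2" and "i < n" "j < n" "code n i @ u = code n j @ v"
  shows "i = j"
proof -
  have *: False if "i < j" "i < n" "j < n" "code n i @ u = code n j @ v" for i j u v
  proof -
    have "i < n - 1" using that by simp
    then have "(code n i @ u) ! i = 0" by (simp add: code_def nth_append)
    moreover have "(code n j @ v) ! i = 1" using that \<open>i < n - 1\<close> by (auto simp: code_def nth_append)
    ultimately show False using that(4) by simp
  qed
  show ?thesis using *[of i j u v] *[of j i v u] assms by (cases i j rule: linorder_cases) auto
qed

text \<open>Unique parsing strips the codes of \<open>w\<close> from both sides. What is left is a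
  product of codes equal to fewer than \<open>n - 1\<close> ones, and the only code without 0 has
  exactly \<open>n - 1\<close> ones, so nothing is left.\<close>

lemma code_word_eq_append_ones:
  assumes n: "n \<ge> 2"
  shows "\<lbrakk>u \<in> words n; w \<in> words n; s < n - 1; code_word n u = code_word n w @ replicate s 1\<rbrakk> \<Longrightarrow> s = 0"
proof (induction w arbitrary: u)
  case Nil
  show ?case
  proof (cases u)
    case (Cons a u')
    have "code n a = take (length (code n a)) (replicate s 1)"
      using Nil.prems Cons by (metis append_eq_conv_conj append_Nil code_word_simps(1,2))
    then have "set (code n a) \<subseteq> {1}" "length (code n a) \<le> s"
      by (metis empty_iff in_set_takeD insert_iff replicate_eqI set_replicate_conv_if subsetI,
          metis length_replicate length_take min.cobounded1)
    then show ?thesis using Nil.prems(3) Cons by (auto simp: code_def split: if_splits)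
  qed (use Nil in auto)
next
  case (Cons b w)
  have "u \<noteq> []" using Cons.prems n by (auto simp: code_def split: if_splits)
  then obtain a u' where u: "u = a # u'" by (cases u) auto
  then have "a = b" using Cons.prems by (intro code_append_eq[OF n]) auto
  then show ?case using Cons.IH[of u'] Cons.prems u by auto
qed

text \<open>If the image of a code word were not a code word, it would end inside an all-right tree, and
  then the images of its extensions by \<open>(n - 1)\<^sup>k\<close>, whose codes are powers of \<open>1\<close>, would be
  no code words either.\<close>

lemma good_word_code_wordD:
  assumes n: "n \<ge> 2" and f: "f \<in> carrier (thompson_T n)" and w: "w \<in> words n"
    and g: "good_word 2 (conj_map n f) (code_word n w)"
  shows "good_word n f w"
proof -
  obtain v where v: "v \<in> words 2" "maps_word 2 (conj_map n f) (code_word n w) v"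
    using g by (auto simp: good_word_def)
  obtain w' s where w': "w' \<in> words n" "s < n - 1" "v = code_word n w' @ replicate s 1"
    using binary_word_decompose[OF n v(1)] by blast
  obtain k V where V: "\<And>w. w \<in> words n \<Longrightarrow> length w = k \<Longrightarrow> V w \<in> words n \<and> maps_word n f w (V w)"
    using thompson_T_imp_tame(2)[OF n f] tame_wordmap by metis
  \<comment> \<open>Appending \<open>k\<close> letters makes \<open>w\<close> long enough to be good
    for \<open>f\<close>; the choice of the last digit makes the code a power of 1.\<close>
  define r where "r = replicate k (n - 1)"
  have r: "r \<in> words n" "length r = k" using n by (auto simp: r_def intro: replicate_words)
  have cr: "code_word n r = replicate ((n - 1) * k) 1"
    unfolding r_def by (induction k) (auto simp: code_def replicate_add)
  have "good_word n f (w @ r)"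
    by (rule good_word_longer[of n k]) (use V w r in \<open>auto simp: good_word_def\<close>)
  then obtain u where u: "u \<in> words n" "maps_word n f (w @ r) u" by (auto simp: good_word_def)
  have "maps_word 2 (conj_map n f) (code_word n (w @ r)) (code_word n u)"
    using conj_map_maps_word[OF n _ u] w r by simp
  moreover have "maps_word 2 (conj_map n f) (code_word n (w @ r)) (v @ code_word n r)"
    using maps_word_append[OF v(2) code_word_words] by simp
  ultimately have "code_word n u = v @ code_word n r"
    by (rule maps_word_target_unique[rotated -2]) (use v code_word_words in auto)
  also have "\<dots> = code_word n w' @ (replicate s 1 @ replicate ((n - 1) * k) 1)" by (simp add: w'(3) cr)
  \<comment> \<open>Powers of 1 commute, so the stray ones move behind the code of \<open>r\<close>
    and the word ends in the same incomplete code as before.\<close>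
  also have "\<dots> = code_word n (w' @ r) @ replicate s 1"
    by (simp add: cr replicate_add[symmetric] add.commute)
  finally have "s = 0" using code_word_eq_append_ones[OF n u(1), of "w' @ r" s] w' r by simp
  then have "maps_word n f w w'"
    using v w' thompson_T_bij[OF n f] by (intro conj_map_maps_wordD[OF n _ w]) auto
  then show ?thesis using w' by (auto simp: good_word_def)
qed

section \<open>Word length and subadditive functions\<close>

definition is_word :: "('a, 'b) monoid_scheme \<Rightarrow> 'a set \<Rightarrow> 'a list \<Rightarrow> 'a \<Rightarrow> bool" where
  "is_word G A ws g \<longleftrightarrow> set ws \<subseteq> A \<union> m_inv G ` A \<and> foldr (mult G) ws \<one>\<^bsub>G\<^esub> = g"

lemma word_length_le: "is_word G A ws g \<Longrightarrow> word_length G A g \<le> length ws"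
  unfolding word_length_def is_word_def by (rule Least_le) blast

context group
begin

lemma foldr_mult_closed: "set ws \<subseteq> carrier G \<Longrightarrow> foldr (\<otimes>) ws \<one> \<in> carrier G"
  by (induction ws) auto

lemma foldr_mult_append:
  "\<lbrakk>set us \<subseteq> carrier G; set vs \<subseteq> carrier G\<rbrakk> \<Longrightarrow>
    foldr (\<otimes>) (us @ vs) \<one> = foldr (\<otimes>) us \<one> \<otimes> foldr (\<otimes>) vs \<one>"
  by (induction us) (auto simp: foldr_mult_closed m_assoc simp del: foldr_append)

lemma is_word_mult:
  assumes "A \<subseteq> carrier G" "is_word G A us g" "is_word G A vs h"
  shows "is_word G A (us @ vs) (g \<otimes> h)"
proof -
  have "A \<union> m_inv G ` A \<subseteq> carrier G" using assms(1) by auto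
  then have "set us \<subseteq> carrier G" "set vs \<subseteq> carrier G"
    using assms(2,3) unfolding is_word_def by (meson order_trans)+
  then show ?thesis using assms foldr_mult_append by (auto simp: is_word_def simp del: foldr_append)
qed

lemma ex_is_word:
  assumes A: "finite_generating_set G A" and g: "g \<in> carrier G"
  shows "\<exists>ws. is_word G A ws g"
proof -
  have sub: "A \<subseteq> carrier G" and "g \<in> generate G A" using assms by (auto simp: finite_generating_set_def)
  from this(2) show ?thesis
  proof induction
    case one
    show ?case by (rule exI[of _ "[]"]) (simp add: is_word_def)
  next
    case (incl h)
    then show ?case using sub by (intro exI[of _ "[h]"]) (auto simp: is_word_def)
  next
    case (inv h)
    then show ?case using sub by (intro exI[of _ "[inv h]"]) (auto simp: is_word_def)
  next
    case (eng h1 h2)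
    then show ?case using is_word_mult[OF sub] by blast
  qed
qed

lemma ex_shortest_word:
  assumes "finite_generating_set G A" "g \<in> carrier G"
  obtains ws where "is_word G A ws g" "length ws = word_length G A g"
proof -
  have "\<exists>k ws. length ws = k \<and> set ws \<subseteq> A \<union> m_inv G ` A \<and> foldr (\<otimes>) ws \<one> = g"
    using ex_is_word[OF assms] by (auto simp: is_word_def)
  then have "\<exists>ws. length ws = word_length G A g \<and> set ws \<subseteq> A \<union> m_inv G ` A \<and> foldr (\<otimes>) ws \<one> = g"
    unfolding word_length_def by (rule LeastI_ex)
  then show ?thesis using that by (auto simp: is_word_def)
qed

lemma word_length_mult_le:
  assumes A: "finite_generating_set G A" and g: "g \<in> carrier G" "h \<in> carrier G"
  shows "word_length G A (g \<otimes> h) \<le> word_length G A g + word_length G A h"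
proof -
  obtain us vs where "is_word G A us g" "length us = word_length G A g"
    "is_word G A vs h" "length vs = word_length G A h"
    using ex_shortest_word[OF A] g by metis
  moreover have "A \<subseteq> carrier G" using A by (simp add: finite_generating_set_def)
  ultimately show ?thesis using word_length_le[OF is_word_mult, of A us g vs h] by simp
qed

lemma word_length_one: "word_length G A \<one> = 0"
  using word_length_le[of G A "[]" \<one>] by (simp add: is_word_def)

lemma word_length_inv_le:
  assumes A: "finite_generating_set G A" and g: "g \<in> carrier G"
  shows "word_length G A (inv g) \<le> word_length G A g"
proof -
  obtain ws where ws: "is_word G A ws g" "length ws = word_length G A g"
    using ex_shortest_word[OF A g] by metis
  have sub: "A \<subseteq> carrier G" using A by (simp add: finite_generating_set_def)
  have "set ws \<subseteq> A \<union> m_inv G ` A \<Longrightarrow>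
    foldr (\<otimes>) (map (m_inv G) (rev ws)) \<one> = inv (foldr (\<otimes>) ws \<one>)" for ws
  proof (induction ws)
    case (Cons x ws)
    have c: "A \<union> m_inv G ` A \<subseteq> carrier G" using sub by auto
    then have x: "x \<in> carrier G" "set ws \<subseteq> carrier G"
      using Cons.prems by (auto simp only: list.set insert_subset)
    then have y: "set (map (m_inv G) (rev ws)) \<subseteq> carrier G" by auto
    have "foldr (\<otimes>) (map (m_inv G) (rev (x # ws))) \<one> =
        foldr (\<otimes>) (map (m_inv G) (rev ws)) \<one> \<otimes> foldr (\<otimes>) [inv x] \<one>"
      using foldr_mult_append[OF y, of "[inv x]"] x(1) by (simp del: foldr_append)
    then show ?case using Cons x foldr_mult_closed[OF x(2)]
      by (simp add: inv_mult_group del: foldr_append foldr_map)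
  qed simp
  moreover have "m_inv G ` set ws \<subseteq> m_inv G ` (A \<union> m_inv G ` A)"
    using ws(1) unfolding is_word_def by (intro image_mono) simp
  moreover have "m_inv G ` (A \<union> m_inv G ` A) \<subseteq> A \<union> m_inv G ` A" using sub by (auto simp: subset_iff)
  ultimately have "is_word G A (map (m_inv G) (rev ws)) (inv g)"
    using ws(1) unfolding is_word_def by (simp del: foldr_map)
  then show ?thesis using word_length_le ws(2) by fastforce
qed

text \<open>The slope is the sum of \<open>N\<close> over generators and their inverses. It is used
  twice: for the number of bad words, and for the length of the image under a homomorphism.\<close>

lemma subadditive_le_word_length:
  fixes N :: "'a \<Rightarrow> nat"
  assumes A: "finite_generating_set G A"
    and N: "N \<one> = 0" "\<And>g h. g \<in> carrier G \<Longrightarrow> h \<in> carrier G \<Longrightarrow> N (g \<otimes> h) \<le> N g + N h"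
  shows "\<exists>c. \<forall>g\<in>carrier G. N g \<le> c * word_length G A g"
proof -
  let ?S = "A \<union> m_inv G ` A"
  have S: "finite ?S" "?S \<subseteq> carrier G" using A by (auto simp: finite_generating_set_def)
  define c where "c = (\<Sum>s\<in>?S. N s)"
  have c: "N s \<le> c" if "s \<in> ?S" for s
    unfolding c_def using that S(1) by (intro member_le_sum) auto
  have le: "set ws \<subseteq> ?S \<Longrightarrow> N (foldr (\<otimes>) ws \<one>) \<le> c * length ws" for ws
  proof (induction ws)
    case (Cons s ws)
    then have "N (s \<otimes> foldr (\<otimes>) ws \<one>) \<le> N s + N (foldr (\<otimes>) ws \<one>)"
      using S(2) by (intro N(2) foldr_mult_closed) auto
    also have "\<dots> \<le> c + c * length ws" using Cons c by (intro add_mono) auto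
    finally show ?case by simp
  qed (simp add: N(1))
  have "N g \<le> c * word_length G A g" if g: "g \<in> carrier G" for g
  proof -
    obtain ws where "is_word G A ws g" "length ws = word_length G A g"
      using ex_shortest_word[OF A g] by metis
    then show ?thesis using le[of ws] by (auto simp: is_word_def)
  qed
  then show ?thesis by blast
qed

end

text \<open>Word metrics are left invariant and \<open>f\<close> is a homomorphism, so it suffices
  to compare the distances from the identity.\<close>

lemma quasi_isometric_embedding_wordI:
  assumes G: "group G" "group H" and f: "f \<in> hom G H"
    and up: "\<And>g. g \<in> carrier G \<Longrightarrow> word_length H B (f g) \<le> c * word_length G A g"
    and lo: "\<And>g. g \<in> carrier G \<Longrightarrow> word_length G A g \<le> a * word_length H B (f g) + b"
  shows "quasi_isometric_embedding (carrier G) (word_metric G A) (carrier H) (word_metric H B) f"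
  unfolding quasi_isometric_embedding_def
proof
  interpret G: group G by (rule G)
  interpret H: group H by (rule G)
  interpret group_hom G H f by unfold_locales (rule f)
  show "f \<in> carrier G \<rightarrow> carrier H" using f by (auto simp: hom_def)
  \<comment> \<open>This exceeds both slopes and 1. As \<open>K\<close> is at least 1, dividing the
    lower estimate by it leaves an additive error of at most \<open>b\<close>.\<close>
  define K where "K = real a + real c + 1"
  have K: "K \<ge> 1" by (simp add: K_def)
  have "1 / K * word_metric G A x y - real b \<le> word_metric H B (f x) (f y) \<and>
      word_metric H B (f x) (f y) \<le> K * word_metric G A x y + real b"
    if xy: "x \<in> carrier G" "y \<in> carrier G" for x y
  proof -
    define g where "g = inv\<^bsub>G\<^esub> x \<otimes>\<^bsub>G\<^esub> y"
    have g: "g \<in> carrier G" using xy by (simp add: g_def)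
    define p where "p = real (word_length G A g)"
    define q where "q = real (word_length H B (f g))"
    have m: "word_metric G A x y = p" "word_metric H B (f x) (f y) = q"
      using xy by (simp_all add: word_metric_def g_def p_def q_def)
    have pq: "p \<ge> 0" "q \<ge> 0" by (simp_all add: p_def q_def)
    have "q \<le> real c * p" using up[OF g] unfolding p_def q_def by (metis of_nat_mono of_nat_mult)
    also have "\<dots> \<le> K * p" using pq by (intro mult_right_mono) (auto simp: K_def)
    finally have 1: "q \<le> K * p + real b" by simp
    have "p \<le> real a * q + real b"
      using lo[OF g] unfolding p_def q_def by (metis of_nat_mono of_nat_mult of_nat_add)
    also have "\<dots> \<le> K * q + K * real b"
      using pq K mult_right_mono[of 1 K "real b"] by (intro add_mono mult_right_mono) (auto simp: K_def)
    finally have "1 / K * p - real b \<le> q" using K by (simp add: field_simps)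
    then show ?thesis using 1 by (simp add: m)
  qed
  then show "\<exists>K C. K \<ge> 1 \<and> C \<ge> 0 \<and>
        (\<forall>x\<in>carrier G. \<forall>x'\<in>carrier G. 1 / K * word_metric G A x x' - C \<le> word_metric H B (f x) (f x') \<and>
                         word_metric H B (f x) (f x') \<le> K * word_metric G A x x' + C)"
    using K by (intro exI[of _ K] exI[of _ "real b"]) auto
qed

section \<open>The number of bad words\<close>

definition bad_words :: "nat \<Rightarrow> (real \<Rightarrow> real) \<Rightarrow> nat list set" where
  "bad_words n f = {w \<in> words n. \<not> good_word n f w}"

lemma finite_words_less: "finite {w \<in> words n. length w < k}"
proof -
  have "{w \<in> words n. length w < k} = (\<Union>i<k. {w \<in> words n. length w = i})" by auto
  then show ?thesis using finite_words_length by auto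
qed

lemma finite_bad_words: "tame n f \<Longrightarrow> finite (bad_words n f)"
proof -
  assume "tame n f"
  then obtain k where k: "\<And>w. w \<in> words n \<Longrightarrow> length w = k \<Longrightarrow> good_word n f w" by (auto simp: tame_def)
  have "bad_words n f \<subseteq> {w \<in> words n. length w < k}"
    using good_word_longer[OF k] by (auto simp: bad_words_def not_le[symmetric])
  then show ?thesis using finite_words_less finite_subset by blast
qed

text \<open>In the product \<open>g\<close> acts first. A bad word of the product is bad for
  \<open>g\<close>, or it is mapped by \<open>g\<close> onto a word that is bad for
  \<open>f\<close>; in the second case it is determined by its image since \<open>g\<close> is
  injective.\<close>

lemma card_bad_words_mult_le:
  assumes n: "n \<ge> 2" and f: "f \<in> carrier (thompson_T n)" and g: "g \<in> carrier (thompson_T n)"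
  shows "card (bad_words n (f \<otimes>\<^bsub>thompson_T n\<^esub> g)) \<le> card (bad_words n f) + card (bad_words n g)"
proof -
  have fin: "finite (bad_words n f)" "finite (bad_words n g)"
    using thompson_T_imp_tame[OF n] finite_bad_words f g by auto
  have "\<forall>w. \<exists>v. good_word n g w \<longrightarrow> v \<in> words n \<and> maps_word n g w v"
    by (auto simp: good_word_def)
  then obtain V where V: "\<And>w. good_word n g w \<Longrightarrow> V w \<in> words n \<and> maps_word n g w (V w)"
    by metis
  let ?X = "{w \<in> words n. good_word n g w \<and> V w \<in> bad_words n f}"
  have inj: "inj_on V ?X"
  proof (rule inj_onI)
    fix w v assume wv: "w \<in> ?X" "v \<in> ?X" "V w = V v"
    then show "w = v"
      using maps_word_source_unique[OF n _ _ _ _ _ bij_betw_imp_inj_on[OF thompson_T_bij[OF n g]],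
          of w v "V w"] V[of w] V[of v] by simp
  qed
  have X: "finite ?X" "card ?X \<le> card (bad_words n f)"
    using inj_on_finite[OF inj _ fin(1)] card_inj_on_le[OF inj _ fin(1)] by auto
  have "bad_words n (compose circle f g) \<subseteq> bad_words n g \<union> ?X"
  proof
    fix w assume w: "w \<in> bad_words n (compose circle f g)"
    show "w \<in> bad_words n g \<union> ?X"
    proof (cases "good_word n g w")
      case True
      have "\<not> good_word n f (V w)"
        using w V[OF True] maps_word_compose_circle[of n g w "V w" f] by (auto simp: bad_words_def good_word_def)
      then show ?thesis using True w V[OF True] by (auto simp: bad_words_def)
    qed (use w in \<open>auto simp: bad_words_def\<close>)
  qed
  then have "card (bad_words n (compose circle f g)) \<le> card (bad_words n g \<union> ?X)"
    using fin X by (intro card_mono) auto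
  also have "\<dots> \<le> card (bad_words n g) + card ?X" by (rule card_Un_le)
  finally show ?thesis using X by (simp add: thompson_T_mult[OF n f g])
qed

lemma bad_words_one: "bad_words n (\<lambda>x\<in>circle. x) = {}"
  by (auto simp: bad_words_def good_word_def maps_word_def frac_in_circle)

lemma card_bad_words_le_word_length:
  assumes n: "n \<ge> 2" and A: "finite_generating_set (thompson_T n) A"
  shows "\<exists>c. \<forall>f\<in>carrier (thompson_T n). card (bad_words n f) \<le> c * word_length (thompson_T n) A f"
  using A card_bad_words_mult_le[OF n]
  by (intro group.subadditive_le_word_length[OF group_thompson_T[OF n]])
     (auto simp: thompson_T_one bad_words_one)

lemma word_length_hom_le:
  assumes G: "group G" "group H" and f: "f \<in> hom G H"
    and A: "finite_generating_set G A" and B: "finite_generating_set H B"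
  shows "\<exists>c. \<forall>g\<in>carrier G. word_length H B (f g) \<le> c * word_length G A g"
proof -
  interpret G: group G by (rule G)
  interpret H: group H by (rule G)
  interpret group_hom G H f by unfold_locales (rule f)
  show ?thesis using A B by (intro G.subadditive_le_word_length) (auto simp: H.word_length_one H.word_length_mult_le)
qed

lemma code_inj:
  assumes n: "n \<ge> 2"
  shows "u \<in> words n \<Longrightarrow> v \<in> words n \<Longrightarrow> code_word n u = code_word n v \<Longrightarrow> u = v"
proof (induction u arbitrary: v)
  case Nil
  then show ?case using n by (cases v) (auto simp: code_def split: if_splits)
next
  case (Cons a u)
  then obtain b v' where v: "v = b # v'"
    using n by (cases v) (auto simp: code_def split: if_splits)
  then have "a = b" using Cons.prems by (intro code_append_eq[OF n]) auto
  then show ?case using Cons.IH[of v'] Cons.prems v by auto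
qed

lemma card_bad_words_conj_map:
  assumes n: "n \<ge> 2" and f: "f \<in> carrier (thompson_T n)"
  shows "card (bad_words n f) \<le> card (bad_words 2 (conj_map n f))"
proof (rule card_inj_on_le)
  show "inj_on (code_word n) (bad_words n f)"
    by (rule inj_onI) (auto simp: bad_words_def intro: code_inj[OF n])
  show "code_word n ` bad_words n f \<subseteq> bad_words 2 (conj_map n f)"
    using good_word_code_wordD[OF n f] by (auto simp: bad_words_def code_word_words)
  show "finite (bad_words 2 (conj_map n f))"
    using thompson_T_imp_tame[OF _ conj_map_closed[OF n f]] by (intro finite_bad_words) auto
qed

section \<open>Cyclic partitions of the circle\<close>

text \<open>The last condition says that each interval ends where its cyclic successor begins, with
  wrap-around from the last to the first. This is the part that is stable under rotation and that
  makes a map between two such partitions match at the joints.\<close>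

definition cyc_partition :: "nat \<Rightarrow> nat list list \<Rightarrow> bool" where
  "cyc_partition n ws \<longleftrightarrow> ws \<noteq> [] \<and> set ws \<subseteq> words n \<and> distinct ws \<and>
     (\<forall>x\<in>circle. \<exists>w\<in>set ws. \<exists>y\<in>circle. x = aff n w y) \<and>
     (\<forall>u\<in>set ws. \<forall>v\<in>set ws. \<forall>y\<in>circle. \<forall>z\<in>circle. aff n u y = aff n v z \<longrightarrow> u = v) \<and>
     (\<forall>p<length ws. frac (aff n (ws ! p) 1) = aff n (ws ! (Suc p mod length ws)) 0)"

lemma cyc_partition_rotate1:
  assumes "cyc_partition n ws" shows "cyc_partition n (rotate1 ws)"
proof -
  have "frac (aff n (rotate1 ws ! p) 1) = aff n (rotate1 ws ! (Suc p mod length (rotate1 ws))) 0"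
    if "p < length (rotate1 ws)" for p
  proof -
    have "Suc p mod length ws < length ws" using that by (intro mod_less_divisor) auto
    then show ?thesis using assms that by (simp add: nth_rotate1 cyc_partition_def)
  qed
  then show ?thesis using assms unfolding cyc_partition_def by simp
qed

lemma cyc_partition_rotate: "cyc_partition n ws \<Longrightarrow> cyc_partition n (rotate k ws)"
  by (induction k) (auto simp: cyc_partition_rotate1)

text \<open>A word longer than every member of the cover meets one of them in its left endpoint and
  hence extends it.\<close>

lemma tame_of_cover:
  assumes n: "n > 0" and W: "finite W" "W \<subseteq> words n" "\<And>w. w \<in> W \<Longrightarrow> good_word n f w"
    and cov: "\<And>x. x \<in> circle \<Longrightarrow> \<exists>w\<in>W. \<exists>y\<in>circle. x = aff n w y"
  shows "tame n f"
proof -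
  have c0: "(0::real) \<in> circle" by (simp add: circle_def)
  have "good_word n f w" if w: "w \<in> words n" "length w = (\<Sum>w\<in>W. length w)" for w
  proof -
    obtain u y where u: "u \<in> W" "y \<in> circle" "aff n w 0 = aff n u y"
      using cov[OF aff_circle[OF w(1) c0]] by blast
    have "length u \<le> length w" unfolding w(2) using W u by (intro member_le_sum) auto
    then obtain t where "t \<in> words n" "w = u @ t"
      using aff_eq_imp_prefix[OF u(3)[symmetric] u(2) c0] u W w by auto
    then show ?thesis using W(3)[OF u(1)] good_word_append by simp
  qed
  then show ?thesis by (auto simp: tame_def)
qed

text \<open>The map is defined piecewise on half-open intervals, where existence and uniqueness of
  the piece give a bijection. The order of the two lists matters only for the endpoints.\<close>

lemma ex_thompson_T_of_partitions:
  assumes n: "n \<ge> 2" and ws: "cyc_partition n ws" and vs: "cyc_partition n vs"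
    and len: "length ws = length vs"
  shows "\<exists>f\<in>carrier (thompson_T n). \<forall>p<length ws. maps_word n f (ws ! p) (vs ! p)"
proof -
  let ?m = "length ws"
  have n0: "n > 0" using n by simp
  have cov: "\<exists>p<length us. \<exists>y\<in>circle. x = aff n (us ! p) y" if "cyc_partition n us" "x \<in> circle" for us x
    using that unfolding cyc_partition_def by (metis in_set_conv_nth)
  have uniq: "p = q \<and> y = z" if "cyc_partition n us" "p < length us" "q < length us" "y \<in> circle" "z \<in> circle"
    "aff n (us ! p) y = aff n (us ! q) z" for us p q y z
  proof -
    have e: "us ! p = us ! q" using that unfolding cyc_partition_def by (meson nth_mem)
    moreover have "distinct us" using that(1) by (simp add: cyc_partition_def)
    ultimately have "p = q" using nth_eq_iff_index_eq that(2,3) by blast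
    then show ?thesis using that(6) aff_eq_iff[OF n0] by blast
  qed
  have words: "ws ! p \<in> words n" "vs ! p \<in> words n" if "p < ?m" for p
    using ws vs that len nth_mem[of p ws] nth_mem[of p vs] by (auto simp: cyc_partition_def)
  have "\<forall>x\<in>circle. \<exists>z. \<exists>p<?m. \<exists>y\<in>circle. x = aff n (ws ! p) y \<and> z = aff n (vs ! p) y"
    using cov[OF ws] by blast
  then obtain g where g: "\<And>x. x \<in> circle \<Longrightarrow>
      \<exists>p<?m. \<exists>y\<in>circle. x = aff n (ws ! p) y \<and> g x = aff n (vs ! p) y"
    by metis
  define f where "f = restrict g circle"
  have f: "f (aff n (ws ! p) y) = aff n (vs ! p) y" if py: "p < ?m" "y \<in> circle" for p y
  proof -
    have c: "aff n (ws ! p) y \<in> circle" using aff_circle[OF words(1)] py by blast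
    then obtain q z where q: "q < ?m" "z \<in> circle" "aff n (ws ! p) y = aff n (ws ! q) z"
      "g (aff n (ws ! p) y) = aff n (vs ! q) z" using g by blast
    then have "p = q \<and> y = z" using uniq[OF ws] py by blast
    then show ?thesis using q c by (simp add: f_def)
  qed
  have bij: "bij_betw f circle circle"
  proof (rule bij_betwI')
    show "f x \<in> circle" if x: "x \<in> circle" for x
      using cov[OF ws x] f words(2) aff_circle by metis
    show "\<exists>x\<in>circle. y = f x" if y: "y \<in> circle" for y
      using cov[OF vs y] f words(1) len aff_circle by metis
    show "f x = f x' \<longleftrightarrow> x = x'" if x: "x \<in> circle" "x' \<in> circle" for x x'
    proof
      assume e: "f x = f x'"
      obtain p y where p: "p < ?m" "y \<in> circle" "x = aff n (ws ! p) y" using cov[OF ws x(1)] by blast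
      obtain q z where q: "q < ?m" "z \<in> circle" "x' = aff n (ws ! q) z" using cov[OF ws x(2)] by blast
      have "aff n (vs ! p) y = aff n (vs ! q) z" using e f p q by simp
      then have "p = q \<and> y = z" using uniq[OF vs] p q len by simp
      then show "x = x'" using p q by simp
    qed simp
  qed
  then have B: "f \<in> Bij circle" by (simp add: Bij_def f_def)
  have maps: "maps_word n f (ws ! p) (vs ! p)" if p: "p < ?m" for p
    unfolding maps_word_def
  proof
    fix x :: real assume x: "x \<in> {0..1}"
    show "f (frac (aff n (ws ! p) x)) = frac (aff n (vs ! p) x)"
    proof (cases "x = 1")
      \<comment> \<open>The right endpoint belongs to the next piece. Both partitions are cyclically
        adjacent in the same order, so the next source piece starts at the value demanded
        here.\<close>
      case True
      have "Suc p mod ?m < ?m" using p by (intro mod_less_divisor) auto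
      then have "f (aff n (ws ! (Suc p mod ?m)) 0) = aff n (vs ! (Suc p mod ?m)) 0"
        by (intro f) (auto simp: circle_def)
      then show ?thesis using ws vs p len True by (simp add: cyc_partition_def)
    next
      case False
      then have "x \<in> circle" using x by (auto simp: circle_def)
      then show ?thesis using f[OF p] words[OF p] by (simp add: frac_circle aff_circle)
    qed
  qed
  have "tame n f"
  proof (rule tame_of_cover[OF n0, of "set ws"])
    show "good_word n f w" if "w \<in> set ws" for w
      using that maps words by (metis good_word_def in_set_conv_nth)
  qed (use ws in \<open>auto simp: cyc_partition_def\<close>)
  then have "f \<in> carrier (thompson_T n)" using B n by (simp add: thompson_T_iff)
  then show ?thesis using maps by blast
qed

text \<open>The uncut version of adjacency, with consecutive intervals filling \<open>[a,b]\<close>.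
  It is compatible with concatenation and rescaling, which suits induction over trees; the chain
  from 0 to 1 is then closed up to a cyclic partition.\<close>

primrec chain :: "nat \<Rightarrow> real \<Rightarrow> real \<Rightarrow> nat list list \<Rightarrow> bool" where
  "chain n a b [] \<longleftrightarrow> a = b"
| "chain n a b (w # ws) \<longleftrightarrow> aff n w 0 = a \<and> chain n (aff n w 1) b ws"

lemma chain_append: "chain n a c us \<Longrightarrow> chain n c b vs \<Longrightarrow> chain n a b (us @ vs)"
  by (induction us arbitrary: a) auto

lemma chain_map_Cons:
  "chain n a b ws \<Longrightarrow> chain n ((real j + a) / real n) ((real j + b) / real n) (map ((#) j) ws)"
  by (induction ws arbitrary: a) auto

lemma chain_le: "n > 0 \<Longrightarrow> chain n a b ws \<Longrightarrow> a \<le> b"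
proof (induction ws arbitrary: a)
  case (Cons w ws)
  then show ?case using aff_less_iff[of n w 0 1] by fastforce
qed simp

lemma chain_bounds:
  "n > 0 \<Longrightarrow> chain n a b ws \<Longrightarrow> w \<in> set ws \<Longrightarrow> a \<le> aff n w 0 \<and> aff n w 1 \<le> b"
proof (induction ws arbitrary: a)
  case (Cons u ws)
  have "aff n u 0 \<le> aff n u 1" using aff_le_iff[OF Cons.prems(1), of u 0 1] by simp
  moreover have "aff n u 1 \<le> b" using Cons.prems by (intro chain_le[of n _ b ws]) auto
  moreover have "aff n u 1 \<le> aff n w 0 \<and> aff n w 1 \<le> b" if "w \<in> set ws"
    using Cons.prems that by (intro Cons.IH) auto
  ultimately show ?case using Cons.prems by auto
qed simp

lemma chain_sorted:
  "n > 0 \<Longrightarrow> chain n a b ws \<Longrightarrow> sorted_wrt (\<lambda>u v. aff n u 1 \<le> aff n v 0) ws"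
proof (induction ws arbitrary: a)
  case (Cons w ws)
  then have "chain n (aff n w 1) b ws" by simp
  then show ?case using Cons.IH Cons.prems(1) chain_bounds by fastforce
qed simp

lemma chain_cover:
  "n > 0 \<Longrightarrow> chain n a b ws \<Longrightarrow> a \<le> x \<Longrightarrow> x < b \<Longrightarrow> \<exists>w\<in>set ws. \<exists>y\<in>circle. x = aff n w y"
proof (induction ws arbitrary: a)
  case (Cons w ws)
  show ?case
  proof (cases "x < aff n w 1")
    case True
    then have "x \<in> aff n w ` {0..1}" using Cons.prems by (simp add: aff_image)
    then obtain y where "y \<in> {0..1}" "x = aff n w y" by blast
    moreover from this have "y \<in> circle" using True Cons.prems(1) by (auto simp: circle_def aff_less_iff)
    ultimately show ?thesis by auto
  next
    case False
    then show ?thesis using Cons.IH[of "aff n w 1"] Cons.prems by auto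
  qed
qed simp

lemma chain_adjacent:
  "chain n a b ws \<Longrightarrow> Suc p < length ws \<Longrightarrow> aff n (ws ! p) 1 = aff n (ws ! Suc p) 0"
proof (induction ws arbitrary: a p)
  case (Cons w ws)
  then show ?case by (cases p; cases ws) auto
qed simp

lemma chain_last: "chain n a b ws \<Longrightarrow> ws \<noteq> [] \<Longrightarrow> aff n (last ws) 1 = b"
  by (induction ws arbitrary: a) auto

lemma chain_hd: "chain n a b ws \<Longrightarrow> ws \<noteq> [] \<Longrightarrow> aff n (hd ws) 0 = a"
  by (cases ws) auto

lemma sorted_wrt_chain_left:
  assumes "n > 0" "chain n a b ws" shows "sorted_wrt (<) (map (\<lambda>w. aff n w 0) ws)"
proof -
  have "aff n u 0 < aff n u 1" for u using assms(1) by (simp add: aff_less_iff)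
  then have "aff n u 0 < aff n v 0" if "aff n u 1 \<le> aff n v 0" for u v
    using that order_less_le_trans by blast
  then show ?thesis unfolding sorted_wrt_map
    by (intro sorted_wrt_mono_rel[OF _ chain_sorted[OF assms]])
qed

lemma cyc_partition_chain:
  assumes n: "n > 0" and ch: "chain n 0 1 ws" and w: "set ws \<subseteq> words n"
  shows "cyc_partition n ws"
proof -
  have ne: "ws \<noteq> []" using ch by auto
  have lt: "aff n (ws ! p) 1 \<le> aff n (ws ! q) 0" if "p < q" "q < length ws" for p q
    using chain_sorted[OF n ch] that by (simp add: sorted_wrt_iff_nth_less)
  have *: False if "p < q" "q < length ws" "y \<in> circle" "z \<in> circle" "aff n (ws ! p) y = aff n (ws ! q) z" for p q y z
  proof -
    have "aff n (ws ! p) y < aff n (ws ! p) 1"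
      using that(3) by (simp add: aff_less_iff[OF n] circle_def)
    also have "\<dots> \<le> aff n (ws ! q) 0" using lt that by blast
    also have "\<dots> \<le> aff n (ws ! q) z" using that(4) by (simp add: aff_le_iff[OF n] circle_def)
    finally show False using that by simp
  qed
  have "distinct (map (\<lambda>w. aff n w 0) ws)"
    using sorted_wrt_chain_left[OF n ch] strict_sorted_iff by blast
  then have d: "distinct ws" by (simp add: distinct_map)
  have "frac (aff n (ws ! p) 1) = aff n (ws ! (Suc p mod length ws)) 0" if p: "p < length ws" for p
  proof (cases "Suc p < length ws")
    case True
    then have "aff n (ws ! Suc p) 0 \<in> circle" using w by (intro aff_circle) (auto simp: circle_def)
    then show ?thesis using True chain_adjacent[OF ch True] by (simp add: frac_circle)
  next
    case False
    then have "Suc p = length ws" using p by simp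
    then have "aff n (ws ! p) 1 = 1" using chain_last[OF ch ne] by (metis diff_Suc_1 last_conv_nth ne)
    then show ?thesis using chain_hd[OF ch ne] ne \<open>Suc p = length ws\<close> by (simp add: hd_conv_nth)
  qed
  moreover have "u = v" if uv: "u \<in> set ws" "v \<in> set ws" "y \<in> circle" "z \<in> circle" "aff n u y = aff n v z" for u v y z
  proof -
    obtain p q where pq: "p < length ws" "q < length ws" "u = ws ! p" "v = ws ! q"
      using uv by (metis in_set_conv_nth)
    then show ?thesis using *[of p q y z] *[of q p z y] uv by (cases p q rule: linorder_cases) auto
  qed
  ultimately show ?thesis
    using ne w d chain_cover[OF n ch] by (auto simp: cyc_partition_def circle_def)
qed

section \<open>Leaves of trees\<close>

text \<open>Pairs each label with the address of its leaf. Addresses are words in the sense of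
  \<open>aff\<close>, which translates \<open>leaf_interval\<close> into the language of
  \<open>maps_word\<close>.\<close>

function leaves :: "ltree \<Rightarrow> (nat \<times> nat list) list" where
  "leaves (Leaf i) = [(i, [])]"
| "leaves (Caret ts) = concat (map (\<lambda>j. map (\<lambda>(i, w). (i, j # w)) (leaves (ts ! j))) [0..<length ts])"
  by pat_completeness auto
termination
proof (relation "Wellfounded.measure size")
  fix ts :: "ltree list" and j
  assume "j \<in> set [0..<length ts]"
  then have "ts ! j \<in> set ts" by simp
  then show "(ts ! j, Caret ts) \<in> Wellfounded.measure size"
    using size_list_estimation'[of "ts ! j" ts "size (ts ! j)" size] by simp
qed simp

lemma leaf_labels_eq: "leaf_labels t = map fst (leaves t)"
proof (induction t)
  case (Caret ts)
  have "map leaf_labels ts = map (\<lambda>j. leaf_labels (ts ! j)) [0..<length ts]"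
    by (rule nth_equalityI) simp_all
  then have "concat (map leaf_labels ts) = concat (map (\<lambda>j. leaf_labels (ts ! j)) [0..<length ts])"
    by (rule arg_cong)
  also have "\<dots> = concat (map (\<lambda>j. map fst (leaves (ts ! j))) [0..<length ts])"
    using Caret by (intro arg_cong[where f = concat] map_cong) auto
  finally show ?case by (simp add: map_concat comp_def case_prod_beta)
qed simp

lemma in_set_leaf_labels: "i \<in> set (leaf_labels t) \<longleftrightarrow> (\<exists>w. (i, w) \<in> set (leaves t))"
  unfolding leaf_labels_eq by force

lemma leaves_words: "nary n t \<Longrightarrow> (i, w) \<in> set (leaves t) \<Longrightarrow> w \<in> words n"
proof (induction t arbitrary: w)
  case (Caret ts)
  then obtain j v where j: "j < length ts" "w = j # v" "(i, v) \<in> set (leaves (ts ! j))" by auto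
  then have "ts ! j \<in> set ts" by simp
  then have "v \<in> words n" using Caret.IH[of "ts ! j" v] Caret.prems(1) j(3) by simp
  then show ?case using j Caret.prems by simp
qed simp

lemma chain_leaves: "nary n t \<Longrightarrow> n > 0 \<Longrightarrow> chain n 0 1 (map snd (leaves t))"
proof (induction t)
  case (Caret ts)
  let ?L = "\<lambda>j. map ((#) j) (map snd (leaves (ts ! j)))"
  have len: "length ts = n" using Caret.prems by simp
  have "k \<le> n \<Longrightarrow> chain n 0 (real k / real n) (concat (map ?L [0..<k]))" for k
  proof (induction k)
    case (Suc k)
    have "ts ! k \<in> set ts" using Suc.prems len by simp
    then have "chain n 0 1 (map snd (leaves (ts ! k)))"
      using Caret by simp
    then have "chain n ((real k + 0) / real n) ((real k + 1) / real n) (?L k)" by (rule chain_map_Cons)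
    then show ?case using chain_append[OF Suc.IH] Suc.prems by (simp add: add.commute)
  qed simp
  from this[of n] show ?case using len Caret.prems(2)
    by (simp add: map_concat comp_def case_prod_beta)
qed simp

lemma cyc_partition_leaves:
  assumes "nary n t" "n > 0" shows "cyc_partition n (map snd (leaves t))"
proof (rule cyc_partition_chain[OF assms(2) chain_leaves[OF assms]], rule subsetI)
  fix w assume "w \<in> set (map snd (leaves t))"
  then obtain i where "(i, w) \<in> set (leaves t)" by auto
  then show "w \<in> words n" by (rule leaves_words[OF assms(1)])
qed

lemma subinterval_affine:
  "a + real j * ((b - a) / real n) + (a + real (j + 1) * ((b - a) / real n) - (a + real j * ((b - a) / real n))) * x
      = a + (b - a) * ((real j + x) / real n)"
proof -
  have "a + real j * d + (a + real (j + 1) * d - (a + real j * d)) * x = a + d * (real j + x)" for d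
    by (simp add: algebra_simps)
  from this[of "(b - a) / real n"] show ?thesis by simp
qed

lemma leaf_interval_imp:
  "leaf_interval t a b i K \<Longrightarrow> nary n t \<Longrightarrow>
    \<exists>w. (i, w) \<in> set (leaves t) \<and> K = {a + (b - a) * aff n w 0..a + (b - a) * aff n w 1}"
proof (induction rule: leaf_interval.induct)
  case (2 j ts a b i K)
  then obtain w where w: "(i, w) \<in> set (leaves (ts ! j))"
    "K = {a + real j * ((b - a) / real (length ts)) + (a + real (j + 1) * ((b - a) / real (length ts)) - (a + real j * ((b - a) / real (length ts)))) * aff n w 0..
      a + real j * ((b - a) / real (length ts)) + (a + real (j + 1) * ((b - a) / real (length ts)) - (a + real j * ((b - a) / real (length ts)))) * aff n w 1}"
    by auto
  have len: "length ts = n" using 2 by simp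
  note e = subinterval_affine[of a j b n]
  have "K = {a + (b - a) * aff n (j # w) 0..a + (b - a) * aff n (j # w) 1}"
    using w(2) unfolding len e by simp
  moreover have "(i, j # w) \<in> set (leaves (Caret ts))" using w(1) 2(1) by force
  ultimately show ?case by blast
qed auto

lemma leaf_interval_of_leaf:
  "nary n t \<Longrightarrow> (i, w) \<in> set (leaves t) \<Longrightarrow>
    leaf_interval t a b i {a + (b - a) * aff n w 0..a + (b - a) * aff n w 1}"
proof (induction t arbitrary: a b w)
  case (Leaf k)
  then show ?case using leaf_interval.intros(1)[of k a b] by simp
next
  case (Caret ts)
  then obtain j v where j: "j < length ts" "w = j # v" "(i, v) \<in> set (leaves (ts ! j))" by auto
  have len: "length ts = n" using Caret by simp
  note e = subinterval_affine[of a j b n]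
  have "ts ! j \<in> set ts" using j by simp
  then have "leaf_interval (ts ! j) (a + real j * ((b - a) / real n)) (a + real (j + 1) * ((b - a) / real n)) i
    {a + (b - a) * ((real j + aff n v 0) / real n)..a + (b - a) * ((real j + aff n v 1) / real n)}"
    unfolding e[symmetric] using Caret j by (intro Caret.IH) auto
  then show ?case using leaf_interval.intros(2)[OF j(1), of a b i] len j(2) by simp
qed

lemma leaf_interval_iff:
  assumes "nary n t" "n > 0"
  shows "leaf_interval t 0 1 i K \<longleftrightarrow> (\<exists>w. (i, w) \<in> set (leaves t) \<and> K = aff n w ` {0..1})"
proof
  assume "leaf_interval t 0 1 i K"
  then show "\<exists>w. (i, w) \<in> set (leaves t) \<and> K = aff n w ` {0..1}"
    using leaf_interval_imp[of t 0 1 i K n] assms by (simp add: aff_image)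
next
  assume "\<exists>w. (i, w) \<in> set (leaves t) \<and> K = aff n w ` {0..1}"
  then obtain w where w: "(i, w) \<in> set (leaves t)" "K = aff n w ` {0..1}" by blast
  show "leaf_interval t 0 1 i K"
    using leaf_interval_of_leaf[OF assms(1) w(1), of 0 1] by (simp add: w(2) aff_image[OF assms(2)])
qed

section \<open>Elements determined by tree pairs\<close>

definition maps_leaves :: "nat \<Rightarrow> (real \<Rightarrow> real) \<Rightarrow> ltree \<Rightarrow> ltree \<Rightarrow> bool" where
  "maps_leaves n f S R \<longleftrightarrow>
     (\<forall>i w v. (i, w) \<in> set (leaves S) \<longrightarrow> (i, v) \<in> set (leaves R) \<longrightarrow> maps_word n f w v)"

lemma represents_iff:
  assumes "n > 0"
  shows "represents n (S, R) f \<longleftrightarrow>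
    labelled_tree_pair n (S, R) \<and> f \<in> carrier (thompson_T n) \<and> maps_leaves n f S R"
proof -
  have "(\<forall>i K L. leaf_interval S 0 1 i K \<longrightarrow> leaf_interval R 0 1 i L \<longrightarrow> maps_affinely_onto f K L)
      \<longleftrightarrow> maps_leaves n f S R" if "nary n S" "nary n R"
    unfolding maps_leaves_def leaf_interval_iff[OF that(1) assms] leaf_interval_iff[OF that(2) assms]
    using maps_affinely_onto_iff[OF assms, of f] by blast
  then show ?thesis by (auto simp: represents_def labelled_tree_pair_def)
qed

lemma maps_leaves_unique:
  assumes n: "n \<ge> 2" and t: "nary n S" "nary n R" "set (leaf_labels S) \<subseteq> set (leaf_labels R)"
    and fg: "f \<in> carrier (thompson_T n)" "g \<in> carrier (thompson_T n)"
    and m: "maps_leaves n f S R" "maps_leaves n g S R"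
  shows "f = g"
proof (rule thompson_T_eqI[OF n n fg])
  fix x assume "x \<in> circle"
  then obtain i w y where w: "(i, w) \<in> set (leaves S)" "y \<in> circle" "x = aff n w y"
    using cyc_partition_leaves[OF t(1)] n by (auto simp: cyc_partition_def)
  have "i \<in> set (leaf_labels R)" using t(3) w(1) in_set_leaf_labels by blast
  then obtain v where v: "(i, v) \<in> set (leaves R)" using in_set_leaf_labels by blast
  then have "f (aff n w y) = aff n v y" "g (aff n w y) = aff n v y"
    using m w v leaves_words[OF t(1)] leaves_words[OF t(2)]
    unfolding maps_leaves_def by (blast intro: maps_word_circle)+
  then show "f x = g x" using w by simp
qed

lemma maps_leaves_compose:
  assumes "maps_leaves n f S R" "maps_leaves n g R Q" "set (leaf_labels S) \<subseteq> set (leaf_labels R)"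
  shows "maps_leaves n (compose circle g f) S Q"
  unfolding maps_leaves_def
proof (intro allI impI)
  fix i w v assume w: "(i, w) \<in> set (leaves S)" "(i, v) \<in> set (leaves Q)"
  have "i \<in> set (leaf_labels R)" using assms(3) w(1) in_set_leaf_labels by blast
  then obtain u where u: "(i, u) \<in> set (leaves R)" using in_set_leaf_labels by blast
  then show "maps_word n (compose circle g f) w v"
    using assms w unfolding maps_leaves_def by (blast intro: maps_word_compose_circle)
qed

text \<open>Cyclic partitions may be rotated. Rotating the leaves of \<open>S\<close> by
  \<open>k\<close> aligns the label sequences, so that equal labels are the same as equal
  positions.\<close>

lemma ex_maps_leaves:
  assumes n: "n \<ge> 2" and t: "nary n S" "nary n R"
    and rot: "leaf_labels R = rotate k (leaf_labels S)" "distinct (leaf_labels S)"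
  shows "\<exists>f\<in>carrier (thompson_T n). maps_leaves n f S R"
proof -
  have n0: "n > 0" using n by simp
  let ?S = "rotate k (leaves S)"
  have e: "map fst ?S = map fst (leaves R)" using rot by (simp add: leaf_labels_eq rotate_map)
  then have len: "length ?S = length (leaves R)" by (metis length_map)
  obtain f where f: "f \<in> carrier (thompson_T n)"
    "\<And>p. p < length ?S \<Longrightarrow> maps_word n f (map snd ?S ! p) (map snd (leaves R) ! p)"
    using ex_thompson_T_of_partitions[OF n cyc_partition_rotate[OF cyc_partition_leaves[OF t(1) n0], of k]
      cyc_partition_leaves[OF t(2) n0]] len
    by (auto simp: rotate_map)
  have "maps_leaves n f S R"
    unfolding maps_leaves_def
  proof (intro allI impI)
    fix i w v assume w: "(i, w) \<in> set (leaves S)" "(i, v) \<in> set (leaves R)"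
    then obtain p q where p: "p < length ?S" "?S ! p = (i, w)" and q: "q < length (leaves R)" "leaves R ! q = (i, v)"
      by (metis in_set_conv_nth set_rotate)
    have "map fst ?S ! p = map fst ?S ! q" using p q len unfolding e by (metis e fst_conv nth_map)
    moreover have "distinct (map fst ?S)" using rot(2) by (simp add: leaf_labels_eq rotate_map[symmetric])
    ultimately have "p = q" using nth_eq_iff_index_eq[of "map fst ?S" p q] p(1) q(1) len by fastforce
    then show "maps_word n f w v" using f(2)[OF p(1)] p q by simp
  qed
  then show ?thesis using f by blast
qed

section \<open>Tree pairs of elements\<close>

text \<open>Adjacent pieces of \<open>f\<close> have adjacent images, except at the point sent to \<open>0\<close>. Hence \<open>f\<close>
  increases on both sides of that point.\<close>

lemma thompson_T_cyclic_mono: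
  assumes n: "n \<ge> 2" and fT: "f \<in> carrier (thompson_T n)"
  obtains c where "c \<in> circle"
    "\<And>x y. \<lbrakk>x \<in> circle; y \<in> circle; x < y; \<not> (x < c \<and> c \<le> y)\<rbrakk> \<Longrightarrow> f x < f y"
    "\<And>x y. \<lbrakk>x \<in> circle; y \<in> circle; x < c; c \<le> y\<rbrakk> \<Longrightarrow> f y < f x"
proof -
  have n0: "n > 0" using n by simp
  have bij: "bij_betw f circle circle" by (rule thompson_T_bij[OF n fT])
  obtain k V where V: "\<And>w. w \<in> words n \<Longrightarrow> length w = k \<Longrightarrow> V w \<in> words n \<and> maps_word n f w (V w)"
    using thompson_T_imp_tame(2)[OF n fT] tame_wordmap by metis
  define M where "M = n ^ k"
  have M: "M > 0" using n by (simp add: M_def)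
  have mless: "x * real M < y * real M \<longleftrightarrow> x < y" and mle: "x * real M \<le> y * real M \<longleftrightarrow> x \<le> y" for x y
    using M by simp_all
  have "\<forall>l. \<exists>v. l < M \<longrightarrow> v \<in> words n \<and> (\<forall>x\<in>{0..1}. f (frac ((real l + x) / real M)) = frac (aff n v x))"
  proof (intro allI)
    fix l show "\<exists>v. l < M \<longrightarrow> v \<in> words n \<and> (\<forall>x\<in>{0..1}. f (frac ((real l + x) / real M)) = frac (aff n v x))"
    proof (cases "l < M")
      case True
      then obtain w where w: "w \<in> words n" "length w = k" "\<And>x. aff n w x = (real l + x) / real n ^ k"
        using ex_word_value[of l n k] by (auto simp: M_def)
      then show ?thesis using V[OF w(1,2)] by (intro exI[of _ "V w"]) (auto simp: maps_word_def M_def)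
    qed simp
  qed
  then obtain v where v: "\<And>l. l < M \<Longrightarrow> v l \<in> words n"
    "\<And>l x. l < M \<Longrightarrow> x \<in> {0..1} \<Longrightarrow> f (frac ((real l + x) / real M)) = frac (aff n (v l) x)"
    by metis
  \<comment> \<open>The limit of \<open>f\<close> at the right end of the piece number
    \<open>l\<close>. It equals the value at the start of the next piece, except where it is 1 and
    that value is 0.\<close>
  define z where "z l = aff n (v l) 1" for l
  have z01: "0 \<le> z l" "z l \<le> 1" if "l < M" for l
    using v(1)[OF that] by (simp_all add: z_def aff_nonneg aff_le_1)
  have piece: "f x = aff n (v l) (x * real M - real l)"
    if l: "l < M" and x: "real l \<le> x * real M" "x * real M < real l + 1" for l x
  proof -
    have "real l + 1 \<le> real M" using l by linarith
    then have "x * real M < 1 * real M" using x by linarith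
    then have "x < 1" by (simp only: mless)
    moreover have "0 * real M \<le> x * real M" using x by simp
    then have "0 \<le> x" by (simp only: mle)
    ultimately have xc: "x \<in> circle" by (simp add: circle_def)
    have y: "x * real M - real l \<in> circle" using x by (simp add: circle_def)
    have "(real l + (x * real M - real l)) / real M = x" using M by simp
    then show ?thesis
      using v(2)[OF l circle_unit[OF y]] frac_circle[OF xc] frac_circle[OF aff_circle[OF v(1)[OF l] y]] by simp
  qed
  have piece_mono: "f x < f y"
    if "l < M" "real l \<le> x * real M" "x < y" "y * real M < real l + 1" for l x y
  proof -
    have "x * real M < y * real M" using that(3) by (simp only: mless)
    moreover from this have "x * real M < real l + 1" "real l \<le> y * real M" using that by linarith+
    ultimately show ?thesis using that piece[of l x] piece[of l y] n0 by (simp add: aff_less_iff)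
  qed
  have piece_less: "f x < z l"
    if "l < M" "real l \<le> x * real M" "x * real M < real l + 1" for l x
    using that piece[of l x] n0 by (simp add: aff_less_iff z_def)
  have next_piece: "f (frac (real (Suc l) / real M)) = frac (z l)" if "l < M" for l
    using v(2)[OF that, of 1] by (simp add: z_def add.commute)
  have "0 \<in> f ` circle" using bij by (simp add: bij_betw_def circle_def)
  then obtain c where c: "c \<in> circle" "f c = 0" by auto
  have fne: "f x \<noteq> 0" if "x \<in> circle" "x \<noteq> c" for x
    using bij that c by (metis bij_betw_imp_inj_on inj_onD)
  have z_eq: "f (frac (real (Suc l) / real M)) = z l"
    if l: "l < M" "frac (real (Suc l) / real M) \<noteq> c" for l
  proof -
    have "frac (z l) \<noteq> 0" using next_piece[OF l(1)] fne[OF frac_in_circle l(2)] by simp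
    then have "z l \<noteq> 1" by auto
    then have "z l \<in> circle" using z01[OF l(1)] by (auto simp: circle_def)
    then show ?thesis using next_piece[OF l(1)] by (simp add: frac_circle)
  qed
  \<comment> \<open>Induction on the number of pieces needed to reach \<open>y\<close>. If the last
    of them separates \<open>x\<close> from \<open>y\<close>, its left end \<open>b\<close> serves
    as an intermediate point.\<close>
  have mono: "j \<le> M \<Longrightarrow> 0 \<le> x \<Longrightarrow> x < y \<Longrightarrow> y * real M < real j \<Longrightarrow> \<not> (x < c \<and> c \<le> y) \<Longrightarrow> f x < f y" for j x y
  proof (induction j arbitrary: x y)
    case 0
    have "0 < y * real M" using 0 M by simp
    then show ?case using 0 by simp
  next
    case (Suc j)
    have jM: "j < M" using Suc.prems by simp
    consider "y * real M < real j" | "real j \<le> x * real M" | "x * real M < real j" "real j \<le> y * real M" by linarith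
    then show ?case
    proof cases
      case 1
      then show ?thesis using Suc by simp
    next
      case 2
      then show ?thesis using piece_mono[OF jM] Suc.prems by simp
    next
      case 3
      have "j > 0" using 3 Suc.prems(2) M by (cases j) (auto simp: mult_less_0_iff)
      then obtain i where i: "j = Suc i" by (cases j) auto
      have iM: "i < M" using jM i by simp
      define b where "b = real j / real M"
      have bM: "b * real M = real j" using M by (simp add: b_def)
      have xb: "x < b" "b \<le> y"
        using 3 unfolding bM[symmetric] mless mle by auto
      have "b < 1" "0 \<le> b" using jM M by (simp_all add: b_def)
      then have bc: "b \<in> circle" by (simp add: circle_def)
      \<comment> \<open>The point \<open>b\<close> is not \<open>c\<close>, for otherwise
        \<open>c\<close> would lie between \<open>x\<close> and \<open>y\<close>; so there is no
        jump at \<open>b\<close>.\<close>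
      have fb: "f b = z i"
        using z_eq[OF iM] xb Suc.prems(5) frac_circle[OF bc] by (auto simp: b_def i)
      have "f b \<le> f y"
        using piece_mono[OF jM, of b y] xb Suc.prems bM by (cases "b = y") auto
      moreover have "f x < z i"
      proof (cases "real i \<le> x * real M")
        case True
        then show ?thesis using piece_less[OF iM] 3 i by simp
      next
        case False
        define a where "a = real i / real M"
        have aM: "a * real M = real i" using M by (simp add: a_def)
        have "x * real M < a * real M" using False aM by simp
        then have xa: "x < a" by (simp only: mless)
        have "a * real M < b * real M" using aM bM i by simp
        then have "a < b" by (simp only: mless)
        then have "f x < f a" using Suc.prems xa xb aM i by (intro Suc.IH) auto
        also have "f a < z i" using piece_less[OF iM] aM by simp
        finally show ?thesis .
      qed
      ultimately show ?thesis using fb by simp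
    qed
  qed
  have mono': "f x < f y" if "x \<in> circle" "y \<in> circle" "x < y" "\<not> (x < c \<and> c \<le> y)" for x y
    using mono[of M x y] that M by (auto simp: circle_def)
  moreover have "f y < f x" if xy: "x \<in> circle" "y \<in> circle" "x < c" "c \<le> y" for x y
  proof -
    obtain m where m: "M = Suc m" using M by (cases M) auto
    have c0: "(0::real) \<in> circle" "c > 0" using xy by (auto simp: circle_def)
    \<comment> \<open>The last piece closes up with the first one at 0, without a jump because the
      jump is at \<open>c > 0\<close>. Hence the values after \<open>c\<close> stay below
      \<open>f 0\<close>, and those before \<open>c\<close> start from it.\<close>
    have f0: "f 0 = z m" using z_eq[of m] m c0(2) by auto
    have "f y < z m"
    proof (cases "real m \<le> y * real M")
      case True
      have "y * real M < 1 * real M" unfolding mless using xy by (simp add: circle_def)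
      moreover have "real M = real m + 1" using m by simp
      ultimately have "y * real M < real m + 1" by linarith
      then show ?thesis using True m by (intro piece_less) auto
    next
      case False
      define a where "a = real m / real M"
      have aM: "a * real M = real m" using M by (simp add: a_def)
      have "y * real M < a * real M" using False aM by simp
      then have ya: "y < a" by (simp only: mless)
      have "a \<in> circle" using m by (simp add: a_def circle_def)
      then have "f y < f a" using xy ya by (intro mono') auto
      also have "f a < z m" using piece_less[of m a] aM m by simp
      finally show ?thesis .
    qed
    also have "z m \<le> f x" using mono'[OF c0(1) xy(1)] f0 xy by (cases "x = 0") (auto simp: circle_def)
    finally show ?thesis .
  qed
  ultimately show ?thesis using that c(1) by blast
qed

text \<open>Splits every vertex that violates \<open>P\<close> and stops at the first one that
  satisfies it; \<open>w\<close> is the address of the current root. The number \<open>d\<close>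
  only bounds the depth, and it has no influence once all words of that length satisfy
  \<open>P\<close>.\<close>

primrec grow :: "nat \<Rightarrow> nat \<Rightarrow> (nat list \<Rightarrow> bool) \<Rightarrow> (nat list \<Rightarrow> nat) \<Rightarrow> nat list \<Rightarrow> ltree" where
  "grow n 0 P g w = Leaf (g w)"
| "grow n (Suc d) P g w = (if P w then Leaf (g w) else Caret (map (\<lambda>j. grow n d P g (w @ [j])) [0..<n]))"

fun carets :: "ltree \<Rightarrow> nat" where
  "carets (Leaf i) = 0"
| "carets (Caret ts) = Suc (sum_list (map carets ts))"

lemma leaves_Caret_map:
  "leaves (Caret (map F [0..<n])) = concat (map (\<lambda>j. map (\<lambda>(i, w). (i, j # w)) (leaves (F j))) [0..<n])"
proof -
  have "map (\<lambda>j. map (\<lambda>(i, w). (i, j # w)) (leaves (map F [0..<n] ! j))) [0..<n] =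
    map (\<lambda>j. map (\<lambda>(i, w). (i, j # w)) (leaves (F j))) [0..<n]"
    by (intro map_cong) auto
  then show ?thesis by (simp only: leaves.simps(2) length_map length_upt diff_zero)
qed

lemma nary_grow: "nary n (grow n d P g w)"
  by (induction d arbitrary: w) auto

text \<open>The shape does not depend on the labelling. This permits reading off the leaves with
  dummy labels before the actual labels, which are defined in terms of these leaves, are
  available.\<close>

lemma leaves_grow:
  "leaves (grow n d P g w) = map (\<lambda>a. (g (w @ a), a)) (map snd (leaves (grow n d P h w)))"
proof (induction d arbitrary: w)
  case (Suc d)
  show ?case
  proof (cases "P w")
    case False
    then have L: "leaves (grow n (Suc d) P g w) =
        concat (map (\<lambda>j. map (\<lambda>(i, a). (i, j # a)) (leaves (grow n d P g (w @ [j])))) [0..<n])" for g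
      by (simp add: leaves_Caret_map del: leaves.simps(2))
    have E: "map (\<lambda>(i, a). (i, j # a)) (leaves (grow n d P g (w @ [j]))) =
        map (\<lambda>a. (g (w @ a), a)) (map snd (map (\<lambda>(i, a). (i, j # a)) (leaves (grow n d P h (w @ [j])))))" for j
      by (subst Suc.IH) (simp add: comp_def case_prod_unfold)
    show ?thesis by (simp only: L[of g] E L[of h] map_concat map_map comp_def)
  qed simp
qed simp

lemma grow_leaf:
  "\<lbrakk>\<And>u. u \<in> words n \<Longrightarrow> length u = d \<Longrightarrow> P (w @ u); (i, a) \<in> set (leaves (grow n d P g w))\<rbrakk> \<Longrightarrow> P (w @ a)"
proof (induction d arbitrary: w a)
  case (Suc d)
  show ?case
  proof (cases "P w")
    case False
    then obtain j b where j: "j < n" "a = j # b" "(i, b) \<in> set (leaves (grow n d P g (w @ [j])))"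
      using Suc.prems(2) by auto
    have "P ((w @ [j]) @ u)" if "u \<in> words n" "length u = d" for u
      using Suc.prems(1)[of "j # u"] that j by simp
    then have "P ((w @ [j]) @ b)" using Suc.IH j(3) by blast
    then show ?thesis using j by simp
  qed (use Suc.prems in auto)
qed simp

lemma grow_inner:
  "(i, a) \<in> set (leaves (grow n d P g w)) \<Longrightarrow> a = b @ c \<Longrightarrow> c \<noteq> [] \<Longrightarrow> \<not> P (w @ b)"
proof (induction d arbitrary: w a b)
  case (Suc d)
  then have P: "\<not> P w" by (auto split: if_splits)
  then obtain j a' where j: "j < n" "a = j # a'" "(i, a') \<in> set (leaves (grow n d P g (w @ [j])))"
    using Suc.prems(1) by auto
  show ?case
  proof (cases b)
    case (Cons j' b')
    then show ?thesis using Suc.IH[OF j(3), of b'] Suc.prems j by simp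
  qed (use P in simp)
qed simp

text \<open>Carets sit at pairwise distinct addresses, each of which violates
  \<open>P\<close>.\<close>

lemma carets_grow:
  "carets (grow n d P g w) \<le> card {b \<in> words n. length b < d \<and> \<not> P (w @ b)}"
proof (induction d arbitrary: w)
  case (Suc d)
  let ?B = "\<lambda>w d. {b \<in> words n. length b < d \<and> \<not> P (w @ b)}"
  have fin: "finite (?B w d)" for w d
    by (rule finite_subset[OF _ finite_words_less[of n d]]) auto
  show ?case
  proof (cases "P w")
    case False
    have sub: "insert [] (\<Union>j<n. (#) j ` ?B (w @ [j]) d) \<subseteq> ?B w (Suc d)"
      using False by auto
    have "carets (grow n (Suc d) P g w) = Suc (\<Sum>j<n. carets (grow n d P g (w @ [j])))"
      using False by (simp add: comp_def sum_set_upt_conv_sum_list_nat[symmetric] atLeast0LessThan)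
    also have "\<dots> \<le> Suc (\<Sum>j<n. card (?B (w @ [j]) d))"
      by (intro Suc_leI le_imp_less_Suc sum_mono Suc.IH)
    also have "(\<Sum>j<n. card (?B (w @ [j]) d)) = (\<Sum>j<n. card ((#) j ` ?B (w @ [j]) d))"
      by (intro sum.cong refl card_image[symmetric]) auto
    also have "\<dots> = card (\<Union>j<n. (#) j ` ?B (w @ [j]) d)"
      by (intro card_UN_disjoint[symmetric] ballI impI finite_imageI fin) auto
    also have "Suc \<dots> = card (insert [] (\<Union>j<n. (#) j ` ?B (w @ [j]) d))"
      by (intro card_insert_disjoint[symmetric] finite_UN_I finite_imageI fin) auto
    also have "\<dots> \<le> card (?B w (Suc d))" by (rule card_mono[OF fin sub])
    finally show ?thesis .
  qed simp
qed simp

text \<open>A caret replaces one leaf by \<open>n\<close>. For \<open>n \<ge> 2\<close> the number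
  of carets is therefore determined by the number of leaves and is preserved by relabelling and
  regrouping.\<close>

lemma length_leaf_labels:
  assumes "n > 0" shows "nary n t \<Longrightarrow> length (leaf_labels t) = Suc ((n - 1) * carets t)"
proof (induction t)
  case (Caret ts)
  have "length (leaf_labels (Caret ts)) = (\<Sum>t\<leftarrow>ts. length (leaf_labels t))"
    by (simp add: length_concat comp_def)
  also have "\<dots> = (\<Sum>t\<leftarrow>ts. Suc ((n - 1) * carets t))"
    using Caret by (intro arg_cong[where f = sum_list] map_cong) auto
  also have "\<dots> = length ts + (n - 1) * sum_list (map carets ts)"
    by (induction ts) (auto simp: algebra_simps)
  finally show ?case using Caret.prems assms by (cases n) (auto simp: algebra_simps)
qed simp

text \<open>This is why the trees of bad words of \<open>f\<close> and of its inverse form a tree pair for \<open>f\<close>.\<close>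

lemma minimal_good_word_image:
  assumes n: "n \<ge> 2" and f: "f \<in> carrier (thompson_T n)"
    and a: "a \<in> words n" "v \<in> words n" "maps_word n f a v"
    and min: "\<And>b c. a = b @ c \<Longrightarrow> c \<noteq> [] \<Longrightarrow> \<not> good_word n f b"
    and v: "v = b @ t"
    and g: "good_word n (restrict (inv_into circle f) circle) b"
  shows "t = []"
proof -
  have bij: "bij_betw f circle circle" by (rule thompson_T_bij[OF n f])
  let ?h = "restrict (inv_into circle f) circle"
  have "restrict (inv_into circle ?h) circle = f"
    using thompson_T_inv[OF n f] thompson_T_inv[OF n thompson_T_inv_into[OF n f]]
      group.inv_inv[OF group_thompson_T[OF n] f] by metis
  moreover have "bij_betw ?h circle circle" by (rule thompson_T_bij[OF n thompson_T_inv_into[OF n f]])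
  ultimately have inv: "maps_word n f c b" if "maps_word n ?h b c" for c
    using maps_word_inv that by metis
  obtain c where c: "c \<in> words n" "maps_word n ?h b c" using g by (auto simp: good_word_def)
  have t: "t \<in> words n" "b \<in> words n" using a v by auto
  have "maps_word n f (c @ t) v" using maps_word_append[OF inv[OF c(2)] t(1)] v by simp
  \<comment> \<open>Now \<open>c\<close> is a good initial segment of \<open>a\<close>, and
    minimality of \<open>a\<close> leaves no room for \<open>t\<close>.\<close>
  then have "a = c @ t"
    using maps_word_source_unique[OF n _ _ a(2) a(3)] a(1) c t bij by (auto simp: bij_betw_def)
  moreover have "good_word n f c" using inv[OF c(2)] t(2) by (auto simp: good_word_def)
  ultimately show ?thesis using min by blast
qed

lemma grow_tame:
  assumes n: "n \<ge> 2" and f: "f \<in> carrier (thompson_T n)"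
  obtains d where "\<And>g i a. (i, a) \<in> set (leaves (grow n d (good_word n f) g [])) \<Longrightarrow> good_word n f a"
    "\<And>g i a b c. (i, a) \<in> set (leaves (grow n d (good_word n f) g [])) \<Longrightarrow> a = b @ c \<Longrightarrow> c \<noteq> [] \<Longrightarrow>
      \<not> good_word n f b"
    "\<And>g. carets (grow n d (good_word n f) g []) \<le> card (bad_words n f)"
proof -
  obtain d where d: "\<And>w. w \<in> words n \<Longrightarrow> length w = d \<Longrightarrow> good_word n f w"
    using thompson_T_imp_tame(2)[OF n f] by (auto simp: tame_def)
  show ?thesis
  proof
    show "good_word n f a" if "(i, a) \<in> set (leaves (grow n d (good_word n f) g []))" for g i a
      using grow_leaf[of n d "good_word n f" "[]" i a g] d that by simp
    show "\<not> good_word n f b"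
      if "(i, a) \<in> set (leaves (grow n d (good_word n f) g []))" "a = b @ c" "c \<noteq> []" for g i a b c
      using grow_inner[OF that] by simp
    have "card {b \<in> words n. length b < d \<and> \<not> good_word n f ([] @ b)} \<le> card (bad_words n f)"
      using finite_bad_words[OF thompson_T_imp_tame(2)[OF n f]]
      by (intro card_mono) (auto simp: bad_words_def)
    then show "carets (grow n d (good_word n f) g []) \<le> card (bad_words n f)" for g
      using carets_grow[of n d "good_word n f" g "[]"] by linarith
  qed
qed

text \<open>Cut the list at \<open>c\<close>. The images increase on either part and those of the
  second part precede those of the first, so swapping the parts yields a sorted list with the same
  elements as \<open>bs\<close>.\<close>

lemma sorted_image_rotate:
  fixes lo :: "'a \<Rightarrow> real" and f :: "real \<Rightarrow> real"
  assumes as: "sorted_wrt (<) (map lo as)" and bs: "sorted_wrt (<) (map lo bs)"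
    and V: "V ` set as = set bs" "\<And>a. a \<in> set as \<Longrightarrow> lo (V a) = f (lo a)"
    and f: "\<And>x y. \<lbrakk>x \<in> lo ` set as; y \<in> lo ` set as; x < y; \<not> (x < c \<and> c \<le> y)\<rbrakk> \<Longrightarrow> f x < f y"
      "\<And>x y. \<lbrakk>x \<in> lo ` set as; y \<in> lo ` set as; x < c; c \<le> y\<rbrakk> \<Longrightarrow> f y < f x"
  shows "\<exists>k. map V as = rotate k bs"
proof -
  define us where "us = takeWhile (\<lambda>a. lo a < c) as"
  define vs where "vs = dropWhile (\<lambda>a. lo a < c) as"
  have asuv: "as = us @ vs" by (simp add: us_def vs_def)
  have us: "lo a < c" if "a \<in> set us" for a using that by (auto simp: us_def dest: set_takeWhileD)
  have vs: "c \<le> lo a" if "a \<in> set vs" for a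
  proof -
    have "sorted_wrt (<) (map lo vs)" using as by (simp add: asuv sorted_wrt_append)
    moreover have "vs \<noteq> []" using that by auto
    moreover from this have "\<not> lo (hd vs) < c" unfolding vs_def by (rule hd_dropWhile)
    ultimately show ?thesis using that by (cases vs) auto
  qed
  have "sorted_wrt (\<lambda>a b. lo a < lo b) us"
    using as by (simp add: asuv sorted_wrt_append sorted_wrt_map)
  then have "sorted_wrt (\<lambda>a b. (lo \<circ> V) a < (lo \<circ> V) b) us"
  proof (rule sorted_wrt_mono_rel[rotated])
    fix a b assume "a \<in> set us" "b \<in> set us" "lo a < lo b"
    then show "(lo \<circ> V) a < (lo \<circ> V) b"
      using V(2)[of a] V(2)[of b] f(1)[of "lo a" "lo b"] us[of b] by (simp add: asuv)
  qed
  then have su: "sorted_wrt (<) (map (lo \<circ> V) us)" by (simp only: sorted_wrt_map)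
  have "sorted_wrt (\<lambda>a b. lo a < lo b) vs"
    using as by (simp add: asuv sorted_wrt_append sorted_wrt_map)
  then have "sorted_wrt (\<lambda>a b. (lo \<circ> V) a < (lo \<circ> V) b) vs"
  proof (rule sorted_wrt_mono_rel[rotated])
    fix a b assume "a \<in> set vs" "b \<in> set vs" "lo a < lo b"
    then show "(lo \<circ> V) a < (lo \<circ> V) b"
      using V(2)[of a] V(2)[of b] f(1)[of "lo a" "lo b"] vs[of a] by (simp add: asuv)
  qed
  then have sv: "sorted_wrt (<) (map (lo \<circ> V) vs)" by (simp only: sorted_wrt_map)
  have "(lo \<circ> V) b < (lo \<circ> V) a" if "a \<in> set us" "b \<in> set vs" for a b
    using V(2)[of a] V(2)[of b] f(2)[of "lo a" "lo b"] us vs that by (simp add: asuv)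
  then have s: "sorted_wrt (<) (map lo (map V vs @ map V us))"
    using su sv by (auto simp: sorted_wrt_append sorted_wrt_map)
  have setb: "set (map V vs @ map V us) = set bs" using V(1) by (auto simp: asuv)
  then have e: "map lo (map V vs @ map V us) = map lo bs"
    by (intro strict_sorted_equal[OF s bs, symmetric]) (simp only: set_map)
  have "distinct (map lo bs)" using bs strict_sorted_iff by blast
  then have "inj_on lo (set bs)" by (simp add: distinct_map)
  then have "map V vs @ map V us = bs"
    using setb by (intro map_inj_on[OF e]) simp
  then have "rotate (length (map V vs)) bs = map V us @ map V vs" using rotate_append by metis
  then show ?thesis by (intro exI[of _ "length vs"]) (simp add: asuv)
qed

text \<open>The leaves of the target tree are numbered from left to right, and each source leaf
  takes the number of its image. Since \<open>f\<close> preserves the cyclic order of left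
  endpoints, the source labels form a rotation of the target labels.\<close>

lemma ex_tree_pair:
  assumes n: "n \<ge> 2" and f: "f \<in> carrier (thompson_T n)"
  shows "\<exists>S R. represents n (S, R) f \<and> carets S \<le> card (bad_words n f)"
proof -
  have n0: "n > 0" using n by simp
  have bij: "bij_betw f circle circle" by (rule thompson_T_bij[OF n f])
  let ?h = "restrict (inv_into circle f) circle"
  have h: "?h \<in> carrier (thompson_T n)" by (rule thompson_T_inv_into[OF n f])
  have hh: "restrict (inv_into circle ?h) circle = f"
    using thompson_T_inv[OF n f] thompson_T_inv[OF n h] group.inv_inv[OF group_thompson_T[OF n] f] by metis
  have bijh: "bij_betw ?h circle circle" by (rule thompson_T_bij[OF n h])
  obtain d where d: "\<And>g i a. (i, a) \<in> set (leaves (grow n d (good_word n f) g [])) \<Longrightarrow> good_word n f a"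
    "\<And>g i a b c. (i, a) \<in> set (leaves (grow n d (good_word n f) g [])) \<Longrightarrow> a = b @ c \<Longrightarrow> c \<noteq> [] \<Longrightarrow>
      \<not> good_word n f b"
    "\<And>g. carets (grow n d (good_word n f) g []) \<le> card (bad_words n f)"
    using grow_tame[OF n f] by metis
  obtain e where e: "\<And>g i a. (i, a) \<in> set (leaves (grow n e (good_word n ?h) g [])) \<Longrightarrow> good_word n ?h a"
    "\<And>g i a b c. (i, a) \<in> set (leaves (grow n e (good_word n ?h) g [])) \<Longrightarrow> a = b @ c \<Longrightarrow> c \<noteq> [] \<Longrightarrow>
      \<not> good_word n ?h b"
    "\<And>g. carets (grow n e (good_word n ?h) g []) \<le> card (bad_words n ?h)"
    using grow_tame[OF n h] by metis
  define as where "as = map snd (leaves (grow n d (good_word n f) (\<lambda>_. 0) []))"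
  define bs where "bs = map snd (leaves (grow n e (good_word n ?h) (\<lambda>_. 0) []))"
  have as: "cyc_partition n as" "sorted_wrt (<) (map (\<lambda>w. aff n w 0) as)"
    unfolding as_def using cyc_partition_leaves[OF nary_grow n0] sorted_wrt_chain_left[OF n0 chain_leaves[OF nary_grow n0]]
    by auto
  have bs: "cyc_partition n bs" "sorted_wrt (<) (map (\<lambda>w. aff n w 0) bs)"
    unfolding bs_def using cyc_partition_leaves[OF nary_grow n0] sorted_wrt_chain_left[OF n0 chain_leaves[OF nary_grow n0]]
    by auto
  have asw: "a \<in> words n" if "a \<in> set as" for a using as that by (auto simp: cyc_partition_def)
  have bsw: "a \<in> words n" if "a \<in> set bs" for a using bs that by (auto simp: cyc_partition_def)
  have agood: "good_word n f a" if "a \<in> set as" for a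
    using that d(1)[of _ a "\<lambda>_. 0"] by (auto simp: as_def)
  have amin: "\<not> good_word n f b" if "a \<in> set as" "a = b @ c" "c \<noteq> []" for a b c
    using that d(2)[of _ a "\<lambda>_. 0" b c] by (auto simp: as_def)
  have bgood: "good_word n ?h a" if "a \<in> set bs" for a
    using that e(1)[of _ a "\<lambda>_. 0"] by (auto simp: bs_def)
  have bmin: "\<not> good_word n ?h b" if "a \<in> set bs" "a = b @ c" "c \<noteq> []" for a b c
    using that e(2)[of _ a "\<lambda>_. 0" b c] by (auto simp: bs_def)
  \<comment> \<open>Stated for an arbitrary element and its inverse because it is applied in both
    directions. The word \<open>v\<close> meets some leaf \<open>b\<close> of the other tree, so one
    extends the other. Minimality on the source side excludes that \<open>v\<close> is longer,
    minimality on the target side that \<open>b\<close> is.\<close>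
  have image: "v \<in> set ys"
    if p: "f1 \<in> carrier (thompson_T n)" "h1 = restrict (inv_into circle f1) circle"
      and xs: "a \<in> set xs" "\<And>a. a \<in> set xs \<Longrightarrow> a \<in> words n" "\<And>a b c. a \<in> set xs \<Longrightarrow> a = b @ c \<Longrightarrow> c \<noteq> [] \<Longrightarrow> \<not> good_word n f1 b"
      and ys: "cyc_partition n ys" "\<And>b. b \<in> set ys \<Longrightarrow> good_word n h1 b"
        "\<And>a b c. a \<in> set ys \<Longrightarrow> a = b @ c \<Longrightarrow> c \<noteq> [] \<Longrightarrow> \<not> good_word n h1 b"
      and v: "v \<in> words n" "maps_word n f1 a v" for f1 h1 xs ys a v
  proof -
    have c0: "(0::real) \<in> circle" by (simp add: circle_def)
    have "aff n v 0 \<in> circle" by (rule aff_circle[OF v(1) c0])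
    then obtain b y where b: "b \<in> set ys" "y \<in> circle" "aff n v 0 = aff n b y"
      using ys(1) by (auto simp: cyc_partition_def)
    have bw: "b \<in> words n" using b ys(1) by (auto simp: cyc_partition_def)
    show ?thesis
    proof (cases "length b \<le> length v")
      case True
      then obtain t where t: "v = b @ t" using aff_eq_imp_prefix[OF b(3)[symmetric] b(2) c0 bw v(1)] by auto
      have "t = []"
      proof (rule minimal_good_word_image[OF n p(1) xs(2)[OF xs(1)] v _ t])
        show "good_word n (restrict (inv_into circle f1) circle) b" using ys(2)[OF b(1)] p(2) by simp
        show "\<not> good_word n f1 b'" if "a = b' @ c'" "c' \<noteq> []" for b' c'
          using xs(3)[OF xs(1) that] .
      qed
      then show ?thesis using t b by simp
    next
      case False
      then obtain t where t: "b = v @ t" using aff_eq_imp_prefix[OF b(3) c0 b(2) v(1) bw] by auto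
      have "maps_word n h1 v a" using maps_word_inv[OF thompson_T_bij[OF n p(1)] v(2)] p(2) by simp
      then have "good_word n h1 v" using xs by (auto simp: good_word_def)
      then have "t = []" using ys(3)[OF b(1) t] by blast
      then show ?thesis using t b by simp
    qed
  qed
  have "\<forall>a. \<exists>v. a \<in> set as \<longrightarrow> v \<in> words n \<and> maps_word n f a v" using agood by (auto simp: good_word_def)
  then obtain V where V: "\<And>a. a \<in> set as \<Longrightarrow> V a \<in> words n" "\<And>a. a \<in> set as \<Longrightarrow> maps_word n f a (V a)" by metis
  have Vbs: "V a \<in> set bs" if a: "a \<in> set as" for a
    using image[OF f refl a asw amin bs(1) bgood bmin V[OF a]] .
  have Vsurj: "V ` set as = set bs"
  proof
    show "V ` set as \<subseteq> set bs" using Vbs by auto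
    show "set bs \<subseteq> V ` set as"
    proof
      fix b assume b: "b \<in> set bs"
      then obtain a where a: "a \<in> words n" "maps_word n ?h b a" using bgood by (auto simp: good_word_def)
      have as': "a \<in> set as"
        using image[OF h hh[symmetric] b bsw bmin as(1) agood amin a] .
      have "maps_word n f a b" using maps_word_inv[OF bijh a(2)] hh by simp
      then have "V a = b" using maps_word_target_unique[OF n a(1) V(1)[OF as'] bsw[OF b] V(2)[OF as']] by simp
      then show "b \<in> V ` set as" using as' by auto
    qed
  qed
  obtain c where c: "c \<in> circle"
    "\<And>x y. \<lbrakk>x \<in> circle; y \<in> circle; x < y; \<not> (x < c \<and> c \<le> y)\<rbrakk> \<Longrightarrow> f x < f y"
    "\<And>x y. \<lbrakk>x \<in> circle; y \<in> circle; x < c; c \<le> y\<rbrakk> \<Longrightarrow> f y < f x"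
    using thompson_T_cyclic_mono[OF n f] by metis
  have c0: "(0::real) \<in> circle" by (simp add: circle_def)
  have lo: "(\<lambda>w. aff n w 0) ` set as \<subseteq> circle" using aff_circle[OF asw c0] by auto
  have "\<exists>k. map V as = rotate k bs"
  proof (rule sorted_image_rotate[OF as(2) bs(2) Vsurj, where c = c and f = f])
    show "aff n (V a) 0 = f (aff n a 0)" if "a \<in> set as" for a
      using maps_word_circle[OF V(2)[OF that] asw[OF that] V(1)[OF that] c0] by simp
    show "f x < f y" if "x \<in> (\<lambda>w. aff n w 0) ` set as" "y \<in> (\<lambda>w. aff n w 0) ` set as" "x < y"
      "\<not> (x < c \<and> c \<le> y)" for x y
      using lo that by (intro c(2)) blast+
    show "f y < f x" if "x \<in> (\<lambda>w. aff n w 0) ` set as" "y \<in> (\<lambda>w. aff n w 0) ` set as" "x < c" "c \<le> y" for x y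
      using lo that by (intro c(3)) blast+
  qed
  then obtain k where k: "map V as = rotate k bs" by blast
  have dist: "distinct bs" using bs by (simp add: cyc_partition_def)
  define g where "g b = (THE p. p < length bs \<and> bs ! p = b)" for b
  have g: "g (bs ! p) = p" if "p < length bs" for p
    unfolding g_def using that dist by (intro the_equality) (auto simp: nth_eq_iff_index_eq)
  have gbs: "map g bs = [0..<length bs]" by (rule nth_equalityI) (auto simp: g)
  have ginj: "inj_on g (set bs)" using gbs by (metis distinct_map distinct_upt)
  define S where "S = grow n d (good_word n f) (\<lambda>a. g (V a)) []"
  define R where "R = grow n e (good_word n ?h) g []"
  have S: "leaves S = map (\<lambda>a. (g (V a), a)) as"
    unfolding S_def as_def by (subst leaves_grow[of _ _ _ _ _ "\<lambda>_. 0"]) simp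
  have R: "leaves R = map (\<lambda>a. (g a, a)) bs"
    unfolding R_def bs_def by (subst leaves_grow[of _ _ _ _ _ "\<lambda>_. 0"]) simp
  have Rl: "leaf_labels R = [0..<length bs]" by (simp add: leaf_labels_eq R comp_def gbs)
  have "leaf_labels S = map g (map V as)" by (simp add: leaf_labels_eq S comp_def)
  then have Sl: "leaf_labels S = rotate k [0..<length bs]" by (simp add: k rotate_map[symmetric] gbs)
  have nary: "nary n S" "nary n R" by (simp_all add: S_def R_def nary_grow)
  have "cyclically_labelled S" unfolding cyclically_labelled_def Sl by (intro exI[of _ k]) simp
  moreover have "cyclically_labelled R" unfolding cyclically_labelled_def Rl by (intro exI[of _ 0]) simp
  ultimately have pair: "labelled_tree_pair n (S, R)"
    using nary by (simp add: labelled_tree_pair_def Sl Rl)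
  have "maps_leaves n f S R"
    unfolding maps_leaves_def
  proof (intro allI impI)
    fix i w v assume w: "(i, w) \<in> set (leaves S)" "(i, v) \<in> set (leaves R)"
    then have "w \<in> set as" "v \<in> set bs" "g (V w) = g v" by (auto simp: S R)
    then have "V w = v" using ginj Vbs by (metis inj_onD)
    then show "maps_word n f w v" using V(2)[OF \<open>w \<in> set as\<close>] by simp
  qed
  then have "represents n (S, R) f" using pair f by (simp add: represents_iff[OF n0])
  moreover have "carets S \<le> card (bad_words n f)" unfolding S_def by (rule d(3))
  ultimately show ?thesis by blast
qed

section \<open>Caret replacement is the conjugation\<close>

lemma code_Suc_0: "n > 0 \<Longrightarrow> code (Suc n) 0 = [0]"
  by (simp add: code_def)

lemma code_Suc_Suc: "n > 0 \<Longrightarrow> code (Suc n) (Suc j) = 1 # code n j"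
  by (cases n) (auto simp: code_def)

text \<open>The recursion of the all-right tree is that of the codes: the first tree has address 0,
  and each later one has the letter 1 in front of its address in the smaller all-right tree.\<close>

lemma leaves_all_right:
  "ts \<noteq> [] \<Longrightarrow> leaves (all_right ts) =
     concat (map (\<lambda>j. map (\<lambda>(i, w). (i, code (length ts) j @ w)) (leaves (ts ! j))) [0..<length ts])"
proof (induction ts rule: all_right.induct)
  case (2 t)
  then show ?case by (simp add: code_def)
next
  case (3 t u ts)
  let ?us = "u # ts"
  let ?m = "length ?us"
  have m: "?m > 0" by simp
  have upt0: "[0..<Suc (Suc (length ts))] = 0 # map Suc [0..<Suc (length ts)]"
    by (simp add: upt_conv_Cons map_Suc_upt del: upt_Suc)
  have "leaves (all_right (t # ?us)) =
    map (\<lambda>(i, w). (i, 0 # w)) (leaves t) @ map (\<lambda>(i, w). (i, 1 # w)) (leaves (all_right ?us))"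
    by (simp add: upt_rec)
  also have "map (\<lambda>(i, w). (i, 1 # w)) (leaves (all_right ?us)) =
    concat (map (\<lambda>j. map (\<lambda>(i, w). (i, code (Suc ?m) (Suc j) @ w)) (leaves (?us ! j))) [0..<?m])"
    by (subst 3) (simp_all only: code_Suc_Suc[OF m], simp_all add: map_concat comp_def case_prod_unfold)
  also have "map (\<lambda>(i, w). (i, 0 # w)) (leaves t) = map (\<lambda>(i, w). (i, code (Suc ?m) 0 @ w)) (leaves t)"
    by (simp only: code_Suc_0[OF m]) simp
  also have "\<dots> @ concat (map (\<lambda>j. map (\<lambda>(i, w). (i, code (Suc ?m) (Suc j) @ w)) (leaves (?us ! j))) [0..<?m]) =
    concat (map (\<lambda>j. map (\<lambda>(i, w). (i, code (length (t # ?us)) j @ w)) (leaves ((t # ?us) ! j))) [0..<length (t # ?us)])"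
    by (simp only: length_Cons upt0 list.map map_map comp_def nth_Cons_0 nth_Cons_Suc concat.simps)
  finally show ?case .
qed simp

lemma leaves_caret_replacement:
  assumes "n \<ge> 2"
  shows "nary n t \<Longrightarrow> leaves (caret_replacement t) = map (\<lambda>(i, w). (i, code_word n w)) (leaves t)"
proof (induction t)
  case (Caret ts)
  have len: "length ts = n" "ts \<noteq> []" using Caret assms by auto
  have e: "map (\<lambda>j. map (\<lambda>(i, w). (i, code n j @ w)) (leaves (map caret_replacement ts ! j))) [0..<n] =
      map (\<lambda>j. map (\<lambda>(i, w). (i, code n j @ w)) (leaves (caret_replacement (ts ! j)))) [0..<n]"
    using len by (intro map_cong refl) simp
  have "map caret_replacement ts \<noteq> []" by (simp add: len)
  from leaves_all_right[OF this] have "leaves (caret_replacement (Caret ts)) =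
    concat (map (\<lambda>j. map (\<lambda>(i, w). (i, code n j @ w)) (leaves (caret_replacement (ts ! j)))) [0..<n])"
    unfolding caret_replacement.simps length_map len(1) e .
  also have "\<dots> = concat (map (\<lambda>j. map (\<lambda>(i, w). (i, code n j @ code_word n w)) (leaves (ts ! j))) [0..<n])"
  proof (rule arg_cong[where f = concat], rule map_cong[OF refl])
    fix j assume "j \<in> set [0..<n]"
    then have "ts ! j \<in> set ts" using len by simp
    then have "leaves (caret_replacement (ts ! j)) = map (\<lambda>(i, w). (i, code_word n w)) (leaves (ts ! j))"
      using Caret by auto
    then show "map (\<lambda>(i, w). (i, code n j @ w)) (leaves (caret_replacement (ts ! j)))
      = map (\<lambda>(i, w). (i, code n j @ code_word n w)) (leaves (ts ! j))"
      by (simp add: comp_def case_prod_beta)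
  qed
  also have "\<dots> = map (\<lambda>(i, w). (i, code_word n w)) (leaves (Caret ts))"
    by (simp add: len map_concat comp_def case_prod_unfold)
  finally show ?case .
qed simp

lemma nary_all_right: "ts \<noteq> [] \<Longrightarrow> \<forall>t\<in>set ts. nary 2 t \<Longrightarrow> nary 2 (all_right ts)"
  by (induction ts rule: all_right.induct) auto

lemma nary_caret_replacement:
  assumes "n \<ge> 2" shows "nary n t \<Longrightarrow> nary 2 (caret_replacement t)"
proof (induction t)
  case (Caret ts)
  have "ts \<noteq> []" using Caret.prems assms by auto
  then show ?case using Caret by (auto intro!: nary_all_right)
qed simp

lemma leaf_labels_caret_replacement:
  "n \<ge> 2 \<Longrightarrow> nary n t \<Longrightarrow> leaf_labels (caret_replacement t) = leaf_labels t"
  by (simp add: leaf_labels_eq leaves_caret_replacement comp_def case_prod_beta)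

lemma represents_caret_replacement:
  assumes n: "n \<ge> 2" and r: "represents n (S, R) f"
  shows "represents 2 (caret_replacement S, caret_replacement R) (conj_map n f)"
proof -
  have n0: "n > 0" using n by simp
  have SR: "labelled_tree_pair n (S, R)" "f \<in> carrier (thompson_T n)" "maps_leaves n f S R"
    using r by (auto simp: represents_iff[OF n0])
  then have nary: "nary n S" "nary n R" by (auto simp: labelled_tree_pair_def)
  have "labelled_tree_pair 2 (caret_replacement S, caret_replacement R)"
    using SR(1) by (auto simp: labelled_tree_pair_def cyclically_labelled_def
      leaf_labels_caret_replacement[OF n] nary_caret_replacement[OF n])
  moreover have "maps_leaves 2 (conj_map n f) (caret_replacement S) (caret_replacement R)"
    using SR(3) leaves_words[OF nary(1)] leaves_words[OF nary(2)]
    by (fastforce simp: maps_leaves_def leaves_caret_replacement[OF n] nary intro!: conj_map_maps_word[OF n])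
  ultimately show ?thesis using conj_map_closed[OF n SR(2)] by (simp add: represents_iff)
qed

text \<open>Existence of a tree pair makes the description satisfiable by the conjugate. For
  uniqueness, the replacement of any pair of \<open>f\<close> represents the conjugate as well, and
  a tree pair determines its element.\<close>

lemma phi_star_eq:
  assumes n: "n \<ge> 2" and f: "f \<in> carrier (thompson_T n)"
  shows "phi_star n f = conj_map n f"
  unfolding phi_star_def
proof (rule the_equality)
  obtain S R where "represents n (S, R) f" using ex_tree_pair[OF n f] by blast
  then show "\<exists>S R. represents n (S, R) f \<and> represents 2 (caret_replacement S, caret_replacement R) (conj_map n f)"
    using represents_caret_replacement[OF n] by blast
next
  fix g assume "\<exists>S R. represents n (S, R) f \<and> represents 2 (caret_replacement S, caret_replacement R) g"
  then obtain S R where SR: "represents n (S, R) f" "represents 2 (caret_replacement S, caret_replacement R) g" by blast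
  note c = represents_caret_replacement[OF n SR(1)]
  let ?S = "caret_replacement S" and ?R = "caret_replacement R"
  have p: "labelled_tree_pair 2 (?S, ?R)" using SR(2) by (simp add: represents_iff)
  then have "length (leaf_labels ?S) = length (leaf_labels ?R)" by (simp add: labelled_tree_pair_def)
  moreover have "set (leaf_labels t) = {0..<length (leaf_labels t)}" if "cyclically_labelled t" for t
    using that unfolding cyclically_labelled_def by (metis set_rotate set_upt)
  ultimately have "set (leaf_labels ?S) \<subseteq> set (leaf_labels ?R)" using p by (simp add: labelled_tree_pair_def)
  then show "g = conj_map n f"
    using SR(2) c p by (intro maps_leaves_unique[of 2 ?S ?R]) (auto simp: represents_iff labelled_tree_pair_def)
qed

section \<open>Substitution into trees\<close>

fun subst :: "(nat \<Rightarrow> ltree) \<Rightarrow> ltree \<Rightarrow> ltree" where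
  "subst \<sigma> (Leaf i) = \<sigma> i"
| "subst \<sigma> (Caret ts) = Caret (map (subst \<sigma>) ts)"

lemma leaf_labels_subst: "leaf_labels (subst \<sigma> u) = concat (map (\<lambda>i. leaf_labels (\<sigma> i)) (leaf_labels u))"
proof (induction u)
  case (Caret ts)
  have "map (\<lambda>t. leaf_labels (subst \<sigma> t)) ts =
      map (\<lambda>t. concat (map (\<lambda>i. leaf_labels (\<sigma> i)) (leaf_labels t))) ts"
    using Caret by (intro map_cong) auto
  then have "concat (map (\<lambda>t. leaf_labels (subst \<sigma> t)) ts) =
      concat (map (\<lambda>t. concat (map (\<lambda>i. leaf_labels (\<sigma> i)) (leaf_labels t))) ts)"
    by (rule arg_cong)
  also have "\<dots> = concat (map (\<lambda>i. leaf_labels (\<sigma> i)) (concat (map leaf_labels ts)))"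
    by (induction ts) auto
  finally show ?case by (simp add: comp_def)
qed simp

lemma leaves_subst:
  "(j, x) \<in> set (leaves (subst \<sigma> u)) \<Longrightarrow>
    \<exists>i w v. (i, w) \<in> set (leaves u) \<and> (j, v) \<in> set (leaves (\<sigma> i)) \<and> x = w @ v"
proof (induction u arbitrary: x)
  case (Caret ts)
  then obtain a y where a: "a < length ts" "x = a # y" "(j, y) \<in> set (leaves (subst \<sigma> (ts ! a)))" by auto
  have "ts ! a \<in> set ts" using a by simp
  from Caret.IH[OF this a(3)] obtain i w v where
    w: "(i, w) \<in> set (leaves (ts ! a))" "(j, v) \<in> set (leaves (\<sigma> i))" "y = w @ v" by blast
  have "(i, a # w) \<in> set (leaves (Caret ts))" using w(1) a(1) by force
  then show ?case using w a by (intro exI[of _ i] exI[of _ "a # w"] exI[of _ v]) simp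
qed auto

lemma distinct_concat_overlap:
  "\<lbrakk>distinct (concat (map F is)); i \<in> set is; j \<in> set is; x \<in> set (F i); x \<in> set (F j)\<rbrakk> \<Longrightarrow> i = j"
  by (induction "is") (auto simp: disjoint_iff)

lemma distinct_concat_mem: "distinct (concat xss) \<Longrightarrow> xs \<in> set xss \<Longrightarrow> distinct xs"
  by (induction xss) auto

lemma leaves_label_unique:
  "\<lbrakk>distinct (leaf_labels t); (i, w) \<in> set (leaves t); (i, v) \<in> set (leaves t)\<rbrakk> \<Longrightarrow> w = v"
  using eq_key_imp_eq_value[of "leaves t" i w v] by (simp add: leaf_labels_eq)

text \<open>An affine map on the interval of a leaf remains affine on everything hung below it, so
  the element that realizes a move on small trees realizes it for all substituted trees. Distinct
  labels guarantee that a label of the large trees belongs to the same substituted tree on both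
  sides.\<close>

lemma maps_leaves_subst:
  assumes f: "maps_leaves n f u u'" and l: "set (leaf_labels u') \<subseteq> set (leaf_labels u)"
    and d: "distinct (leaf_labels (subst \<sigma> u))"
    and \<sigma>: "\<And>i. i \<in> set (leaf_labels u) \<Longrightarrow> nary n (\<sigma> i)"
  shows "maps_leaves n f (subst \<sigma> u) (subst \<sigma> u')"
  unfolding maps_leaves_def
proof (intro allI impI)
  fix j x x' assume x: "(j, x) \<in> set (leaves (subst \<sigma> u))" "(j, x') \<in> set (leaves (subst \<sigma> u'))"
  obtain i w v where w: "(i, w) \<in> set (leaves u)" "(j, v) \<in> set (leaves (\<sigma> i))" "x = w @ v"
    using leaves_subst[OF x(1)] by blast
  obtain i' w' v' where w': "(i', w') \<in> set (leaves u')" "(j, v') \<in> set (leaves (\<sigma> i'))" "x' = w' @ v'"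
    using leaves_subst[OF x(2)] by blast
  have i: "i \<in> set (leaf_labels u)" "i' \<in> set (leaf_labels u)"
    using w(1) w'(1) l in_set_leaf_labels by blast+
  have j: "j \<in> set (leaf_labels (\<sigma> i))" "j \<in> set (leaf_labels (\<sigma> i'))"
    using w(2) w'(2) in_set_leaf_labels by blast+
  have ii: "i = i'" using distinct_concat_overlap[OF d[unfolded leaf_labels_subst] i j] .
  have "distinct (leaf_labels (\<sigma> i))"
    using distinct_concat_mem[OF d[unfolded leaf_labels_subst]] i by simp
  then have "v = v'" using leaves_label_unique w(2) w'(2) ii by blast
  moreover have "maps_word n f w w'" using f w(1) w'(1) ii unfolding maps_leaves_def by blast
  moreover have "v \<in> words n" by (rule leaves_words[OF \<sigma>[OF i(1)] w(2)])
  ultimately show "maps_word n f x x'" using maps_word_append w w' by simp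
qed

section \<open>Moves between trees\<close>

text \<open>The cost is the word length of one element carrying the leaves of one tree to the
  equally labelled leaves of the other. Costs of successive moves add up by composition.\<close>

definition reach :: "nat \<Rightarrow> (real \<Rightarrow> real) set \<Rightarrow> nat \<Rightarrow> ltree \<Rightarrow> ltree \<Rightarrow> bool" where
  "reach n A m t t' \<longleftrightarrow>
     (\<exists>f\<in>carrier (thompson_T n). word_length (thompson_T n) A f \<le> m \<and> maps_leaves n f t t')"

lemma reach_refl:
  assumes "n \<ge> 2" "distinct (leaf_labels t)"
  shows "reach n A m t t"
  unfolding reach_def
proof (intro bexI conjI)
  interpret group "thompson_T n" by (rule group_thompson_T[OF assms(1)])
  show "\<one>\<^bsub>thompson_T n\<^esub> \<in> carrier (thompson_T n)" by (rule one_closed)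
  show "word_length (thompson_T n) A \<one>\<^bsub>thompson_T n\<^esub> \<le> m" by (simp add: word_length_one)
  show "maps_leaves n \<one>\<^bsub>thompson_T n\<^esub> t t"
    using leaves_label_unique[OF assms(2)]
    by (auto simp: maps_leaves_def thompson_T_one maps_word_def frac_in_circle)
qed

lemma reach_trans:
  assumes n: "n \<ge> 2" and A: "finite_generating_set (thompson_T n) A"
    and r: "reach n A k t t'" "reach n A m t' t''" and l: "set (leaf_labels t) \<subseteq> set (leaf_labels t')"
  shows "reach n A (k + m) t t''"
proof -
  obtain f g where f: "f \<in> carrier (thompson_T n)" "word_length (thompson_T n) A f \<le> k" "maps_leaves n f t t'"
    and g: "g \<in> carrier (thompson_T n)" "word_length (thompson_T n) A g \<le> m" "maps_leaves n g t' t''"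
    using r by (auto simp: reach_def)
  have "word_length (thompson_T n) A (g \<otimes>\<^bsub>thompson_T n\<^esub> f) \<le> k + m"
    using group.word_length_mult_le[OF group_thompson_T[OF n] A g(1) f(1)] f(2) g(2) by linarith
  then show ?thesis
    using maps_leaves_compose[OF f(3) g(3) l] thompson_T_compose[OF n g(1) f(1)] thompson_T_mult[OF n g(1) f(1)]
    by (auto simp: reach_def)
qed

lemma reach_mono: "reach n A k t t' \<Longrightarrow> k \<le> m \<Longrightarrow> reach n A m t t'"
  by (force simp: reach_def)

definition small_trees :: "nat \<Rightarrow> nat \<Rightarrow> nat \<Rightarrow> ltree set" where
  "small_trees n c N = {t. nary n t \<and> carets t \<le> c \<and> set (leaf_labels t) \<subseteq> {..<N}}"

lemma finite_small_trees: "finite (small_trees n c N)"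
proof (induction c)
  case 0
  have "small_trees n 0 N \<subseteq> Leaf ` {..<N}"
  proof
    fix t assume "t \<in> small_trees n 0 N"
    then show "t \<in> Leaf ` {..<N}" by (cases t) (auto simp: small_trees_def)
  qed
  then show ?case using finite_subset by blast
next
  case (Suc c)
  have "small_trees n (Suc c) N \<subseteq> Leaf ` {..<N} \<union> Caret ` {ts. set ts \<subseteq> small_trees n c N \<and> length ts = n}"
  proof
    fix t assume t: "t \<in> small_trees n (Suc c) N"
    show "t \<in> Leaf ` {..<N} \<union> Caret ` {ts. set ts \<subseteq> small_trees n c N \<and> length ts = n}"
    proof (cases t)
      case (Caret ts)
      have "carets x \<le> c" if "x \<in> set ts" for x
      proof -
        have "carets x \<le> sum_list (map carets ts)" using that by (intro member_le_sum_list) auto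
        then show ?thesis using t Caret by (simp add: small_trees_def)
      qed
      then have "set ts \<subseteq> small_trees n c N" "length ts = n"
        using t Caret by (auto simp: small_trees_def)
      then show ?thesis using Caret by blast
    qed (use t in \<open>auto simp: small_trees_def\<close>)
  qed
  moreover have "finite (Leaf ` {..<N} \<union> Caret ` {ts. set ts \<subseteq> small_trees n c N \<and> length ts = n})"
    using finite_lists_length_eq[OF Suc] by simp
  ultimately show ?case using finite_subset by blast
qed

text \<open>An operation that hangs \<open>k\<close> trees, in order, onto a fixed tree with at most three carets.\<close>

definition template :: "nat \<Rightarrow> nat \<Rightarrow> (ltree list \<Rightarrow> ltree) \<Rightarrow> bool" where
  "template n k F \<longleftrightarrow> (\<forall>us. length us = k \<longrightarrow>
     (\<forall>\<sigma>. F (map (subst \<sigma>) us) = subst \<sigma> (F us)) \<and>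
     leaf_labels (F us) = concat (map leaf_labels us) \<and>
     ((\<forall>u\<in>set us. nary n u) \<longrightarrow> nary n (F us)) \<and>
     carets (F us) \<le> 3 + sum_list (map carets us))"

lemma templateD:
  assumes "template n k F" "length us = k"
  shows "F (map (subst \<sigma>) us) = subst \<sigma> (F us)" "leaf_labels (F us) = concat (map leaf_labels us)"
    "\<forall>u\<in>set us. nary n u \<Longrightarrow> nary n (F us)" "carets (F us) \<le> 3 + sum_list (map carets us)"
  using assms unfolding template_def by blast+

lemma concat_rotate: "\<exists>k. concat (rotate r xss) = rotate k (concat xss)"
proof -
  let ?r = "r mod length xss"
  have "concat (rotate r xss) = concat (drop ?r xss) @ concat (take ?r xss)"
    by (simp add: rotate_drop_take)
  also have "\<dots> = rotate (length (concat (take ?r xss))) (concat (take ?r xss) @ concat (drop ?r xss))"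
    by (simp only: rotate_append)
  also have "concat (take ?r xss) @ concat (drop ?r xss) = concat xss"
    by (metis append_take_drop_id concat_append)
  finally show ?thesis by blast
qed

text \<open>Up to substitution there are only finitely many moves between templates.\<close>

lemma template_move:
  assumes n: "n \<ge> 2"
  shows "\<exists>C>0. \<forall>k F F' r xs. k \<le> 3 * n \<longrightarrow> template n k F \<longrightarrow> template n k F' \<longrightarrow> length xs = k \<longrightarrow>
    (\<forall>x\<in>set xs. nary n x) \<longrightarrow> distinct (leaf_labels (F xs)) \<longrightarrow> reach n A C (F xs) (F' (rotate r xs))"
proof -
  \<comment> \<open>A template adds at most three carets to at most \<open>3 * n\<close> hanging
    trees; applied to single leaves it produces a tree of this finite set.\<close>
  let ?U = "small_trees n 3 (3 * n)"
  define M where "M = {(u, u'). u \<in> ?U \<and> u' \<in> ?U \<and> distinct (leaf_labels u) \<and>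
    (\<exists>k. leaf_labels u' = rotate k (leaf_labels u))}"
  have "M \<subseteq> ?U \<times> ?U" by (auto simp: M_def)
  then have fin: "finite M" using finite_small_trees finite_subset by blast
  have "\<exists>f. f \<in> carrier (thompson_T n) \<and> maps_leaves n f (fst p) (snd p)" if p: "p \<in> M" for p
  proof -
    obtain k where k: "leaf_labels (snd p) = rotate k (leaf_labels (fst p))" using p by (auto simp: M_def)
    have "nary n (fst p)" "nary n (snd p)" "distinct (leaf_labels (fst p))"
      using p by (auto simp: M_def small_trees_def)
    then show ?thesis using ex_maps_leaves[OF n _ _ k] by blast
  qed
  then obtain e where e: "\<And>p. p \<in> M \<Longrightarrow> e p \<in> carrier (thompson_T n)"
    "\<And>p. p \<in> M \<Longrightarrow> maps_leaves n (e p) (fst p) (snd p)" by metis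
  define C where "C = Suc (\<Sum>p\<in>M. word_length (thompson_T n) A (e p))"
  have C: "word_length (thompson_T n) A (e p) \<le> C" if "p \<in> M" for p
  proof -
    have "word_length (thompson_T n) A (e p) \<le> (\<Sum>p\<in>M. word_length (thompson_T n) A (e p))"
      using fin that by (intro member_le_sum) auto
    then show ?thesis by (simp add: C_def)
  qed
  have "reach n A C (F xs) (F' (rotate r xs))"
    if k: "k \<le> 3 * n" and F: "template n k F" "template n k F'" and xs: "length xs = k" "\<forall>x\<in>set xs. nary n x"
      and d: "distinct (leaf_labels (F xs))" for k F F' r xs
  proof -
    \<comment> \<open>Numbered leaves as placeholders: the given trees are substituted for them, and
      both sides of the move arise from trees of the finite set by the same substitution.\<close>
    define us where "us = map Leaf [0..<k]"
    define u where "u = F us"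
    define u' where "u' = F' (rotate r us)"
    define \<sigma> where "\<sigma> i = xs ! i" for i
    have us: "length us = k" "length (rotate r us) = k" by (simp_all add: us_def)
    have xs': "xs = map (subst \<sigma>) us"
      by (rule nth_equalityI) (simp_all add: us_def xs \<sigma>_def)
    have t: "F xs = subst \<sigma> u" "F' (rotate r xs) = subst \<sigma> u'"
      unfolding xs' u_def u'_def rotate_map by (rule templateD(1)[OF F(1) us(1)], rule templateD(1)[OF F(2) us(2)])
    have cus: "concat (map leaf_labels us) = [0..<k]" by (simp add: us_def comp_def)
    have lu: "leaf_labels u = [0..<k]" using templateD(2)[OF F(1) us(1)] cus by (simp add: u_def)
    obtain j where "concat (rotate r (map leaf_labels us)) = rotate j (concat (map leaf_labels us))"
      using concat_rotate by blast
    then have lu': "leaf_labels u' = rotate j (leaf_labels u)"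
      using templateD(2)[OF F(2) us(2)] cus lu by (simp add: u'_def rotate_map)
    have z: "sum_list (map carets us) = 0" "sum_list (map carets (rotate r us)) = 0"
      by (auto simp: us_def)
    have "carets u \<le> 3" "carets u' \<le> 3"
      using templateD(4)[OF F(1) us(1)] templateD(4)[OF F(2) us(2)] by (simp_all only: z u_def u'_def)
    moreover have "nary n u" "nary n u'"
      unfolding u_def u'_def by (rule templateD(3)[OF F(1) us(1)], simp add: us_def)
        (rule templateD(3)[OF F(2) us(2)], simp add: us_def)
    moreover have "set (leaf_labels u) \<subseteq> {..<3 * n}" "set (leaf_labels u') \<subseteq> {..<3 * n}"
      unfolding lu' using k by (auto simp: lu)
    ultimately have "u \<in> ?U" "u' \<in> ?U" by (simp_all add: small_trees_def)
    then have M: "(u, u') \<in> M" using lu lu' by (auto simp: M_def)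
    have "maps_leaves n (e (u, u')) (subst \<sigma> u) (subst \<sigma> u')"
    proof (rule maps_leaves_subst)
      show "maps_leaves n (e (u, u')) u u'" using e(2)[OF M] by simp
      show "set (leaf_labels u') \<subseteq> set (leaf_labels u)" unfolding lu' by simp
      show "distinct (leaf_labels (subst \<sigma> u))" using d unfolding t .
      show "nary n (\<sigma> i)" if "i \<in> set (leaf_labels u)" for i using that xs by (simp add: lu \<sigma>_def)
    qed
    then show ?thesis using e(1)[OF M] C[OF M] unfolding t reach_def by blast
  qed
  then show ?thesis by (intro exI[of _ C]) (auto simp: C_def)
qed

definition two_carets :: "nat \<Rightarrow> nat \<Rightarrow> ltree list \<Rightarrow> ltree" where
  "two_carets n i xs = Caret (take i xs @ Caret (take n (drop i xs)) # drop (i + n) xs)"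

text \<open>Moves act at the root, so rearranging the last child of the root together with a caret
  below it has to include the root caret; this is where the bound of three carets comes
  from.\<close>

definition three_carets :: "nat \<Rightarrow> nat \<Rightarrow> ltree list \<Rightarrow> ltree" where
  "three_carets n i xs = Caret (take (n - 1) xs @ [two_carets n i (drop (n - 1) xs)])"

lemma take_take_drop: "take i xs @ take n (drop i xs) @ drop (i + n) xs = xs"
  by (metis add.commute append_take_drop_id drop_drop)

lemma map_take_take_drop:
  "map f (take i xs) @ map f (take n (drop i xs)) @ map f (drop (i + n) xs) = map f xs"
  by (simp only: map_append[symmetric] take_take_drop)

lemma template_Caret: "template n n Caret"
  by (simp add: template_def comp_def)

lemma leaf_labels_two_carets: "leaf_labels (two_carets n i xs) = concat (map leaf_labels xs)"
  unfolding map_take_take_drop[of leaf_labels i xs n, symmetric] by (simp add: two_carets_def)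

lemma subst_two_carets: "two_carets n i (map (subst \<sigma>) xs) = subst \<sigma> (two_carets n i xs)"
  by (simp add: two_carets_def take_map drop_map)

lemma nary_two_carets:
  "\<lbrakk>n \<ge> 2; i \<le> n - 1; length xs = 2 * n - 1; \<forall>x\<in>set xs. nary n x\<rbrakk> \<Longrightarrow> nary n (two_carets n i xs)"
  by (auto simp: two_carets_def dest: in_set_takeD in_set_dropD)

lemma carets_two_carets: "carets (two_carets n i xs) = 2 + sum_list (map carets xs)"
  unfolding map_take_take_drop[of carets i xs n, symmetric] by (simp add: two_carets_def)

lemma template_two_carets: "n \<ge> 2 \<Longrightarrow> i \<le> n - 1 \<Longrightarrow> template n (2 * n - 1) (two_carets n i)"
  by (simp add: template_def leaf_labels_two_carets subst_two_carets nary_two_carets carets_two_carets)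

lemma template_three_carets:
  assumes "n \<ge> 2" "i \<le> n - 1" shows "template n (3 * n - 2) (three_carets n i)"
  unfolding template_def
proof (intro allI impI conjI)
  fix us :: "ltree list" and \<sigma> assume us: "length us = 3 * n - 2"
  show "three_carets n i (map (subst \<sigma>) us) = subst \<sigma> (three_carets n i us)"
    by (simp add: three_carets_def take_map drop_map subst_two_carets)
  have m: "map f (take (n - 1) us) @ map f (drop (n - 1) us) = map f us" for f :: "ltree \<Rightarrow> 'a"
    by (simp only: map_append[symmetric] append_take_drop_id)
  show "leaf_labels (three_carets n i us) = concat (map leaf_labels us)"
    unfolding m[of leaf_labels, symmetric] by (simp add: three_carets_def leaf_labels_two_carets)
  show "carets (three_carets n i us) \<le> 3 + sum_list (map carets us)"
    unfolding m[of carets, symmetric] by (simp add: three_carets_def carets_two_carets)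
  assume na: "\<forall>u\<in>set us. nary n u"
  have "nary n (two_carets n i (drop (n - 1) us))"
    using assms us na by (intro nary_two_carets) (auto dest: in_set_dropD)
  then show "nary n (three_carets n i us)"
    using assms us na by (auto simp: three_carets_def dest: in_set_takeD)
qed

section \<open>Reduction to left combs\<close>

text \<open>The normal form in which the two halves of a tree pair meet: every further caret hangs
  on the first child, so the shape is fixed by the number of leaves.\<close>

inductive left_comb :: "ltree \<Rightarrow> bool" where
  "left_comb (Leaf i)"
| "left_comb t \<Longrightarrow> left_comb (Caret (t # map Leaf is))"

lemma left_comb_cases:
  assumes "left_comb t"
  obtains i where "t = Leaf i" | s "is" where "t = Caret (s # map Leaf is)" "left_comb s"
  using assms by cases auto

text \<open>Equal numbers of labels mean equal numbers of carets, so both trees are single leaves or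
  both have a top caret; the \<open>n - 1\<close> trailing labels of that caret can then be split
  off.\<close>

lemma left_comb_unique:
  assumes n: "n \<ge> 2"
  shows "left_comb t \<Longrightarrow> left_comb t' \<Longrightarrow> nary n t \<Longrightarrow> nary n t' \<Longrightarrow> leaf_labels t = leaf_labels t' \<Longrightarrow> t = t'"
proof (induction arbitrary: t' rule: left_comb.induct)
  case (1 i)
  have "(n - 1) * carets t' = 0" using length_leaf_labels[of n t'] 1 n by (simp flip: 1(4))
  then have "carets t' = 0" using n by simp
  then show ?case using 1 by (cases t') auto
next
  case (2 t ks)
  have n0: "n > 0" using n by simp
  have "length (leaf_labels t') = length (leaf_labels (Caret (t # map Leaf ks)))" by (simp only: 2(6))
  then have "(n - 1) * carets t' = (n - 1) * carets (Caret (t # map Leaf ks))"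
    unfolding length_leaf_labels[OF n0 2(4)] length_leaf_labels[OF n0 2(5)] by (rule Suc_inject)
  then have "carets t' = carets (Caret (t # map Leaf ks))"
    by (subst (asm) mult_cancel1) (use n in auto)
  then have "carets t' > 0" by simp
  note pos = this
  from 2(3) show ?case
  proof (rule left_comb_cases)
    fix i assume "t' = Leaf i"
    then show ?thesis using pos by simp
  next
    fix s js assume s: "t' = Caret (s # map Leaf js)" "left_comb s"
    have len: "length js = length ks" using 2(4,5) s(1) by simp
    have "leaf_labels t @ ks = leaf_labels s @ js" using 2(6) s(1) by (simp add: comp_def)
    then have "leaf_labels t = leaf_labels s" "ks = js" using len by (auto simp: append_eq_append_conv)
    then show ?thesis using 2(2)[OF s(2)] 2(4,5) s(1) by simp
  qed
qed

section \<open>Termination measure and regrouping moves\<close>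

function right_depth :: "ltree \<Rightarrow> nat" where
  "right_depth (Leaf i) = 0"
| "right_depth (Caret ts) = (if ts = [] then 0 else Suc (right_depth (last ts)))"
  by pat_completeness auto
termination
proof (relation "Wellfounded.measure size")
  fix ts :: "ltree list"
  assume "ts \<noteq> []"
  then show "(last ts, Caret ts) \<in> Wellfounded.measure size"
    using size_list_estimation'[of "last ts" ts "size (last ts)" size] by simp
qed simp

lemma right_depth_le: "right_depth t \<le> carets t"
proof (induction t)
  case (Caret ts)
  show ?case
  proof (cases "ts = []")
    case False
    then have "right_depth (last ts) \<le> carets (last ts)" using Caret by simp
    also have "\<dots> \<le> sum_list (map carets ts)" using False by (intro member_le_sum_list) auto
    finally show ?thesis using False by simp
  qed simp
qed simp

text \<open>Decreased by unfolding a caret onto the right spine and by absorbing the top caret of the right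
  spine into the left comb.\<close>

definition unfold_measure :: "ltree list \<Rightarrow> nat" where
  "unfold_measure ts = 2 * sum_list (map carets ts) - right_depth (last ts)"

lemma two_carets_first:
  "length xs = n \<Longrightarrow> two_carets n 0 (xs @ ys) = Caret (Caret xs # ys)"
  by (simp add: two_carets_def)

lemma two_carets_last:
  "length xs + length ys = 2 * n - 1 \<Longrightarrow> length xs = n - 1 \<Longrightarrow>
    two_carets n (n - 1) (xs @ ys) = Caret (xs @ [Caret ys])"
  by (simp add: two_carets_def)

lemma two_carets_middle:
  "length xs = i \<Longrightarrow> length ys = n \<Longrightarrow> two_carets n i (xs @ ys @ zs) = Caret (xs @ Caret ys # zs)"
  by (simp add: two_carets_def)

text \<open>Fixes a cost \<open>C\<close> that serves all moves at once, so that the reductions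
  below only have to count moves.\<close>

locale moves =
  fixes n :: nat and A :: "(real \<Rightarrow> real) set" and C :: nat
  assumes n: "n \<ge> 2" and A: "finite_generating_set (thompson_T n) A"
    and move: "\<And>k F F' r xs. \<lbrakk>k \<le> 3 * n; template n k F; template n k F'; length xs = k;
      \<forall>x\<in>set xs. nary n x; distinct (leaf_labels (F xs))\<rbrakk> \<Longrightarrow> reach n A C (F xs) (F' (rotate r xs))"
begin

text \<open>Rotating and regrouping brings a given leaf one level closer to the root.\<close>

lemma raise_leaf:
  "\<lbrakk>nary n (Caret ts); distinct (leaf_labels (Caret ts)); i < n; m \<in> set (leaf_labels (ts ! i))\<rbrakk> \<Longrightarrow>
    \<exists>k ts'. reach n A (C * Suc (carets (ts ! i))) (Caret ts) (Caret (Leaf m # ts')) \<and>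
      nary n (Caret (Leaf m # ts')) \<and> leaf_labels (Caret (Leaf m # ts')) = rotate k (leaf_labels (Caret ts))"
proof (induction "carets (ts ! i)" arbitrary: ts i rule: less_induct)
  case less
  have len: "length ts = n" "\<forall>t\<in>set ts. nary n t" using less.prems(1) by auto
  show ?case
  proof (cases "ts ! i")
    case (Leaf j)
    then have j: "ts ! i = Leaf m" using less.prems by simp
    have "rotate i ts = ts ! i # drop (Suc i) ts @ take i ts"
      using less.prems(3) len by (simp add: rotate_drop_take Cons_nth_drop_Suc[symmetric])
    then obtain ts' where ts': "rotate i ts = Leaf m # ts'" using j by simp
    have "reach n A C (Caret ts) (Caret (rotate i ts))"
      using move[OF _ template_Caret template_Caret] len less.prems by simp
    moreover obtain k where "concat (rotate i (map leaf_labels ts)) = rotate k (concat (map leaf_labels ts))"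
      using concat_rotate by blast
    then have "leaf_labels (Caret (rotate i ts)) = rotate k (leaf_labels (Caret ts))" by (simp add: rotate_map)
    moreover have "nary n (Caret (rotate i ts))" using len by simp
    ultimately show ?thesis unfolding ts' using j by (intro exI[of _ k] exI[of _ ts']) auto
  next
    case (Caret ss)
    have ss: "length ss = n" "\<forall>t\<in>set ss. nary n t"
      using Caret len less.prems(3) nth_mem[of i ts] by auto
    obtain s where "s \<in> set ss" "m \<in> set (leaf_labels s)" using less.prems(4) Caret by auto
    then obtain j where j: "j < n" "m \<in> set (leaf_labels (ss ! j))"
      using ss(1) by (metis in_set_conv_nth)
    define xs where "xs = take i ts @ ss @ drop (Suc i) ts"
    have xs: "length xs = 2 * n - 1" "\<forall>x\<in>set xs. nary n x"
      using len ss less.prems(3) by (auto simp: xs_def dest: in_set_takeD in_set_dropD)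
    have t: "Caret ts = two_carets n i xs"
    proof -
      have "take i ts @ Caret ss # drop (Suc i) ts = ts"
        using id_take_nth_drop[of i ts] less.prems(3) len Caret by simp
      then show ?thesis
        unfolding xs_def using two_carets_middle[of "take i ts" i ss n "drop (Suc i) ts"] len ss less.prems(3)
        by simp
    qed
    \<comment> \<open>Dissolving the child \<open>i\<close> puts the subtree with the label
      \<open>m\<close> at position \<open>i + j\<close>; the rotation brings it to the front. The
      lower caret is rebuilt at the last place, which is not the front one as
      \<open>n \<ge> 2\<close>.\<close>
    define ys where "ys = rotate (i + j) xs"
    have ys: "length ys = 2 * n - 1" "\<forall>x\<in>set ys. nary n x" using xs by (simp_all add: ys_def)
    have "ys ! 0 = ss ! j"
      using xs j less.prems(3) len ss by (simp add: ys_def nth_rotate xs_def nth_append)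
    then obtain zs where zs: "ys = ss ! j # zs" using ys n by (cases ys) auto
    define ts1 where "ts1 = take (n - 1) ys @ [Caret (drop (n - 1) ys)]"
    have t1: "two_carets n (n - 1) ys = Caret ts1"
      unfolding ts1_def using two_carets_last[of "take (n - 1) ys" "drop (n - 1) ys" n] ys by simp
    have ts10: "ts1 ! 0 = ss ! j" using n ys by (simp add: ts1_def zs nth_append)
    have r1: "reach n A C (Caret ts) (Caret ts1)"
      unfolding t t1[symmetric] ys_def
      using less.prems xs n by (intro move[of "2 * n - 1"] template_two_carets) (auto simp: t)
    obtain k where "concat (rotate (i + j) (map leaf_labels xs)) = rotate k (concat (map leaf_labels xs))"
      using concat_rotate by blast
    then have l1: "leaf_labels (Caret ts1) = rotate k (leaf_labels (Caret ts))"
      unfolding t t1[symmetric] leaf_labels_two_carets ys_def by (simp add: rotate_map)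
    have na: "nary n (Caret ts1)" unfolding t1[symmetric] using nary_two_carets n ys by simp
    have less1: "carets (ss ! j) < carets (ts ! i)"
    proof -
      have "carets (ss ! j) \<le> sum_list (map carets ss)" using j ss by (intro member_le_sum_list) auto
      then show ?thesis using Caret by simp
    qed
    obtain k' ts' where IH: "reach n A (C * Suc (carets (ss ! j))) (Caret ts1) (Caret (Leaf m # ts'))"
      "nary n (Caret (Leaf m # ts'))" "leaf_labels (Caret (Leaf m # ts')) = rotate k' (leaf_labels (Caret ts1))"
      using less.hyps[of ts1 0] less1 ts10 na l1 less.prems(2) j(2) n by auto
    have "reach n A (C + C * Suc (carets (ss ! j))) (Caret ts) (Caret (Leaf m # ts'))"
      by (rule reach_trans[OF n A r1 IH(1)]) (simp only: l1 set_rotate order_refl)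
    \<comment> \<open>One move per level: the descent enters a proper subtree, which has fewer
      carets.\<close>
    moreover have "C + C * Suc (carets (ss ! j)) \<le> C * Suc (carets (ts ! i))"
      using less1 mult_le_mono2[of "Suc (Suc (carets (ss ! j)))" "Suc (carets (ts ! i))" C] by simp
    ultimately show ?thesis
      using IH(2,3) l1 reach_mono by (intro exI[of _ "k' + k"] exI[of _ ts']) (simp add: rotate_rotate)
  qed
qed

text \<open>The first child \<open>p\<close> is the finished comb and grows at the expense of its
  siblings. Each move regroups without rotating, so the labels keep their order, and it lowers
  \<open>unfold_measure\<close>, which therefore bounds the number of moves.\<close>

lemma straighten:
  "\<lbrakk>nary n (Caret (p # ts)); distinct (leaf_labels (Caret (p # ts))); left_comb p\<rbrakk> \<Longrightarrow>
    \<exists>t. left_comb t \<and> nary n t \<and> leaf_labels t = leaf_labels (Caret (p # ts)) \<and>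
      reach n A (C * unfold_measure ts) (Caret (p # ts)) t"
proof (induction "unfold_measure ts" arbitrary: p ts rule: less_induct)
  case less
  have len: "length ts = n - 1" "ts \<noteq> []" "nary n p" "\<forall>t\<in>set ts. nary n t" using less.prems n by auto
  \<comment> \<open>Common to the three kinds of moves below: a single move at cost
    \<open>C\<close>, then the induction hypothesis.\<close>
  have step: ?case
    if k: "k \<le> 3 * n" and F: "template n k F" "template n k F'" and xs: "length xs = k" "\<forall>x\<in>set xs. nary n x"
      and t: "Caret (p # ts) = F xs" "Caret (q # us) = F' xs" and q: "left_comb q"
      and m: "unfold_measure us < unfold_measure ts" for k F F' xs q us
  proof -
    have r: "reach n A C (Caret (p # ts)) (Caret (q # us))"
      using move[OF k F xs, of 0] less.prems(2) unfolding t by simp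
    have l: "leaf_labels (Caret (q # us)) = leaf_labels (Caret (p # ts))"
      unfolding t using F xs by (simp add: template_def)
    have na: "nary n (Caret (q # us))" unfolding t using F xs by (simp add: template_def)
    obtain t where IH: "left_comb t" "nary n t" "leaf_labels t = leaf_labels (Caret (q # us))"
      "reach n A (C * unfold_measure us) (Caret (q # us)) t"
      using less.hyps[OF m na _ q] less.prems(2) l by metis
    have "reach n A (C + C * unfold_measure us) (Caret (p # ts)) t"
      by (rule reach_trans[OF n A r IH(4)]) (simp only: l order_refl)
    moreover have "C + C * unfold_measure us \<le> C * unfold_measure ts"
      using m mult_le_mono2[of "Suc (unfold_measure us)" "unfold_measure ts" C] by simp
    ultimately show ?thesis using IH l reach_mono by metis
  qed
  have "\<exists>xs x. ts = xs @ [x]" using len by (metis append_butlast_last_id)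
  then obtain ws x where ts: "ts = ws @ [x]" by blast
  have ws: "length ws = n - 2" "\<forall>t\<in>set ws. nary n t" "nary n x" using len ts by auto
  show ?case
  proof (cases "\<exists>ys. Caret ys \<in> set ws")
    case True
    then obtain as ys bs where w: "ws = as @ Caret ys # bs" by (meson split_list)
    define zs where "zs = as @ ys @ bs @ [x]"
    \<comment> \<open>A caret at a middle child is exchanged for one at the last child. The number
      of carets is unchanged and the right spine becomes longer by one.\<close>
    define us where "us = take (n - 2) zs @ [Caret (drop (n - 2) zs)]"
    have ys: "length ys = n" "\<forall>t\<in>set ys. nary n t" using ws w by auto
    have zs: "length zs = 2 * n - 2" "\<forall>t\<in>set zs. nary n t"
      using ws ys by (auto simp: zs_def w)
    have n2: "n - 2 < length zs" using zs n by simp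
    show ?thesis
    proof (rule step[of "2 * n - 1" "two_carets n (Suc (length as))" "two_carets n (n - 1)" "p # zs" p us])
      have i: "Suc (length as) \<le> n - 1" using ws w by simp
      show "template n (2 * n - 1) (two_carets n (Suc (length as)))"
        "template n (2 * n - 1) (two_carets n (n - 1))"
        using template_two_carets n i by auto
      show "Caret (p # ts) = two_carets n (Suc (length as)) (p # zs)"
        using two_carets_middle[of "p # as" "Suc (length as)" ys n "bs @ [x]"] ys by (simp add: zs_def ts w)
      show "Caret (p # us) = two_carets n (n - 1) (p # zs)"
        using two_carets_last[of "p # take (n - 2) zs" "drop (n - 2) zs" n] zs n
        by (simp add: us_def)
      have "right_depth (last us) = Suc (right_depth x)"
        using n2 by (simp add: us_def) (simp add: zs_def)
      moreover have "right_depth (last ts) = right_depth x" by (simp add: ts)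
      moreover have "sum_list (map carets us) = sum_list (map carets ts)"
      proof -
        have "sum_list (map carets us) = Suc (sum_list (map carets (take (n - 2) zs @ drop (n - 2) zs)))"
          by (simp add: us_def del: append_take_drop_id)
        also have "\<dots> = sum_list (map carets ts)"
          by (simp only: append_take_drop_id) (simp add: zs_def ts w)
        finally show ?thesis .
      qed
      moreover have "Suc (right_depth x) \<le> sum_list (map carets ts)"
        using right_depth_le[of x] by (simp add: ts w)
      ultimately show "unfold_measure us < unfold_measure ts" by (simp add: unfold_measure_def)
    qed (use zs len n less.prems(3) in auto)
  next
    case False
    have "\<forall>w\<in>set ws. \<exists>i. w = Leaf i"
    proof
      fix w assume "w \<in> set ws"
      then have "w \<noteq> Caret ys" for ys using False by blast
      then show "\<exists>i. w = Leaf i" by (metis ltree.exhaust)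
    qed
    then have "ws \<in> range (map Leaf)" by (auto simp: ex_map_conv[symmetric])
    then obtain ks where leafs: "ws = map Leaf ks" by blast
    have "length ks = n - 2" using ws leafs by simp
    show ?thesis
    proof (cases x)
      case (Leaf i)
      have "Caret (p # ts) = Caret (p # map Leaf (ks @ [i]))" by (simp add: ts leafs Leaf)
      then have "left_comb (Caret (p # ts))" using left_comb.intros(2)[OF less.prems(3)] by metis
      then show ?thesis using less.prems reach_refl[OF n] by blast
    next
      case (Caret xs)
      have xs: "length xs = n" "\<forall>t\<in>set xs. nary n t" using ws Caret by auto
      then obtain y ss where y: "xs = y # ss" using n by (cases xs) auto
      have ss: "length ss = n - 1" "ss \<noteq> []" using xs y n by auto
      have mts: "sum_list (map carets ts) = Suc (carets y + sum_list (map carets ss))"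
        "right_depth (last ts) = Suc (right_depth (last ss))"
        using ss by (simp_all add: ts leafs Caret y comp_def)
      have rd: "right_depth (last ss) \<le> sum_list (map carets ss)"
      proof -
        have "carets (last ss) \<le> sum_list (map carets ss)" using ss by (intro member_le_sum_list) auto
        then show ?thesis using right_depth_le[of "last ss"] by linarith
      qed
      show ?thesis
      proof (cases y)
        case (Leaf i)
        show ?thesis
        \<comment> \<open>All middle children and the first child of the last one are leaves, so
          they complete the comb by one caret. The siblings lose one caret, counted twice, and their
          right spine loses one level, so the measure drops by one.\<close>
        proof (rule step[of "2 * n - 1" "two_carets n (n - 1)" "two_carets n 0" "(p # ws) @ y # ss"
              "Caret (p # map Leaf (ks @ [i]))" ss])
          show "template n (2 * n - 1) (two_carets n (n - 1))" "template n (2 * n - 1) (two_carets n 0)"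
            using template_two_carets n by auto
          show "Caret (p # ts) = two_carets n (n - 1) ((p # ws) @ y # ss)"
            using two_carets_last[of "p # ws" "y # ss" n] ws ss n by (simp add: ts Caret y)
          show "Caret (Caret (p # map Leaf (ks @ [i])) # ss) = two_carets n 0 ((p # ws) @ y # ss)"
            using two_carets_first[of "p # map Leaf (ks @ [i])" n ss] ws n by (simp add: leafs Leaf)
          show "left_comb (Caret (p # map Leaf (ks @ [i])))" by (rule left_comb.intros(2)[OF less.prems(3)])
          show "unfold_measure ss < unfold_measure ts"
            unfolding unfold_measure_def mts using rd by simp
        qed (use ws ss len xs y n in auto)
      next
        case (Caret us)
        have us: "length us = n" "\<forall>t\<in>set us. nary n t" using xs Caret y by auto
        define zs where "zs = us @ ss"
        have zs: "length zs = 2 * n - 1" "\<forall>t\<in>set zs. nary n t" using us ss xs y by (auto simp: zs_def)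
        \<comment> \<open>The caret at the first child of \<open>x\<close> is exchanged for one at
          its last child, which lengthens the right spine by one at constant number of
          carets.\<close>
        define vs where "vs = ws @ [Caret (take (n - 1) zs @ [Caret (drop (n - 1) zs)])]"
        have n1: "n - 1 < length zs" using zs n by simp
        have "length (p # ws) = n - 1" using ws n by simp
        then have tk: "take (n - 1) ((p # ws) @ zs) = p # ws" "drop (n - 1) ((p # ws) @ zs) = zs"
          by (metis append_eq_conv_conj)+
        show ?thesis
        proof (rule step[of "3 * n - 2" "three_carets n 0" "three_carets n (n - 1)" "(p # ws) @ zs" p vs])
          show "template n (3 * n - 2) (three_carets n 0)" "template n (3 * n - 2) (three_carets n (n - 1))"
            using template_three_carets n by auto
          show "Caret (p # ts) = three_carets n 0 ((p # ws) @ zs)"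
            unfolding three_carets_def tk
            using two_carets_first[of us n ss] us by (simp add: ts \<open>x = Caret xs\<close> y Caret zs_def)
          show "Caret (p # vs) = three_carets n (n - 1) ((p # ws) @ zs)"
            unfolding three_carets_def tk
            using two_carets_last[of "take (n - 1) zs" "drop (n - 1) zs" n] zs
            by (simp add: vs_def del: One_nat_def)
          have "right_depth (last vs) = Suc (Suc (right_depth (last ss)))"
            using n1 ss by (simp add: vs_def) (simp add: zs_def)
          moreover have "sum_list (map carets vs) = sum_list (map carets ts)"
          proof -
            have "sum_list (map carets vs) = Suc (Suc (sum_list (map carets (take (n - 1) zs @ drop (n - 1) zs))))"
              by (simp add: vs_def leafs comp_def del: append_take_drop_id)
            also have "\<dots> = sum_list (map carets ts)"
              by (simp only: append_take_drop_id mts) (simp add: zs_def Caret)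
            finally show ?thesis .
          qed
          ultimately show "unfold_measure vs < unfold_measure ts"
            unfolding unfold_measure_def mts using rd Caret by simp
        qed (use zs ws len n less.prems(3) in auto)
      qed
    qed
  qed
qed

text \<open>The factor 3 is made up of one move per caret for raising the leaf \<open>m\<close> and
  two per caret for straightening, because \<open>unfold_measure\<close> is at most twice the number
  of carets.\<close>

lemma reach_left_comb:
  assumes t: "nary n t" "distinct (leaf_labels t)" "m \<in> set (leaf_labels t)"
  shows "\<exists>t' k. left_comb t' \<and> nary n t' \<and> leaf_labels t' = rotate k (leaf_labels t) \<and>
    hd (leaf_labels t') = m \<and> reach n A (C * (3 * carets t)) t t'"
proof (cases t)
  case (Leaf i)
  then show ?thesis using t reach_refl[OF n t(2)] left_comb.intros(1)[of i]
    by (intro exI[of _ t] exI[of _ 0]) auto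
next
  case (Caret ts)
  have len: "length ts = n" using t Caret by simp
  obtain s where "s \<in> set ts" "m \<in> set (leaf_labels s)" using t(3) Caret by auto
  then obtain i where i: "i < n" "m \<in> set (leaf_labels (ts ! i))"
    using len by (metis in_set_conv_nth)
  obtain k ts' where 1: "reach n A (C * Suc (carets (ts ! i))) t (Caret (Leaf m # ts'))"
    "nary n (Caret (Leaf m # ts'))" "leaf_labels (Caret (Leaf m # ts')) = rotate k (leaf_labels t)"
    using raise_leaf[of ts i m] t i Caret by auto
  have n0: "n > 0" using n by simp
  have d: "distinct (leaf_labels (Caret (Leaf m # ts')))" using 1(3) t(2) by simp
  obtain t' where 2: "left_comb t'" "nary n t'" "leaf_labels t' = leaf_labels (Caret (Leaf m # ts'))"
    "reach n A (C * unfold_measure ts') (Caret (Leaf m # ts')) t'"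
    using straighten[OF 1(2) d left_comb.intros(1)] by blast
  have r: "reach n A (C * Suc (carets (ts ! i)) + C * unfold_measure ts') t t'"
    by (rule reach_trans[OF n A 1(1) 2(4)]) (simp only: 1(3) set_rotate order_refl)
  have "length (leaf_labels (Caret (Leaf m # ts'))) = length (leaf_labels t)" using 1(3) by simp
  then have "Suc ((n - 1) * carets (Caret (Leaf m # ts'))) = Suc ((n - 1) * carets t)"
    by (simp only: length_leaf_labels[OF n0 1(2)] length_leaf_labels[OF n0 t(1)])
  then have "(n - 1) * carets (Caret (Leaf m # ts')) = (n - 1) * carets t" by (rule Suc_inject)
  then have "carets (Caret (Leaf m # ts')) = carets t"
    by (subst (asm) mult_cancel1) (use n in auto)
  then have "unfold_measure ts' \<le> 2 * carets t" by (simp add: unfold_measure_def)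
  moreover have "carets (ts ! i) \<le> sum_list (map carets ts)" using i len by (intro member_le_sum_list) auto
  then have "Suc (carets (ts ! i)) \<le> carets t" using Caret by simp
  ultimately have "Suc (carets (ts ! i)) + unfold_measure ts' \<le> 3 * carets t" by linarith
  then have "C * Suc (carets (ts ! i)) + C * unfold_measure ts' \<le> C * (3 * carets t)"
    by (metis distrib_left mult_le_mono2)
  then have "reach n A (C * (3 * carets t)) t t'" using r reach_mono by blast
  moreover have "hd (leaf_labels t') = m" unfolding 2(3) by simp
  moreover have "leaf_labels t' = rotate k (leaf_labels t)" by (simp only: 2(3) 1(3))
  ultimately show ?thesis using 2(1,2) by blast
qed

text \<open>Both trees are carried to the same left comb, with labels starting at 0, and
  \<open>f\<close> is the first passage followed by the inverse of the second. Each passage costs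
  \<open>3 * C\<close> per caret, and the trees have equally many carets.\<close>

lemma word_length_le_carets:
  assumes r: "represents n (S, R) f"
  shows "word_length (thompson_T n) A f \<le> 6 * C * carets S"
proof -
  interpret group "thompson_T n" by (rule group_thompson_T[OF n])
  have SR: "labelled_tree_pair n (S, R)" "f \<in> carrier (thompson_T n)" "maps_leaves n f S R"
    using r n by (auto simp: represents_iff)
  then have na: "nary n S" "nary n R" and len: "length (leaf_labels S) = length (leaf_labels R)"
    by (auto simp: labelled_tree_pair_def)
  define N where "N = length (leaf_labels S)"
  have "cyclically_labelled S" "cyclically_labelled R" using SR(1) by (simp_all add: labelled_tree_pair_def)
  then obtain a b where l: "leaf_labels S = rotate a [0..<N]" "leaf_labels R = rotate b [0..<N]"
    unfolding cyclically_labelled_def N_def len by blast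
  have lS: "length (leaf_labels S) = Suc ((n - 1) * carets S)" "length (leaf_labels R) = Suc ((n - 1) * carets R)"
    using length_leaf_labels[of n] na n by auto
  have c: "carets R = carets S" using len lS n by simp
  have "N > 0" using lS by (simp add: N_def)
  then have m: "0 \<in> set (leaf_labels S)" "0 \<in> set (leaf_labels R)" unfolding l by auto
  have d: "distinct (leaf_labels S)" "distinct (leaf_labels R)" unfolding l by auto
  obtain t i where t: "left_comb t" "nary n t" "leaf_labels t = rotate i (leaf_labels S)"
    "hd (leaf_labels t) = 0" "reach n A (C * (3 * carets S)) S t"
    using reach_left_comb[OF na(1) d(1) m(1)] by blast
  obtain t' j where t': "left_comb t'" "nary n t'" "leaf_labels t' = rotate j (leaf_labels R)"
    "hd (leaf_labels t') = 0" "reach n A (C * (3 * carets S)) R t'"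
    using reach_left_comb[OF na(2) d(2) m(2)] c by metis
  \<comment> \<open>A cyclic labelling is determined by its first label. This makes the labels of
    the two combs coincide.\<close>
  have zero: "rotate k [0..<N] = [0..<N]" if "hd (rotate k [0..<N]) = 0" for k
  proof -
    have "k mod N = 0" using that \<open>N > 0\<close> by (simp add: hd_rotate_conv_nth)
    then show ?thesis using rotate_id[of k "[0..<N]"] by simp
  qed
  have "leaf_labels t = [0..<N]" "leaf_labels t' = [0..<N]"
    using t(3,4) t'(3,4) zero[of "i + a"] zero[of "j + b"] by (simp_all add: l rotate_rotate)
  then have tt: "t = t'" using left_comb_unique[OF n t(1) t'(1) t(2) t'(2)] by simp
  obtain p where p: "p \<in> carrier (thompson_T n)" "word_length (thompson_T n) A p \<le> C * (3 * carets S)"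
    "maps_leaves n p S t" using t(5) by (auto simp: reach_def)
  obtain q where q: "q \<in> carrier (thompson_T n)" "word_length (thompson_T n) A q \<le> C * (3 * carets S)"
    "maps_leaves n q R t" using t'(5) tt by (auto simp: reach_def)
  let ?q = "inv\<^bsub>thompson_T n\<^esub> q"
  have q': "?q \<in> carrier (thompson_T n)" using q by simp
  have "maps_leaves n ?q t R"
    using q(3) maps_word_inv[OF thompson_T_bij[OF n q(1)]]
    unfolding thompson_T_inv[OF n q(1)] maps_leaves_def by blast
  moreover have "set (leaf_labels S) \<subseteq> set (leaf_labels t)" using t(3) by simp
  ultimately have "maps_leaves n (?q \<otimes>\<^bsub>thompson_T n\<^esub> p) S R"
    using maps_leaves_compose[OF p(3)] thompson_T_mult[OF n q' p(1)] by metis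
  moreover have "set (leaf_labels S) \<subseteq> set (leaf_labels R)" unfolding l by simp
  ultimately have "f = ?q \<otimes>\<^bsub>thompson_T n\<^esub> p"
    using maps_leaves_unique[OF n na _ SR(2) _ SR(3)] q' p(1) by blast
  then have "word_length (thompson_T n) A f \<le> word_length (thompson_T n) A ?q + word_length (thompson_T n) A p"
    using word_length_mult_le[OF A q' p(1)] by simp
  also have "\<dots> \<le> C * (3 * carets S) + C * (3 * carets S)"
    using word_length_inv_le[OF A q(1)] p(2) q(2) by linarith
  finally show ?thesis by simp
qed

end

lemma word_length_le_card_bad_words:
  assumes n: "n \<ge> 2" and A: "finite_generating_set (thompson_T n) A"
  shows "\<exists>c. \<forall>f\<in>carrier (thompson_T n). word_length (thompson_T n) A f \<le> c * card (bad_words n f)"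
proof -
  obtain C where C: "\<forall>k F F' r xs. k \<le> 3 * n \<longrightarrow> template n k F \<longrightarrow> template n k F' \<longrightarrow> length xs = k \<longrightarrow>
    (\<forall>x\<in>set xs. nary n x) \<longrightarrow> distinct (leaf_labels (F xs)) \<longrightarrow> reach n A C (F xs) (F' (rotate r xs))"
    using template_move[OF n, of A] by blast
  interpret moves n A C by unfold_locales (use n A C in blast)+
  have "word_length (thompson_T n) A f \<le> 6 * C * card (bad_words n f)" if f: "f \<in> carrier (thompson_T n)" for f
  proof -
    obtain S R where SR: "represents n (S, R) f" "carets S \<le> card (bad_words n f)"
      using ex_tree_pair[OF n f] by blast
    have "word_length (thompson_T n) A f \<le> 6 * C * carets S" by (rule word_length_le_carets[OF SR(1)])
    also have "\<dots> \<le> 6 * C * card (bad_words n f)" using SR(2) by simp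
    finally show ?thesis .
  qed
  then show ?thesis by blast
qed

theorem theorem3p8:
  fixes n :: nat and A B :: "(real \<Rightarrow> real) set"
  assumes "n \<ge> 2"
    and "finite_generating_set (thompson_T n) A"
    and "finite_generating_set (thompson_T 2) B"
  shows "quasi_isometric_embedding
           (carrier (thompson_T n)) (word_metric (thompson_T n) A)
           (carrier (thompson_T 2)) (word_metric (thompson_T 2) B) (phi_star n)"
proof -
  note n = assms(1)
  have G: "group (thompson_T n)" "group (thompson_T 2)" using group_thompson_T n by auto
  obtain a where a: "\<And>f. f \<in> carrier (thompson_T n) \<Longrightarrow>
      word_length (thompson_T n) A f \<le> a * card (bad_words n f)"
    using word_length_le_card_bad_words[OF n assms(2)] by blast
  obtain b where b: "\<And>g. g \<in> carrier (thompson_T 2) \<Longrightarrow>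
      card (bad_words 2 g) \<le> b * word_length (thompson_T 2) B g"
    using card_bad_words_le_word_length[OF order_refl assms(3)] by blast
  obtain c where c: "\<And>f. f \<in> carrier (thompson_T n) \<Longrightarrow>
      word_length (thompson_T 2) B (conj_map n f) \<le> c * word_length (thompson_T n) A f"
    using word_length_hom_le[OF G conj_map_hom[OF n] assms(2,3)] by blast
  \<comment> \<open>The two maps are only known to agree on the carrier, so closure under
    multiplication is needed to replace one by the other at products.\<close>
  have hom: "phi_star n \<in> hom (thompson_T n) (thompson_T 2)"
    using conj_map_hom[OF n] group.is_monoid[OF G(1)] monoid.m_closed[of "thompson_T n"]
    by (simp add: hom_def Pi_iff phi_star_eq[OF n])
  show ?thesis
  proof (rule quasi_isometric_embedding_wordI[OF G hom])
    fix f assume f: "f \<in> carrier (thompson_T n)"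
    show "word_length (thompson_T 2) B (phi_star n f) \<le> c * word_length (thompson_T n) A f"
      using c[OF f] by (simp add: phi_star_eq[OF n f])
    have "word_length (thompson_T n) A f \<le> a * card (bad_words n f)" by (rule a[OF f])
    also have "\<dots> \<le> a * card (bad_words 2 (conj_map n f))"
      using card_bad_words_conj_map[OF n f] by simp
    also have "\<dots> \<le> a * (b * word_length (thompson_T 2) B (conj_map n f))"
      using b[OF conj_map_closed[OF n f]] by (intro mult_le_mono2)
    finally show "word_length (thompson_T n) A f \<le> (a * b) * word_length (thompson_T 2) B (phi_star n f) + 0"
      by (simp add: phi_star_eq[OF n f])
  qed
qed

end
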